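(* Let $\mathbf 0$ be the empty configuration and $\mathbf 1$ the configuration that is full in $\Lambda^-$ and empty in $\Lambda\setminus\Lambda^-$. Let $\mathcal E_{B_i}^-(r)$ (resp. $\mathcal E_{B_i}^+(r)$) be the set of configurations composed of a single quasi-regular hexagon contained in (resp. containing) $E_{B_i}(r)$. For $L>2r^*+3$ the following hold. (i) If $\delta\in(0,\frac12)$: if $\eta\in\mathcal E_{B_5}^-(r^* )$ then $\lim_{\beta\to\infty}\mathbb P_\eta(\tau_{\mathbf 0}<\tau_{\mathbf 1})=1$; if $\eta\in\mathcal E_{B_0}^+(r^*+1)$ then $\lim_{\beta\to\infty}\mathbb P_\eta(\tau_{\mathbf 1}<\tau_{\mathbf 0})=1$. (ii) If $\delta\in(\frac12,1)$: if $\eta\in\mathcal E_{B_1}^-(r^*+1)$ then $\lim_{\beta\to\infty}\mathbb P_\eta(\tau_{\mathbf 0}<\tau_{\mathbf 1})=1$; if $\eta\in\mathcal E_{B_2}^+(r^*+1)$ then $\lim_{\beta\to\infty}\mathbb P_\eta(\tau_{\mathbf 1}<\tau_{\mathbf 0})=1$.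
   Context: Model. $\mathbb H^2$ is the discrete hexagonal lattice, with dual the triangular lattice $\mathbb T^2$; each site of $\mathbb H^2$ is the center of a triangular face of $\mathbb T^2$ (edge length of $\mathbb{T}^2$ taken as unit of length), two sites are nearest neighbors if they share an edge of $\mathbb H^2$, and $|x-y|$ is the lattice distance. Fix an integer $L\ge 1$ and a regular hexagon of radius (side length) $L$ with sides along $\mathbb T^2$; it contains $6L^2$ sites. $\Lambda\subset\mathbb H^2$ is the union of this hexagon and all sites not in it at lattice distance one from it. Put $\partial^-\Lambda=\{x\in\Lambda:\exists y\notin\Lambda,\ |y-x|=1\}$ and $\Lambda^-=\Lambda\setminus\partial^-\Lambda$ (so $\Lambda^-$ is the hexagon of radius $L$). Configurations: $\eta\in\mathcal X=\{0,1\}^\Lambda$. Hamiltonian: $H(\eta)=-U\sum_{\{x,y\}}\eta(x)\eta(y)+\Delta\sum_{x\in\Lambda}\eta(x)$, the first sum over unordered nearest-neighbor pairs in $\Lambda^-$. Kawasaki dynamics. Let $\bar\Lambda^{*,orie}$ be the set of oriented nearest-neighbor bonds $(x\to y)$ with $x,y\in\Lambda$, or $x\in\partial^-\Lambda,y\notin\Lambda$, or $x\notin\Lambda,y\in\partial^-\Lambda$. $T_b\eta$ is obtained from $\eta$ by exchanging the values at $x,y$ (first case), setting $\eta(x)=0$ (second case), setting $\eta(y)=1$ (third case). The discrete-time Markov chain $(\eta_t)_{t\in\mathbb N}$ has, for $\eta\ne\eta'$, $P(\eta,\eta')=|\bar\Lambda^{*,orie}|^{-1}e^{-\beta[H(\eta')-H(\eta)]_+}$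 if $\eta'=T_b\eta$ for some $b\in\bar\Lambda^{*,orie}$, and $0$ otherwise; $P(\eta,\eta)=1-\sum_{\eta'\ne\eta}P(\eta,\eta')$. Here $\beta>0$ is the inverse temperature. $\mathbb P_\eta$ is the law of the chain started at $\eta$; $\tau_\sigma=\min\{t\ge0:\eta_t=\sigma\}$. Standing assumptions. $U>0$, $\Delta\in(U,\frac32U)$, $3U-2\Delta\ll U$ (it is enough that $3U-2\Delta\le U/100$), $\frac{U}{2(3U-2\Delta)}-\frac12$ is not an integer; $r^*=\lfloor\frac{U}{2(3U-2\Delta)}-\frac12\rfloor$ and $\delta\in(0,1)$ is the fractional part of $\frac{U}{2(3U-2\Delta)}-\frac12$. Geometry. Occupied sites in $\Lambda^-$ are identified with their triangular faces (triangular units). $E(r)=E_{B_0}(r)$ ($r\geq 1$) is the regular hexagon with side (radius) $r$. A bar with larger base $l$ is the set of $2l-1$ triangular units obtained as the difference between an equilateral triangle of side $l$ and one of side $l-1$. $E_{B_1}(r)$ is obtained by attaching a bar with larger base $r$ along its larger base to a side of $E(r)$; for $i=2,\dots,5$, $E_{B_i}(r)$ is obtained from $E_{B_{i-1}}(r)$ by attaching, proceeding clockwise, a bar with larger base $r+1$ along its larger base; $E_{B_6}(r)=E(r+1)$ is obtained from $E_{B_5}(r)$ by attaching a bar of larger base $r+2$. The $E_{B_i}(r)$ are called quasi-regular hexagons and are defined up to rotations by multiples of $\pi/3$ (and translations). A configuration composed of a single quasi-regular hexagon is one whose occupied sites are exactly the faces of a quasi-regular hexagon inside $\Lambda^-$.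 *)

theory Defs
  imports "HOL-Probability.Probability"
begin

section \<open>The hexagonal lattice and its dual\<close>

text \<open>
  The vertex \<open>(a, b)\<close> of the triangular lattice stands for the point
  \<open>a *\<^sub>R (1, 0) + b *\<^sub>R (1/2, sqrt 3 / 2)\<close> of the plane.  A site of the hexagonal lattice is
  the triangular face it is the centre of: \<open>Up a b\<close> is the upward pointing face with lower left
  vertex \<open>(a, b)\<close>, and \<open>Dn a b\<close> the downward pointing face to its right.
\<close>

type_synonym vertex = "int \<times> int"

datatype site = Up int int | Dn int int

fun verts :: "site \<Rightarrow> vertex set" where
  "verts (Up a b) = {(a, b), (a + 1, b), (a, b + 1)}"
| "verts (Dn a b) = {(a + 1, b), (a + 1, b + 1), (a, b + 1)}"

text \<open>An edge of the hexagonal lattice crosses the common edge of two triangular faces.\<close>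

definition nn :: "site \<Rightarrow> site \<Rightarrow> bool" where
  "nn x y \<longleftrightarrow> card (verts x \<inter> verts y) = 2"

definition lattice_dist :: "site \<Rightarrow> site \<Rightarrow> enat" where
  "lattice_dist x y = (INF n \<in> {n. (x, y) \<in> {(u, v). nn u v} ^^ n}. enat n)"

definition faces_in :: "vertex set \<Rightarrow> site set" where
  "faces_in V = {x. verts x \<subseteq> V}"

definition hexagon :: "nat \<Rightarrow> site set" where
  "hexagon r = faces_in {(a, b). \<bar>a\<bar> \<le> int r \<and> \<bar>b\<bar> \<le> int r \<and> \<bar>a + b\<bar> \<le> int r}"


section \<open>Kawasaki dynamics\<close>

definition Lam :: "nat \<Rightarrow> site set" where
  "Lam L = hexagon L \<union> {x. x \<notin> hexagon L \<and> (\<exists>y \<in> hexagon L. lattice_dist x y = 1)}"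

definition Lam_bd :: "nat \<Rightarrow> site set" where
  "Lam_bd L = {x \<in> Lam L. \<exists>y. y \<notin> Lam L \<and> lattice_dist y x = 1}"

definition Lam_minus :: "nat \<Rightarrow> site set" where
  "Lam_minus L = Lam L - Lam_bd L"

type_synonym config = "site \<Rightarrow> nat"

definition configs :: "nat \<Rightarrow> config set" where
  "configs L = Lam L \<rightarrow>\<^sub>E {0, 1}"

text \<open>The product over a two-element set \<open>{x, y}\<close> below is \<open>\<eta> x * \<eta> y\<close>.\<close>

definition hamiltonian :: "nat \<Rightarrow> real \<Rightarrow> real \<Rightarrow> config \<Rightarrow> real" where
  "hamiltonian L U \<Delta> \<eta> =
     - U * (\<Sum>e \<in> {{x, y} | x y. x \<in> Lam_minus L \<and> y \<in> Lam_minus L \<and> nn x y}.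
              \<Prod>z\<in>e. real (\<eta> z))
     + \<Delta> * (\<Sum>x \<in> Lam L. real (\<eta> x))"

definition bonds :: "nat \<Rightarrow> (site \<times> site) set" where
  "bonds L = {(x, y). nn x y \<and>
     (x \<in> Lam L \<and> y \<in> Lam L \<or> x \<in> Lam_bd L \<and> y \<notin> Lam L \<or> x \<notin> Lam L \<and> y \<in> Lam_bd L)}"

definition move :: "nat \<Rightarrow> site \<times> site \<Rightarrow> config \<Rightarrow> config" where
  "move L = (\<lambda>(x, y) \<eta>.
     if x \<in> Lam L \<and> y \<in> Lam L then \<eta>(x := \<eta> y, y := \<eta> x)
     else if x \<in> Lam L then \<eta>(x := 0)
     else \<eta>(y := 1))"

definition jump_prob :: "nat \<Rightarrow> real \<Rightarrow> real \<Rightarrow> real \<Rightarrow> config \<Rightarrow> config \<Rightarrow> real" where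
  "jump_prob L U \<Delta> \<beta> \<eta> \<eta>' =
     (if \<exists>b \<in> bonds L. \<eta>' = move L b \<eta>
      then exp (- \<beta> * max 0 (hamiltonian L U \<Delta> \<eta>' - hamiltonian L U \<Delta> \<eta>)) / real (card (bonds L))
      else 0)"

definition trans_prob :: "nat \<Rightarrow> real \<Rightarrow> real \<Rightarrow> real \<Rightarrow> config \<Rightarrow> config \<Rightarrow> real" where
  "trans_prob L U \<Delta> \<beta> \<eta> \<eta>' =
     (if \<eta>' = \<eta> then 1 - (\<Sum>\<zeta> \<in> configs L - {\<eta>}. jump_prob L U \<Delta> \<beta> \<eta> \<zeta>)
      else jump_prob L U \<Delta> \<beta> \<eta> \<eta>')"

text \<open>Only the values at \<open>\<eta> \<in> configs L\<close> matter; see \<open>pmf_kawasaki_kernel\<close> below.\<close>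

definition kawasaki_kernel :: "nat \<Rightarrow> real \<Rightarrow> real \<Rightarrow> real \<Rightarrow> config \<Rightarrow> config pmf" where
  "kawasaki_kernel L U \<Delta> \<beta> \<eta> = embed_pmf (trans_prob L U \<Delta> \<beta> \<eta>)"


subsection \<open>The law of a Markov chain on its path space\<close>

definition chain_step :: "('a \<Rightarrow> 'a pmf) \<Rightarrow> 'a \<Rightarrow> nat \<Rightarrow> (nat \<Rightarrow> 'a) \<Rightarrow> 'a measure" where
  "chain_step K x n \<omega> = measure_pmf (case n of 0 \<Rightarrow> return_pmf x | Suc m \<Rightarrow> K (\<omega> m))"

text \<open>The measure given by the Ionescu-Tulcea theorem; \<open>emeasure_chain_law\<close> below identifies it.\<close>

definition chain_law :: "('a \<Rightarrow> 'a pmf) \<Rightarrow> 'a \<Rightarrow> (nat \<Rightarrow> 'a) measure" where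
  "chain_law K x =
     projective_family.lim UNIV (Ionescu_Tulcea.CI (chain_step K x) (\<lambda>_. count_space UNIV))
       (\<lambda>_. count_space UNIV)"

definition hitting_time :: "'a \<Rightarrow> (nat \<Rightarrow> 'a) \<Rightarrow> enat" where
  "hitting_time \<sigma> \<omega> = (INF t \<in> {t. \<omega> t = \<sigma>}. enat t)"

definition kawasaki :: "nat \<Rightarrow> real \<Rightarrow> real \<Rightarrow> real \<Rightarrow> config \<Rightarrow> (nat \<Rightarrow> config) measure" where
  "kawasaki L U \<Delta> \<beta> \<eta> = chain_law (kawasaki_kernel L U \<Delta> \<beta>) \<eta>"

definition empty_config :: "nat \<Rightarrow> config" where
  "empty_config L = (\<lambda>x \<in> Lam L. 0)"

definition full_config :: "nat \<Rightarrow> config" where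
  "full_config L = (\<lambda>x \<in> Lam L. if x \<in> Lam_minus L then 1 else 0)"


section \<open>Quasi-regular hexagons\<close>

definition vscale :: "int \<Rightarrow> vertex \<Rightarrow> vertex" where
  "vscale k = (\<lambda>(a, b). (k * a, k * b))"

text \<open>Rotations by \<open>\<pi>/3\<close> about the origin, counterclockwise and clockwise.\<close>

definition rot_ccw :: "vertex \<Rightarrow> vertex" where
  "rot_ccw = (\<lambda>(a, b). (- b, a + b))"

definition rot_cw :: "vertex \<Rightarrow> vertex" where
  "rot_cw = (\<lambda>(a, b). (a + b, - a))"

text \<open>
  The equilateral triangle of side \<open>l\<close> whose base leaves \<open>p\<close> in the direction of the unit lattice
  vector \<open>d\<close>, and which lies to the left of this base.
\<close>

definition triangle :: "vertex \<Rightarrow> vertex \<Rightarrow> nat \<Rightarrow> site set" where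
  "triangle p d l = faces_in {p + vscale (int i) d + vscale (int j) (rot_ccw d) | i j. i + j \<le> l}"

text \<open>The bar whose larger base is the base of the above triangle; the smaller triangle has the same apex.\<close>

definition bar :: "vertex \<Rightarrow> vertex \<Rightarrow> nat \<Rightarrow> site set" where
  "bar p d l = triangle p d l - triangle (p + rot_ccw d) d (l - 1)"

text \<open>
  \<open>quasi_hexagon i r\<close> is \<open>E\<^bsub>B\<^sub>i\<^esub>(r)\<close> for \<open>i \<le> 6\<close>.  The sides of \<open>hexagon r\<close> are run through clockwise,
  so that the exterior is on the left, from the top side on, which leaves \<open>(- r, r)\<close> in
  direction \<open>(1, 0)\<close>.  From the second side on, the side starts one step earlier because of the
  bar attached before it.
\<close>

fun quasi_hexagon :: "nat \<Rightarrow> nat \<Rightarrow> site set" where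
  "quasi_hexagon 0 r = hexagon r"
| "quasi_hexagon (Suc i) r = quasi_hexagon i r \<union>
     (let c = (rot_cw ^^ i) (- int r, int r);
          d = (rot_cw ^^ i) (1, 0)
      in if i = 0 then bar c d r
         else bar (c - d) d (if i < 5 then r + 1 else r + 2))"

text \<open>Equality up to translations and rotations by multiples of \<open>\<pi>/3\<close>.\<close>

definition same_shape :: "site set \<Rightarrow> site set \<Rightarrow> bool" where
  "same_shape S T \<longleftrightarrow>
     (\<exists>k v. verts ` S = (\<lambda>V. (\<lambda>p. (rot_ccw ^^ k) p + v) ` V) ` verts ` T)"

definition quasi_regular :: "site set \<Rightarrow> bool" where
  "quasi_regular Q \<longleftrightarrow> (\<exists>i\<le>5. \<exists>r\<ge>1. same_shape Q (quasi_hexagon i r))"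

definition single_quasi_hexagon :: "nat \<Rightarrow> config \<Rightarrow> bool" where
  "single_quasi_hexagon L \<eta> \<longleftrightarrow> \<eta> \<in> configs L \<and>
     (\<exists>Q. quasi_regular Q \<and> Q \<subseteq> Lam_minus L \<and> {x \<in> Lam L. \<eta> x = 1} = Q)"

text \<open>
  As \<open>E\<^bsub>B\<^sub>i\<^esub>(r)\<close> is defined only up to rotations and translations, containment refers to some copy
  of it.
\<close>

definition E_minus :: "nat \<Rightarrow> nat \<Rightarrow> nat \<Rightarrow> config set" where
  "E_minus L i r = {\<eta>. single_quasi_hexagon L \<eta> \<and>
     (\<exists>S. same_shape S (quasi_hexagon i r) \<and> {x \<in> Lam L. \<eta> x = 1} \<subseteq> S)}"

definition E_plus :: "nat \<Rightarrow> nat \<Rightarrow> nat \<Rightarrow> config set" where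
  "E_plus L i r = {\<eta>. single_quasi_hexagon L \<eta> \<and>
     (\<exists>S. same_shape S (quasi_hexagon i r) \<and> S \<subseteq> {x \<in> Lam L. \<eta> x = 1})}"


section \<open>Critical size\<close>

definition crit_param :: "real \<Rightarrow> real \<Rightarrow> real" where
  "crit_param U \<Delta> = U / (2 * (3 * U - 2 * \<Delta>)) - 1 / 2"

definition crit_radius :: "real \<Rightarrow> real \<Rightarrow> nat" where
  "crit_radius U \<Delta> = nat \<lfloor>crit_param U \<Delta>\<rfloor>"


section \<open>Basic facts\<close>

lemma lattice_dist_eq_1_iff: "lattice_dist x y = 1 \<longleftrightarrow> x \<noteq> y \<and> nn x y"
proof -
  let ?S = "{n. (x, y) \<in> {(u, v). nn u v} ^^ n}"
  have S0: "0 \<in> ?S \<longleftrightarrow> x = y" by auto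
  have S1: "1 \<in> ?S \<longleftrightarrow> nn x y" by auto
  show ?thesis
  proof (cases "?S = {}")
    case True
    then show ?thesis using S1 unfolding lattice_dist_def by (auto simp: top_enat_def one_enat_def)
  next
    case False
    define m where "m = (LEAST n. n \<in> ?S)"
    have m: "m \<in> ?S" "\<And>n. n \<in> ?S \<Longrightarrow> m \<le> n"
      using False LeastI_ex[of "\<lambda>n. n \<in> ?S"] Least_le[of "\<lambda>n. n \<in> ?S"] unfolding m_def by blast+
    have "lattice_dist x y = enat m"
      unfolding lattice_dist_def by (rule antisym, rule INF_lower[OF m(1)], rule INF_greatest)
        (use m(2) in auto)
    moreover have "m = 1 \<longleftrightarrow> x \<noteq> y \<and> nn x y"
    proof
      assume "m = 1"
      then show "x \<noteq> y \<and> nn x y" using m S0 S1 by (metis not_one_le_zero)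
    next
      assume "x \<noteq> y \<and> nn x y"
      then have "m \<le> 1" "m \<noteq> 0" using m S0 S1 by metis+
      then show "m = 1" by simp
    qed
    ultimately show ?thesis by (simp add: one_enat_def)
  qed
qed

lemma nn_commute: "nn x y \<longleftrightarrow> nn y x"
  by (simp add: nn_def Int_commute)

lemma not_nn_refl: "\<not> nn x x"
  by (cases x) (auto simp: nn_def)

lemma nn_Up_Up: "\<not> nn (Up a b) (Up c d)"
  by (auto simp: nn_def Int_insert_left card_insert_if)

lemma nn_Dn_Dn: "\<not> nn (Dn a b) (Dn c d)"
  by (auto simp: nn_def Int_insert_left card_insert_if)

lemma nn_Up_Dn: "nn (Up a b) (Dn c d) \<longleftrightarrow> (c, d) \<in> {(a, b), (a - 1, b), (a, b - 1)}"
  by (auto simp: nn_def Int_insert_left card_insert_if)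

lemma nn_Dn_Up: "nn (Dn c d) (Up a b) \<longleftrightarrow> (c, d) \<in> {(a, b), (a - 1, b), (a, b - 1)}"
  using nn_Up_Dn nn_commute by blast

lemmas nn_simps = nn_Up_Up nn_Dn_Dn nn_Up_Dn nn_Dn_Up

lemma Up_in_hexagon:
  "Up a b \<in> hexagon L \<longleftrightarrow>
     - int L \<le> a \<and> a < int L \<and> - int L \<le> b \<and> b < int L \<and> - int L \<le> a + b \<and> a + b < int L"
  by (auto simp: hexagon_def faces_in_def)

lemma Dn_in_hexagon:
  "Dn a b \<in> hexagon L \<longleftrightarrow>
     - int L \<le> a \<and> a < int L \<and> - int L \<le> b \<and> b < int L \<and>
     - int L \<le> a + b + 1 \<and> a + b + 1 < int L"
  by (auto simp: hexagon_def faces_in_def)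

lemma Lam_eq: "Lam L = hexagon L \<union> {x. \<exists>y\<in>hexagon L. nn x y}"
proof -
  have "x \<noteq> y \<and> nn x y \<longleftrightarrow> nn x y" for x y using not_nn_refl by blast
  then show ?thesis unfolding Lam_def lattice_dist_eq_1_iff by blast
qed

lemma Lam_bd_eq: "Lam_bd L = {x \<in> Lam L. \<exists>y. y \<notin> Lam L \<and> nn x y}"
  unfolding Lam_bd_def lattice_dist_eq_1_iff using nn_commute not_nn_refl by blast

lemma Lam_minus_eq_hexagon: "Lam_minus L = hexagon L"
proof -
  have far: "\<exists>z. nn x z \<and> z \<notin> hexagon L \<and> (\<forall>w. nn z w \<longrightarrow> w \<notin> hexagon L)"
    if x: "x \<notin> hexagon L" "nn x y" "y \<in> hexagon L" for x y
  proof (cases x)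
    case (Up a b)
    then obtain c d where y: "y = Dn c d" using x by (cases y) (auto simp: nn_simps)
    have cd: "c = a \<and> d = b \<or> c = a - 1 \<and> d = b \<or> c = a \<and> d = b - 1"
      using x by (auto simp: Up y nn_simps)
    define z where "z = (if a \<ge> int L \<or> b \<ge> int L then (a, b) else (a - 1, b))"
    have "nn x (Dn (fst z) (snd z))"
      by (auto simp: z_def Up nn_simps)
    moreover have "Dn (fst z) (snd z) \<notin> hexagon L"
      using x cd by (auto simp: z_def Up y Up_in_hexagon Dn_in_hexagon)
    moreover have "w \<notin> hexagon L" if nnw: "nn (Dn (fst z) (snd z)) w" for w
    proof
      assume w: "w \<in> hexagon L"
      obtain p q where pq: "w = Up p q" using nnw by (cases w) (auto simp: nn_simps)
      have "(p, q) \<in> {(fst z, snd z), (fst z + 1, snd z), (fst z, snd z + 1)}"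
        using nnw by (auto simp: pq nn_simps)
      then show False
        using w x(1,3) cd unfolding pq y Up Up_in_hexagon Dn_in_hexagon z_def
        by (simp_all split: if_splits; smt)
    qed
    ultimately show ?thesis by blast
  next
    case (Dn a b)
    then obtain c d where y: "y = Up c d" using x by (cases y) (auto simp: nn_simps)
    have cd: "c = a \<and> d = b \<or> c = a + 1 \<and> d = b \<or> c = a \<and> d = b + 1"
      using x by (auto simp: Dn y nn_simps)
    define z where "z = (if a < - int L \<or> b < - int L then (a, b) else (a + 1, b))"
    have "nn x (Up (fst z) (snd z))"
      by (auto simp: z_def Dn nn_simps)
    moreover have "Up (fst z) (snd z) \<notin> hexagon L"
      using x cd by (auto simp: z_def Dn y Up_in_hexagon Dn_in_hexagon)
    moreover have "w \<notin> hexagon L" if nnw: "nn (Up (fst z) (snd z)) w" for w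
    proof
      assume w: "w \<in> hexagon L"
      obtain p q where pq: "w = Dn p q" using nnw by (cases w) (auto simp: nn_simps)
      have "(p, q) \<in> {(fst z, snd z), (fst z - 1, snd z), (fst z, snd z - 1)}"
        using nnw by (auto simp: pq nn_simps)
      then show False
        using w x(1,3) cd unfolding pq y Dn Up_in_hexagon Dn_in_hexagon z_def
        by (simp_all split: if_splits; smt)
    qed
    ultimately show ?thesis by blast
  qed
  have "x \<in> Lam_bd L" if x: "x \<in> Lam L" "x \<notin> hexagon L" for x
  proof -
    obtain y where "nn x y" "y \<in> hexagon L" using x unfolding Lam_eq by blast
    from far[OF x(2) this] obtain z where
      z: "nn x z" "z \<notin> hexagon L" "\<forall>w. nn z w \<longrightarrow> w \<notin> hexagon L" by blast
    then have "z \<notin> Lam L" unfolding Lam_eq by blast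
    then show ?thesis using z(1) x(1) unfolding Lam_bd_eq by blast
  qed
  moreover have "x \<notin> Lam_bd L" if "x \<in> hexagon L" for x
    using that nn_commute unfolding Lam_bd_eq Lam_eq by blast
  ultimately show ?thesis unfolding Lam_minus_def using Lam_eq by blast
qed

lemma finite_nn: "finite {y. nn x y}"
proof (cases x)
  case (Up a b)
  have "{y. nn x y} \<subseteq> {Dn a b, Dn (a - 1) b, Dn a (b - 1)}"
  proof
    fix y assume "y \<in> {y. nn x y}"
    then show "y \<in> {Dn a b, Dn (a - 1) b, Dn a (b - 1)}" by (cases y) (auto simp: Up nn_simps)
  qed
  then show ?thesis by (rule finite_subset) simp
next
  case (Dn a b)
  have "{y. nn x y} \<subseteq> {Up a b, Up (a + 1) b, Up a (b + 1)}"
  proof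
    fix y assume "y \<in> {y. nn x y}"
    then show "y \<in> {Up a b, Up (a + 1) b, Up a (b + 1)}" by (cases y) (auto simp: Dn nn_simps)
  qed
  then show ?thesis by (rule finite_subset) simp
qed

lemma finite_hexagon: "finite (hexagon L)"
proof -
  let ?I = "{- int L..int L}"
  have "hexagon L \<subseteq> case_prod Up ` (?I \<times> ?I) \<union> case_prod Dn ` (?I \<times> ?I)"
  proof
    fix x assume "x \<in> hexagon L"
    then show "x \<in> case_prod Up ` (?I \<times> ?I) \<union> case_prod Dn ` (?I \<times> ?I)"
      by (cases x) (auto simp: Up_in_hexagon Dn_in_hexagon)
  qed
  then show ?thesis by (rule finite_subset) auto
qed

lemma finite_Lam: "finite (Lam L)"
proof -
  have "Lam L = hexagon L \<union> (\<Union>y\<in>hexagon L. {x. nn y x})"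
    unfolding Lam_eq using nn_commute by blast
  then show ?thesis using finite_nn finite_hexagon by simp
qed

lemma Lam_bd_subset: "Lam_bd L \<subseteq> Lam L"
  by (auto simp: Lam_bd_def)

lemma finite_bonds: "finite (bonds L)"
proof (rule finite_subset)
  let ?A = "Sigma (Lam L) (\<lambda>x. {y. nn x y})"
  show "bonds L \<subseteq> ?A \<union> prod.swap ` ?A"
    using Lam_bd_subset[of L] unfolding bonds_def by (fastforce simp: nn_commute image_iff)
  show "finite (?A \<union> prod.swap ` ?A)"
    using finite_Lam finite_nn by blast
qed

lemma finite_configs: "finite (configs L)"
  unfolding configs_def by (intro finite_PiE finite_Lam) auto

lemma move_in_configs:
  assumes "\<eta> \<in> configs L" "b \<in> bonds L"
  shows "move L b \<eta> \<in> configs L"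
  using assms Lam_bd_subset[of L]
  by (cases b) (auto simp: configs_def bonds_def move_def PiE_iff extensional_def)

lemma jump_prob_nonneg: "0 \<le> jump_prob L U \<Delta> \<beta> \<eta> \<eta>'"
  by (simp add: jump_prob_def)

lemma sum_jump_prob_le_1:
  assumes "\<beta> \<ge> 0"
  shows "(\<Sum>\<zeta> \<in> configs L - {\<eta>}. jump_prob L U \<Delta> \<beta> \<eta> \<zeta>) \<le> 1"
proof -
  let ?S = "(\<lambda>b. move L b \<eta>) ` bonds L" and ?n = "real (card (bonds L))"
  have "(\<Sum>\<zeta> \<in> configs L - {\<eta>}. jump_prob L U \<Delta> \<beta> \<eta> \<zeta>)
      \<le> (\<Sum>\<zeta> \<in> configs L - {\<eta>}. if \<zeta> \<in> ?S then 1 / ?n else 0)"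
    using assms by (intro sum_mono) (auto simp: jump_prob_def intro!: divide_right_mono)
  also have "\<dots> = (\<Sum>\<zeta> \<in> (configs L - {\<eta>}) \<inter> ?S. 1 / ?n)"
    using finite_configs by (intro sum.inter_restrict[symmetric]) auto
  also have "\<dots> \<le> (\<Sum>\<zeta> \<in> ?S. 1 / ?n)"
    using finite_bonds by (intro sum_mono2) auto
  also have "\<dots> = real (card ?S) / ?n" by simp
  also have "\<dots> \<le> 1"
    using card_image_le[OF finite_bonds, of "\<lambda>b. move L b \<eta>" L]
    by (cases "card (bonds L) = 0") (auto simp: divide_le_eq_1)
  finally show ?thesis .
qed

lemma pmf_kawasaki_kernel:
  assumes "\<eta> \<in> configs L" "\<beta> \<ge> 0"
  shows "pmf (kawasaki_kernel L U \<Delta> \<beta> \<eta>) \<eta>' = trans_prob L U \<Delta> \<beta> \<eta> \<eta>'"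
  unfolding kawasaki_kernel_def
proof (rule pmf_embed_pmf)
  let ?f = "trans_prob L U \<Delta> \<beta> \<eta>"
  show nonneg: "0 \<le> ?f \<zeta>" for \<zeta>
    using sum_jump_prob_le_1[OF assms(2)] by (simp add: trans_prob_def jump_prob_nonneg)
  have "?f \<zeta> = 0" if "\<zeta> \<notin> configs L" for \<zeta>
    using that assms(1) move_in_configs by (auto simp: trans_prob_def jump_prob_def split: if_splits)
  then have "(\<integral>\<^sup>+\<zeta>. ennreal (?f \<zeta>) \<partial>count_space UNIV) = (\<Sum>\<zeta>\<in>configs L. ennreal (?f \<zeta>))"
    by (intro nn_integral_count_space'[OF finite_configs]) auto
  also have "\<dots> = ennreal (\<Sum>\<zeta>\<in>configs L. ?f \<zeta>)"
    using nonneg by (simp add: sum_ennreal)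
  also have "(\<Sum>\<zeta>\<in>configs L. ?f \<zeta>) = 1"
    by (subst sum.remove[OF finite_configs assms(1)]) (simp add: trans_prob_def)
  finally show "(\<integral>\<^sup>+\<zeta>. ennreal (?f \<zeta>) \<partial>count_space UNIV) = 1" by simp
qed

context
  fixes K :: "'a \<Rightarrow> 'a pmf" and x :: 'a
begin

interpretation IT: Ionescu_Tulcea "chain_step K x" "\<lambda>_. count_space UNIV"
proof (rule Ionescu_Tulcea.intro)
  fix n
  show "chain_step K x n \<in> measurable (PiM {0..<n} (\<lambda>_. count_space UNIV))
     (subprob_algebra (count_space UNIV))"
  proof (cases n)
    case 0
    then show ?thesis
      by (auto simp: chain_step_def[abs_def] space_subprob_algebra
          intro!: measure_pmf.subprob_space_axioms)
  next
    case (Suc m)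
    have [measurable]: "(\<lambda>\<omega>. \<omega> m) \<in> measurable (PiM {0..<n} (\<lambda>_. count_space UNIV)) (count_space (UNIV :: 'a set))"
      by (rule measurable_component_singleton) (simp add: Suc)
    have [measurable]: "(\<lambda>y. measure_pmf (K y)) \<in> measurable (count_space UNIV) (subprob_algebra (count_space UNIV))"
      by (auto simp: space_subprob_algebra intro!: measure_pmf.subprob_space_axioms)
    show ?thesis
      unfolding chain_step_def[abs_def] by (simp add: Suc) (use Suc in measurable)
  qed
next
  fix n \<omega>
  show "prob_space (chain_step K x n \<omega>)"
    unfolding chain_step_def by (rule prob_space_measure_pmf)
qed

lemma sets_chain_law [measurable_cong]:
  "sets (chain_law K x) = sets (PiM UNIV (\<lambda>_. count_space UNIV))"
  by (simp add: chain_law_def)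

lemma space_chain_law [simp]: "space (chain_law K x) = UNIV"
  by (simp add: chain_law_def space_PiM)

lemma prob_space_chain_law: "prob_space (chain_law K x)"
proof
  interpret CI: prob_space "IT.CI {}" by (rule IT.PF.prob_space_P) simp_all
  let ?S = "space (PiM {} (\<lambda>_::nat. count_space (UNIV :: 'a set)))"
  have "space (chain_law K x) = IT.PF.emb UNIV {} ?S"
    by (auto simp: prod_emb_def space_PiM)
  then have "emeasure (chain_law K x) (space (chain_law K x)) = emeasure (IT.CI {}) ?S"
    unfolding chain_law_def using IT.lim[of "{}" ?S] by simp
  also have "\<dots> = 1"
    using CI.emeasure_space_1 by (simp add: IT.CI_def)
  finally show "emeasure (chain_law K x) (space (chain_law K x)) = 1" .
qed

lemma emeasure_chain_law:
  "emeasure (chain_law K x) {\<omega>. \<forall>t\<le>n. \<omega> t = \<sigma> t} =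
     (if \<sigma> 0 = x then \<Prod>t<n. ennreal (pmf (K (\<sigma> t)) (\<sigma> (Suc t))) else 0)"
proof -
  let ?C = "\<lambda>m. IT.C 0 m (\<lambda>_. undefined)" and ?M = "\<lambda>_::nat. count_space (UNIV :: 'a set)"
  define X where "X m = PiE {0..<m} (\<lambda>t. {\<sigma> t})" for m :: nat
  define c where "c m = ennreal (pmf (case m of 0 \<Rightarrow> return_pmf x | Suc k \<Rightarrow> K (\<sigma> k)) (\<sigma> m))" for m
  have sets_X [measurable]: "X m \<in> sets (PiM {0..<m} ?M)" for m
    unfolding X_def by (intro sets_PiM_I_finite) auto
  have upd: "fun_upd \<omega> m y \<in> X (Suc m) \<longleftrightarrow> \<omega> \<in> X m \<and> y = \<sigma> m"
    if "\<omega> \<in> space (PiM {0..<m} ?M)" for \<omega> m y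
    using that unfolding X_def by (auto simp: PiE_iff extensional_def space_PiM less_Suc_eq)
  have eP: "emeasure (IT.eP m \<omega>) (X (Suc m)) = c m * indicator (X m) \<omega>"
    if \<omega>: "\<omega> \<in> space (PiM {0..<m} ?M)" for m \<omega>
  proof -
    have "(\<lambda>y. fun_upd \<omega> m y) -` X (Suc m) \<inter> space (count_space UNIV) = (if \<omega> \<in> X m then {\<sigma> m} else {})"
      using upd[OF \<omega>] by auto
    moreover have "\<omega> k = \<sigma> k" if "m = Suc k" "\<omega> \<in> X m" for k
      using that by (auto simp: X_def)
    ultimately show ?thesis
      by (subst IT.emeasure_eP[OF \<omega> sets_X])
         (auto simp: c_def chain_step_def emeasure_pmf_single split: nat.split)
  qed
  have C: "emeasure (?C m) (X m) = (\<Prod>t<m. c t)" for m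
  proof (induction m)
    case 0
    have "(\<lambda>_. undefined) \<in> X 0" by (simp add: X_def)
    then show ?case using sets_X[of 0] by simp
  next
    case (Suc m)
    have sp: "space (?C m) = space (PiM {0..<m} ?M)" using IT.space_C[of "\<lambda>_. undefined" 0 m] by simp
    have st: "sets (?C m) = sets (PiM {0..<m} ?M)" using IT.sets_C[of "\<lambda>_. undefined" 0 m] by simp
    have "emeasure (?C (Suc m)) (X (Suc m)) = (\<integral>\<^sup>+\<omega>. emeasure (IT.eP m \<omega>) (X (Suc m)) \<partial>?C m)"
    proof -
      have "space (?C m) \<noteq> {}" by (simp add: sp)
      moreover have "IT.eP m \<in> measurable (?C m) (subprob_algebra (PiM {0..<Suc m} ?M))"
        using IT.measurable_eP[of m] by (simp only: measurable_cong_sets[OF st refl])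
      ultimately have "emeasure (?C m \<bind> IT.eP m) (X (Suc m)) =
          (\<integral>\<^sup>+\<omega>. emeasure (IT.eP m \<omega>) (X (Suc m)) \<partial>?C m)"
        using sets_X by (rule emeasure_bind)
      then show ?thesis by simp
    qed
    also have "\<dots> = (\<integral>\<^sup>+\<omega>. c m * indicator (X m) \<omega> \<partial>?C m)"
      by (intro nn_integral_cong) (simp add: eP sp)
    also have "\<dots> = c m * emeasure (?C m) (X m)"
      using sets_X st by (intro nn_integral_cmult_indicator) simp
    finally show ?case using Suc.IH by (simp add: mult.commute)
  qed
  have "{\<omega>. \<forall>t\<le>n. \<omega> t = \<sigma> t} = IT.PF.emb UNIV {0..<Suc n} (X (Suc n))"
    by (auto simp: X_def prod_emb_iff PiE_iff less_Suc_eq_le)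
  then have "emeasure (chain_law K x) {\<omega>. \<forall>t\<le>n. \<omega> t = \<sigma> t} = emeasure (IT.CI {0..<Suc n}) (X (Suc n))"
    unfolding chain_law_def using IT.lim[OF _ sets_X] by simp
  also have "\<dots> = emeasure (?C (Suc n)) (X (Suc n))"
    using sets_X by (subst IT.emeasure_CI[of _ "Suc n"]) (auto simp: X_def prod_emb_PiE PiE_iff)
  also have "\<dots> = (\<Prod>t<Suc n. c t)" by (rule C)
  also have "\<dots> = c 0 * (\<Prod>t<n. c (Suc t))" by (rule prod.lessThan_Suc_shift)
  finally show ?thesis by (auto simp: c_def)
qed

end

end

theory Submission
  imports Defs
begin

text \<open>
  Write \<open>\<epsilon> = 3 U - 2 \<Delta>\<close>.  A cluster of \<open>n\<close> faces with perimeter \<open>p\<close> has energy \<open>(U p - \<epsilon> n) / 2\<close>, and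
  \<open>p\<^sup>2 \<ge> 6 n\<close>.  Attaching a bar to a hexagon \<open>D\<close> costs at most \<open>3 \<Delta> - 2 U\<close>, the energy of two attached
  particles and a free one, and changes the energy of \<open>D\<close> by \<open>(U - \<epsilon> (2 l - 1)) / 2\<close>.  The energy of
  \<open>E\<^bsub>B\<^sub>i\<^esub>(r)\<close> is therefore maximal at a single \<open>(r, i)\<close>, which is \<open>(r\<^sup>*, 5)\<close> or
  \<open>(r\<^sup>* + 1, 1)\<close> according to \<open>\<delta>\<close>.  Let \<open>\<Gamma>\<close> be this maximum plus \<open>3 \<Delta> - 2 U\<close>.  Smaller droplets dissolve
  and larger ones grow along paths below \<open>\<Gamma>\<close>.  Conversely the isoperimetric inequality shows that the
  number of particles cannot pass from \<open>n + 2\<close> to \<open>n + 3\<close>, where \<open>n\<close> is the area of the critical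
  droplet, without reaching the energy \<open>\<Gamma>\<close>.  The Dirichlet principle turns this gap
  into the statement about hitting probabilities.
\<close>

section \<open>Hitting probabilities of reversible chains\<close>

text \<open>With \<open>R\<close> for the critical radius,
  \<open>U = \<epsilon> * (2 * R + 1 + 2 * \<delta>)\<close>. Hence bars with larger base up to
  \<open>R + 1\<close> cost energy, and those with larger base from \<open>R + 2\<close> on lower
  it. Near the critical size one base \<open>R + 2\<close> is followed by one base
  \<open>R + 1\<close>: completing the hexagon of radius \<open>R + 1\<close> lowers the energy by
  \<open>\<epsilon> * (1 - \<delta>)\<close>, the next bar raises it by
  \<open>\<epsilon> * \<delta>\<close>. The sign of \<open>2 * \<delta> - 1\<close> decides which of
  the two tops is the higher one.

  The cut is by particle number alone, so no saddle has to be identified: hops keep the number, and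
  it changes only in the boundary layer. The bound at the cut is exact because of parity. Two
  particles more than in the critical droplet force a perimeter above its perimeter
  \<open>P\<close>; since the perimeter has the parity of the number of particles, it is at least
  \<open>P + 2\<close>, the perimeter of the droplet with two particles attached.

  The obstacle to growth is the wall: a droplet may touch it anywhere, so bars cannot always be
  attached in clockwise order, and a long side away from the wall has to be found instead.\<close>

fun hits_before :: "'a \<Rightarrow> 'a \<Rightarrow> 'a list \<Rightarrow> bool" where
  "hits_before a b [] \<longleftrightarrow> False"
| "hits_before a b (x # xs) \<longleftrightarrow> x = a \<or> x \<noteq> b \<and> hits_before a b xs"

lemma hits_before_prefix:
  "hits_before a b (map \<omega> [m..<m + n]) \<longleftrightarrow>
     (\<exists>k\<in>{m..<m + n}. \<omega> k = a \<and> (\<forall>j\<in>{m..<k}. \<omega> j \<noteq> b))"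
proof (induction n arbitrary: m)
  case (Suc n)
  have "[m..<m + Suc n] = m # [Suc m..<Suc m + n]" by (simp add: upt_conv_Cons)
  then have "hits_before a b (map \<omega> [m..<m + Suc n]) \<longleftrightarrow>
     \<omega> m = a \<or> \<omega> m \<noteq> b \<and> (\<exists>k\<in>{Suc m..<Suc m + n}. \<omega> k = a \<and> (\<forall>j\<in>{Suc m..<k}. \<omega> j \<noteq> b))"
    using Suc.IH[of "Suc m"] by simp
  also have "\<dots> \<longleftrightarrow> (\<exists>k\<in>{m..<m + Suc n}. \<omega> k = a \<and> (\<forall>j\<in>{m..<k}. \<omega> j \<noteq> b))"
  proof
    assume "\<omega> m = a \<or> \<omega> m \<noteq> b \<and> (\<exists>k\<in>{Suc m..<Suc m + n}. \<omega> k = a \<and> (\<forall>j\<in>{Suc m..<k}. \<omega> j \<noteq> b))"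
    then show "\<exists>k\<in>{m..<m + Suc n}. \<omega> k = a \<and> (\<forall>j\<in>{m..<k}. \<omega> j \<noteq> b)"
    proof (elim disjE conjE bexE)
      assume "\<omega> m = a" then show ?thesis by (intro bexI[of _ m]) auto
    next
      fix k assume "\<omega> m \<noteq> b" "k \<in> {Suc m..<Suc m + n}" "\<omega> k = a" "\<forall>j\<in>{Suc m..<k}. \<omega> j \<noteq> b"
      then show ?thesis by (intro bexI[of _ k]) (auto simp: le_eq_less_or_eq Suc_le_eq)
    qed
  next
    assume "\<exists>k\<in>{m..<m + Suc n}. \<omega> k = a \<and> (\<forall>j\<in>{m..<k}. \<omega> j \<noteq> b)"
    then obtain k where k: "k \<in> {m..<m + Suc n}" "\<omega> k = a" "\<forall>j\<in>{m..<k}. \<omega> j \<noteq> b" by blast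
    show "\<omega> m = a \<or> \<omega> m \<noteq> b \<and> (\<exists>k\<in>{Suc m..<Suc m + n}. \<omega> k = a \<and> (\<forall>j\<in>{Suc m..<k}. \<omega> j \<noteq> b))"
    proof (cases "k = m")
      case False
      then show ?thesis using k by (intro disjI2 conjI bexI[of _ k]) auto
    qed (use k in auto)
  qed
  finally show ?case .
qed auto

text \<open>Which of the two times comes first is decided at a finite time, so the event is an
  increasing union of events that depend on finitely many coordinates. This reduces its probability
  to limits of finite sums.\<close>

lemma hitting_time_less_iff:
  assumes "a \<noteq> b"
  shows "hitting_time a \<omega> < hitting_time b \<omega> \<longleftrightarrow> (\<exists>n. hits_before a b (map \<omega> [0..<Suc n]))"
proof -
  have "hitting_time a \<omega> < hitting_time b \<omega> \<longleftrightarrow> (\<exists>k. \<omega> k = a \<and> enat k < hitting_time b \<omega>)"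
    by (auto simp: hitting_time_def Inf_less_iff)
  also have "\<dots> \<longleftrightarrow> (\<exists>k. \<omega> k = a \<and> (\<forall>j<k. \<omega> j \<noteq> b))"
  proof (intro ex_cong1 conj_cong refl)
    fix k assume a: "\<omega> k = a"
    show "enat k < hitting_time b \<omega> \<longleftrightarrow> (\<forall>j<k. \<omega> j \<noteq> b)"
    proof
      assume "enat k < hitting_time b \<omega>"
      then show "\<forall>j<k. \<omega> j \<noteq> b"
        unfolding hitting_time_def by (metis (mono_tags, lifting) INF_lower enat_ord_simps(2)
            leD mem_Collect_eq order_less_le_trans order.strict_trans)
    next
      assume *: "\<forall>j<k. \<omega> j \<noteq> b"
      \<comment> \<open>The bound is \<open>Suc k\<close> and not only \<open>k\<close> because
        \<open>a \<noteq> b\<close> and the path is at \<open>a\<close> at time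
        \<open>k\<close>.\<close>
      have "enat (Suc k) \<le> hitting_time b \<omega>" unfolding hitting_time_def
      proof (rule INF_greatest)
        fix t assume "t \<in> {t. \<omega> t = b}"
        then have "\<not> t < k" "t \<noteq> k" using * a assms by auto
        then show "enat (Suc k) \<le> enat t" by simp
      qed
      then show "enat k < hitting_time b \<omega>" by (metis Suc_ile_eq)
    qed
  qed
  also have "\<dots> \<longleftrightarrow> (\<exists>n. hits_before a b (map \<omega> [0..<Suc n]))"
    using hits_before_prefix[of a b \<omega> 0] by (fastforce simp del: upt_Suc)
  finally show ?thesis .
qed

section \<open>Finite chains: path probabilities and harmonicity of hitting probabilities\<close>

fun path_weight :: "('a \<Rightarrow> 'a pmf) \<Rightarrow> 'a \<Rightarrow> 'a list \<Rightarrow> real" where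
  "path_weight K x [] = 1"
| "path_weight K x (y # ys) = pmf (K x) y * path_weight K y ys"

lemma path_weight_eq_prod:
  "path_weight K x ys = (\<Prod>t<length ys. pmf (K ((x # ys) ! t)) ((x # ys) ! Suc t))"
proof (induction ys arbitrary: x)
  case (Cons y ys)
  show ?case using Cons[of y] by (simp add: prod.lessThan_Suc_shift del: prod.lessThan_Suc)
qed simp

lemma prefix_eq_iff:
  "map \<omega> [0..<length xs] = xs \<longleftrightarrow> (\<forall>t<length xs. \<omega> t = xs ! t)"
proof
  assume eq: "map \<omega> [0..<length xs] = xs"
  show "\<forall>t<length xs. \<omega> t = xs ! t"
  proof (intro allI impI)
    fix t assume "t < length xs"
    then have "map \<omega> [0..<length xs] ! t = \<omega> t" by simp
    then show "\<omega> t = xs ! t" by (simp only: eq)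
  qed
qed (auto intro: nth_equalityI)

lemma measure_cylinder:
  "measure (chain_law K x) {\<omega>. map \<omega> [0..<Suc (length ys)] = y # ys} =
     (if y = x then path_weight K x ys else 0)"
proof -
  have "{\<omega>. map \<omega> [0..<Suc (length ys)] = y # ys} = {\<omega>. \<forall>t\<le>length ys. \<omega> t = (y # ys) ! t}"
    using prefix_eq_iff[of _ "y # ys"] by (auto simp: less_Suc_eq_le)
  then have "emeasure (chain_law K x) {\<omega>. map \<omega> [0..<Suc (length ys)] = y # ys} =
      (if y = x then \<Prod>t<length ys. ennreal (pmf (K ((y # ys) ! t)) ((y # ys) ! Suc t)) else 0)"
    using emeasure_chain_law[of K x "length ys" "\<lambda>t. (y # ys) ! t"] by simp
  also have "\<dots> = ennreal (if y = x then path_weight K x ys else 0)"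
    by (simp add: path_weight_eq_prod prod_ennreal)
  finally show ?thesis
    by (simp add: measure_def path_weight_eq_prod prod_nonneg)
qed



definition words :: "'a set \<Rightarrow> nat \<Rightarrow> 'a list set" where
  "words S n = {ys. set ys \<subseteq> S \<and> length ys = n}"

lemma finite_words: "finite S \<Longrightarrow> finite (words S n)"
  unfolding words_def by (rule finite_lists_length_eq)

lemma words_0: "words S 0 = {[]}"
  by (auto simp: words_def)

lemma words_Suc: "words S (Suc n) = (\<lambda>(y, ys). y # ys) ` (S \<times> words S n)"
  by (force simp: words_def length_Suc_conv image_iff)

lemma sum_words_Suc:
  "(\<Sum>ys\<in>words S (Suc n). f ys) = (\<Sum>y\<in>S. \<Sum>ys\<in>words S n. f (y # ys))"
proof -
  have "inj_on (\<lambda>(y, ys). y # ys) (S \<times> words S n)" by (auto intro: inj_onI)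
  then show ?thesis
    by (simp add: words_Suc sum.reindex sum.cartesian_product case_prod_unfold)
qed

locale finite_chain =
  fixes K :: "'a \<Rightarrow> 'a pmf" and S :: "'a set"
  assumes finite_S: "finite S" and closed: "\<And>x. x \<in> S \<Longrightarrow> set_pmf (K x) \<subseteq> S"
begin

lemma sum_pmf_S: "x \<in> S \<Longrightarrow> (\<Sum>y\<in>S. pmf (K x) y) = 1"
  using closed finite_S by (intro sum_pmf_eq_1) auto

lemma sum_path_weight: "x \<in> S \<Longrightarrow> (\<Sum>ys\<in>words S n. path_weight K x ys) = 1"
  by (induction n arbitrary: x)
     (simp_all add: words_0 sum_words_Suc sum_pmf_S flip: sum_distrib_left)

text \<open>The probability of reaching \<open>a\<close> before \<open>b\<close> within
  \<open>n\<close> steps, as a sum over words. In this form the first-step equation is an identity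
  of finite sums, and the limit in \<open>n\<close> carries it over to the path measure.\<close>

definition win_prob_upto :: "'a \<Rightarrow> 'a \<Rightarrow> nat \<Rightarrow> 'a \<Rightarrow> real" where
  "win_prob_upto a b n x = (\<Sum>ys\<in>words S n. of_bool (hits_before a b (x # ys)) * path_weight K x ys)"

definition win_prob :: "'a \<Rightarrow> 'a \<Rightarrow> 'a \<Rightarrow> real" where
  "win_prob a b x = measure (chain_law K x) {\<omega>. hitting_time a \<omega> < hitting_time b \<omega>}"

lemma measurable_coordinate [measurable]:
  "(\<lambda>\<omega>. \<omega> k) \<in> measurable (chain_law K x) (count_space UNIV)"
  by (simp add: measurable_cong_sets[OF sets_chain_law refl] measurable_component_singleton)

lemma sets_hits_before [measurable]:
  "{\<omega>. hits_before a b (map \<omega> [0..<n])} \<in> sets (chain_law K x)"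
proof -
  have "Measurable.pred (chain_law K x)
      (\<lambda>\<omega>. \<exists>k\<in>{0..<n}. \<omega> k = a \<and> (\<forall>j\<in>{0..<k}. \<omega> j \<noteq> b))"
    by measurable
  then have "{\<omega> \<in> space (chain_law K x). \<exists>k\<in>{0..<n}. \<omega> k = a \<and> (\<forall>j\<in>{0..<k}. \<omega> j \<noteq> b)} \<in> sets (chain_law K x)"
    by (rule predE)
  then show ?thesis using hits_before_prefix[of a b _ 0 n] by simp
qed

lemma sets_prefix_eq [measurable]: "{\<omega>. map \<omega> [0..<n] = xs} \<in> sets (chain_law K x)"
proof (cases "length xs = n")
  case True
  have "Measurable.pred (chain_law K x) (\<lambda>\<omega>. \<forall>t\<in>{..<n}. \<omega> t = xs ! t)"
    by measurable
  then have "{\<omega> \<in> space (chain_law K x). \<forall>t\<in>{..<n}. \<omega> t = xs ! t} \<in> sets (chain_law K x)"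
    by (rule predE)
  moreover have "{\<omega> \<in> space (chain_law K x). \<forall>t\<in>{..<n}. \<omega> t = xs ! t} = {\<omega>. map \<omega> [0..<n] = xs}"
    using True prefix_eq_iff[of _ xs] by auto
  ultimately show ?thesis by simp
next
  case False
  then have "{\<omega>. map \<omega> [0..<n] = xs} = {}" by auto
  then show ?thesis by simp
qed

lemma measure_hits_before:
  assumes "x \<in> S"
  shows "measure (chain_law K x) {\<omega>. hits_before a b (map \<omega> [0..<Suc n])} = win_prob_upto a b n x"
proof -
  interpret P: prob_space "chain_law K x" by (rule prob_space_chain_law)
  define cyl where "cyl ys = {\<omega>. map \<omega> [0..<Suc n] = x # ys}" for ys
  have m: "measure (chain_law K x) (\<Union>ys\<in>W. cyl ys) = (\<Sum>ys\<in>W. path_weight K x ys)"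
    if W: "W \<subseteq> words S n" for W
  proof -
    have "measure (chain_law K x) (\<Union>ys\<in>W. cyl ys) = (\<Sum>ys\<in>W. measure (chain_law K x) (cyl ys))"
    proof (rule P.finite_measure_finite_Union)
      show "finite W" using W finite_words finite_S finite_subset by blast
      show "cyl ` W \<subseteq> P.events" unfolding cyl_def using sets_prefix_eq by blast
      show "disjoint_family_on cyl W" unfolding disjoint_family_on_def cyl_def by (auto simp del: upt_Suc)
    qed
    also have "\<dots> = (\<Sum>ys\<in>W. path_weight K x ys)"
    proof (rule sum.cong[OF refl])
      fix ys assume "ys \<in> W"
      then have "length ys = n" using W by (auto simp: words_def)
      then show "measure (chain_law K x) (cyl ys) = path_weight K x ys"
        using measure_cylinder[of K x ys x] by (simp add: cyl_def del: upt_Suc)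
    qed
    finally show ?thesis .
  qed
  \<comment> \<open>The paths that stay in \<open>S\<close> for \<open>n\<close> steps have full
    measure, which cuts the event down to finitely many cylinders.\<close>
  define A where "A = (\<Union>ys\<in>words S n. cyl ys)"
  have A: "measure (chain_law K x) A = 1"
    using m[OF subset_refl] sum_path_weight[OF assms] by (simp add: A_def)
  have sA: "A \<in> P.events" unfolding A_def cyl_def
    using finite_words[OF finite_S] sets_prefix_eq by blast
  let ?E = "{\<omega>. hits_before a b (map \<omega> [0..<Suc n])}"
  have "measure (chain_law K x) ?E = measure (chain_law K x) (?E \<inter> A)"
  proof (rule P.finite_measure_eq_AE)
    have "AE \<omega> in chain_law K x. \<omega> \<in> A" using A sA by (simp add: P.prob_eq_1)
    then show "AE \<omega> in chain_law K x. (\<omega> \<in> ?E) = (\<omega> \<in> ?E \<inter> A)" by auto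
  qed (use sA in measurable)
  also have "?E \<inter> A = (\<Union>ys\<in>{ys\<in>words S n. hits_before a b (x # ys)}. cyl ys)"
    by (auto simp: A_def cyl_def simp del: upt_Suc)
  also have "measure (chain_law K x) \<dots> = win_prob_upto a b n x"
    by (subst m) (auto simp: win_prob_upto_def finite_words[OF finite_S]
        simp del: hits_before.simps intro!: sum.mono_neutral_cong_left)
  finally show ?thesis .
qed

lemma win_prob_upto_Suc:
  assumes "x \<noteq> a" "x \<noteq> b"
  shows "win_prob_upto a b (Suc n) x = (\<Sum>z\<in>S. pmf (K x) z * win_prob_upto a b n z)"
  using assms by (simp add: win_prob_upto_def sum_words_Suc sum_distrib_left mult_ac)

lemma win_prob_upto_tendsto:
  assumes "a \<noteq> b" "x \<in> S"
  shows "(\<lambda>n. win_prob_upto a b n x) \<longlonglongrightarrow> win_prob a b x"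
proof -
  interpret P: prob_space "chain_law K x" by (rule prob_space_chain_law)
  define E where "E n = {\<omega>. hits_before a b (map \<omega> [0..<Suc n])}" for n
  have "incseq E"
  proof (rule incseq_SucI, rule subsetI)
    fix n \<omega> assume "\<omega> \<in> E n"
    then show "\<omega> \<in> E (Suc n)"
      using hits_before_prefix[of a b \<omega> 0 "Suc n"] hits_before_prefix[of a b \<omega> 0 "Suc (Suc n)"]
      unfolding E_def by (auto simp del: upt_Suc)
  qed
  moreover have "range E \<subseteq> P.events" unfolding E_def using sets_hits_before by blast
  ultimately have "(\<lambda>n. measure (chain_law K x) (E n)) \<longlonglongrightarrow> measure (chain_law K x) (\<Union>n. E n)"
    by (intro P.finite_Lim_measure_incseq)
  moreover have "(\<Union>n. E n) = {\<omega>. hitting_time a \<omega> < hitting_time b \<omega>}"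
    using hitting_time_less_iff[OF assms(1)] by (auto simp: E_def simp del: upt_Suc)
  moreover have "measure (chain_law K x) (E n) = win_prob_upto a b n x" for n
    unfolding E_def by (rule measure_hits_before[OF assms(2)])
  ultimately show ?thesis by (simp add: win_prob_def)
qed

lemma win_prob_harmonic:
  assumes "a \<noteq> b" "x \<in> S" "x \<noteq> a" "x \<noteq> b"
  shows "win_prob a b x = (\<Sum>z\<in>S. pmf (K x) z * win_prob a b z)"
proof (rule LIMSEQ_unique)
  show "(\<lambda>n. win_prob_upto a b (Suc n) x) \<longlonglongrightarrow> win_prob a b x"
    using win_prob_upto_tendsto[OF assms(1,2)] by (rule LIMSEQ_Suc)
  show "(\<lambda>n. win_prob_upto a b (Suc n) x) \<longlonglongrightarrow> (\<Sum>z\<in>S. pmf (K x) z * win_prob a b z)"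
    unfolding win_prob_upto_Suc[OF assms(3,4)]
    using win_prob_upto_tendsto[OF assms(1)] by (intro tendsto_sum tendsto_mult tendsto_const)
qed

lemma win_prob_target:
  assumes "a \<noteq> b" "a \<in> S"
  shows "win_prob a b a = 1"
proof -
  have "win_prob_upto a b n a = 1" for n
    by (simp add: win_prob_upto_def sum_path_weight[OF assms(2)])
  then show ?thesis
    using win_prob_upto_tendsto[OF assms] by (simp add: LIMSEQ_const_iff)
qed

lemma win_prob_avoided:
  assumes "a \<noteq> b" "b \<in> S"
  shows "win_prob a b b = 0"
proof -
  have "win_prob_upto a b n b = 0" for n
    using assms(1) by (simp add: win_prob_upto_def)
  then show ?thesis
    using win_prob_upto_tendsto[OF assms] by (simp add: LIMSEQ_const_iff)
qed

end

section \<open>Reversible chains: the Dirichlet form and a bound from a cut and a path\<close>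

locale reversible_chain = finite_chain +
  fixes c :: "'a \<Rightarrow> 'a \<Rightarrow> real" and \<mu> :: "'a \<Rightarrow> real"
  assumes conductance: "\<And>x y. x \<in> S \<Longrightarrow> y \<in> S \<Longrightarrow> c x y = \<mu> x * pmf (K x) y"
    and sym: "\<And>x y. x \<in> S \<Longrightarrow> y \<in> S \<Longrightarrow> c x y = c y x"
    and c_nonneg: "\<And>x y. x \<in> S \<Longrightarrow> y \<in> S \<Longrightarrow> 0 \<le> c x y"
begin

text \<open>Ordered pairs are summed, so this is twice the usual Dirichlet form.\<close>

definition dirichlet :: "('a \<Rightarrow> real) \<Rightarrow> real" where
  "dirichlet f = (\<Sum>x\<in>S. \<Sum>y\<in>S. c x y * (f x - f y)\<^sup>2)"

lemma dirichlet_term_le: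
  assumes "x \<in> S" "y \<in> S"
  shows "c x y * (f x - f y)\<^sup>2 \<le> dirichlet f"
proof -
  have "c x y * (f x - f y)\<^sup>2 \<le> (\<Sum>y\<in>S. c x y * (f x - f y)\<^sup>2)"
    using assms c_nonneg finite_S by (intro member_le_sum) auto
  also have "\<dots> \<le> dirichlet f" unfolding dirichlet_def
    using assms c_nonneg finite_S
    by (intro member_le_sum[where f = "\<lambda>x. \<Sum>y\<in>S. c x y * (f x - f y)\<^sup>2"]) (auto intro!: sum_nonneg)
  finally show ?thesis .
qed

lemma dirichlet_nonneg: "0 \<le> dirichlet f"
  unfolding dirichlet_def using c_nonneg by (auto intro!: sum_nonneg)

text \<open>Pythagoras: for \<open>g = f - u\<close> the mixed term is a multiple of the sum over
  \<open>x\<close> of \<open>g x\<close> times the flow of \<open>u\<close> out of \<open>x\<close>.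
  Each summand vanishes, on \<open>B\<close> because \<open>g\<close> does, elsewhere because
  \<open>u\<close> is harmonic. Hence
  \<open>dirichlet f = dirichlet u + dirichlet g\<close>.\<close>

lemma dirichlet_principle:
  assumes harm: "\<And>x. x \<in> S \<Longrightarrow> x \<notin> B \<Longrightarrow> u x = (\<Sum>y\<in>S. pmf (K x) y * u y)"
    and eq: "\<And>x. x \<in> B \<Longrightarrow> f x = u x"
  shows "dirichlet u \<le> dirichlet f"
proof -
  define g where "g x = f x - u x" for x
  have zero: "g x * (\<Sum>y\<in>S. c x y * (u x - u y)) = 0" if x: "x \<in> S" for x
  proof (cases "x \<in> B")
    case True
    then show ?thesis by (simp add: g_def eq)
  next
    case False
    have "(\<Sum>y\<in>S. c x y * (u x - u y)) = \<mu> x * (u x * (\<Sum>y\<in>S. pmf (K x) y) - (\<Sum>y\<in>S. pmf (K x) y * u y))"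
      using x by (simp add: conductance sum_distrib_left sum_subtractf right_diff_distrib mult_ac)
    also have "\<dots> = 0" using harm[OF x False] sum_pmf_S[OF x] by simp
    finally show ?thesis by simp
  qed
  have swap: "(\<Sum>x\<in>S. \<Sum>y\<in>S. c x y * (u x - u y) * g y) = - (\<Sum>x\<in>S. \<Sum>y\<in>S. c x y * (u x - u y) * g x)"
  proof -
    have "(\<Sum>x\<in>S. \<Sum>y\<in>S. c x y * (u x - u y) * g y) = (\<Sum>x\<in>S. \<Sum>y\<in>S. c y x * (u y - u x) * g x)"
      by (rule sum.swap)
    also have "\<dots> = (\<Sum>x\<in>S. \<Sum>y\<in>S. - (c x y * (u x - u y) * g x))"
    proof (intro sum.cong refl)
      fix x y assume "x \<in> S" "y \<in> S"
      then have "c y x = c x y" by (metis sym)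
      then show "c y x * (u y - u x) * g x = - (c x y * (u x - u y) * g x)" by (simp add: algebra_simps)
    qed
    finally show ?thesis by (simp add: sum_negf)
  qed
  have "(\<Sum>x\<in>S. \<Sum>y\<in>S. c x y * (u x - u y) * (g x - g y)) =
      2 * (\<Sum>x\<in>S. \<Sum>y\<in>S. c x y * (u x - u y) * g x)"
    using swap by (simp add: right_diff_distrib sum_subtractf)
  also have "\<dots> = 2 * (\<Sum>x\<in>S. g x * (\<Sum>y\<in>S. c x y * (u x - u y)))"
    by (simp add: sum_distrib_left mult_ac)
  also have "\<dots> = 0" by (simp only: zero sum.neutral_const mult_zero_right cong: sum.cong)
  finally have cross: "(\<Sum>x\<in>S. \<Sum>y\<in>S. c x y * (u x - u y) * (g x - g y)) = 0" .
  have "dirichlet f = dirichlet u + dirichlet g +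
      2 * (\<Sum>x\<in>S. \<Sum>y\<in>S. c x y * (u x - u y) * (g x - g y))"
    unfolding dirichlet_def sum_distrib_left sum.distrib[symmetric]
    by (intro sum.cong refl) (simp add: g_def power2_eq_square algebra_simps)
  then show ?thesis using cross dirichlet_nonneg[of g] by simp
qed

text \<open>
  The equilibrium potential has the least energy among the functions with its values at \<open>a\<close> and
  \<open>b\<close>; the indicator function of a set separating \<open>a\<close> from \<open>b\<close> by edges of conductance at most
  \<open>c\<^sub>1\<close> is such a function.  Hence the potential varies little along edges of conductance at
  least \<open>c\<^sub>0\<close>, when \<open>c\<^sub>1\<close> is small compared to \<open>c\<^sub>0\<close>.
\<close>

lemma win_prob_ge:
  assumes "a \<noteq> b" "a \<in> A" "b \<notin> A" "a \<in> S" "b \<in> S"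
    and cut: "\<And>x y. x \<in> S \<Longrightarrow> y \<in> S \<Longrightarrow> x \<in> A \<Longrightarrow> y \<notin> A \<Longrightarrow> c x y \<le> c1"
    and c0: "0 < c0" and c1: "0 \<le> c1"
    and path: "(x, a) \<in> {(y, z). y \<in> S \<and> z \<in> S \<and> c0 \<le> c y z} ^^ k"
  shows "1 - real k * (real (card S) * sqrt (c1 / c0)) \<le> win_prob a b x"
proof -
  let ?u = "win_prob a b"
  have "dirichlet ?u \<le> dirichlet (\<lambda>x. of_bool (x \<in> A))"
    by (rule dirichlet_principle[of "{a, b}"])
       (use assms(1-5) win_prob_harmonic[OF assms(1)] win_prob_target win_prob_avoided in auto)
  also have "\<dots> \<le> (\<Sum>x\<in>S. \<Sum>y\<in>S. c1)" unfolding dirichlet_def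
  proof (intro sum_mono)
    fix x y assume xy: "x \<in> S" "y \<in> S"
    then show "c x y * (of_bool (x \<in> A) - of_bool (y \<in> A))\<^sup>2 \<le> c1"
      using cut[of x y] cut[of y x] sym[of x y] c1 by (cases "x \<in> A"; cases "y \<in> A") auto
  qed
  also have "\<dots> = (real (card S))\<^sup>2 * c1" by (simp add: power2_eq_square)
  finally have D: "dirichlet ?u \<le> (real (card S))\<^sup>2 * c1" .
  define d where "d = real (card S) * sqrt (c1 / c0)"
  have edge: "\<bar>?u y - ?u z\<bar> \<le> d" if "y \<in> S" "z \<in> S" "c0 \<le> c y z" for y z
  proof -
    have "c0 * (?u y - ?u z)\<^sup>2 \<le> c y z * (?u y - ?u z)\<^sup>2"
      using that by (intro mult_right_mono) auto
    also have "\<dots> \<le> (real (card S))\<^sup>2 * c1"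
      using dirichlet_term_le[OF that(1,2)] D by (rule order_trans)
    finally have "(?u y - ?u z)\<^sup>2 \<le> (real (card S))\<^sup>2 * (c1 / c0)"
      using c0 by (simp add: field_simps)
    then have "sqrt ((?u y - ?u z)\<^sup>2) \<le> sqrt ((real (card S))\<^sup>2 * (c1 / c0))"
      by (rule real_sqrt_le_mono)
    then show ?thesis unfolding d_def real_sqrt_mult by simp
  qed
  from path have "1 - real k * d \<le> ?u x"
  proof (induction k arbitrary: x)
    case 0
    then show ?case using win_prob_target[OF assms(1,4)] by simp
  next
    case (Suc k)
    from Suc.prems obtain y where y: "x \<in> S" "y \<in> S" "c0 \<le> c x y"
      "(y, a) \<in> {(y, z). y \<in> S \<and> z \<in> S \<and> c0 \<le> c y z} ^^ k"
      using relpow_Suc_D2[of x a k] by blast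
    then show ?case using Suc.IH[of y] edge[of x y] by (simp add: algebra_simps abs_le_iff)
  qed
  then show ?thesis by (simp add: d_def)
qed

end

section \<open>The energy landscape in terms of occupied sets\<close>

definition edges :: "site set \<Rightarrow> site set set" where
  "edges S = {{x, y} | x y. x \<in> S \<and> y \<in> S \<and> nn x y}"

lemma edges_mono: "S \<subseteq> T \<Longrightarrow> edges S \<subseteq> edges T"
  by (auto simp: edges_def)

lemma edges_subset_Pow: "edges S \<subseteq> Pow S"
  by (auto simp: edges_def)

lemma finite_edges: "finite S \<Longrightarrow> finite (edges S)"
  by (rule finite_subset[OF edges_subset_Pow]) simp

lemma edges_image:
  assumes "inj_on f S" "\<And>x y. x \<in> S \<Longrightarrow> y \<in> S \<Longrightarrow> nn (f x) (f y) \<longleftrightarrow> nn x y"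
  shows "edges (f ` S) = (`) f ` edges S"
proof (intro subset_antisym subsetI)
  fix e assume "e \<in> edges (f ` S)"
  then obtain x y where "e = {f x, f y}" "x \<in> S" "y \<in> S" "nn x y"
    using assms(2) by (auto simp: edges_def)
  then show "e \<in> (`) f ` edges S"
    by (intro image_eqI[of _ _ "{x, y}"]) (auto simp: edges_def)
next
  fix e assume "e \<in> (`) f ` edges S"
  then obtain x y where "e = {f x, f y}" "x \<in> S" "y \<in> S" "nn x y"
    by (auto simp: edges_def)
  then show "e \<in> edges (f ` S)" using assms(2) by (auto simp: edges_def)
qed

lemma card_edges_image:
  assumes "inj_on f S" "\<And>x y. x \<in> S \<Longrightarrow> y \<in> S \<Longrightarrow> nn (f x) (f y) \<longleftrightarrow> nn x y"
  shows "card (edges (f ` S)) = card (edges S)"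
proof -
  have "inj_on ((`) f) (edges S)"
    by (rule inj_on_subset[OF inj_on_image_Pow[OF assms(1)] edges_subset_Pow])
  then show ?thesis using edges_image[OF assms] by (simp add: card_image)
qed

lemma card_edges_insert:
  assumes "finite S" "x \<notin> S"
  shows "card (edges (insert x S)) = card (edges S) + card {y \<in> S. nn x y}"
proof -
  have "edges (insert x S) = edges S \<union> (\<lambda>y. {x, y}) ` {y \<in> S. nn x y}"
    using nn_commute not_nn_refl by (auto simp: edges_def)
  moreover have "edges S \<inter> (\<lambda>y. {x, y}) ` {y \<in> S. nn x y} = {}"
    using assms(2) edges_subset_Pow by fastforce
  moreover have "inj_on (\<lambda>y. {x, y}) {y \<in> S. nn x y}"
    by (auto intro!: inj_onI simp: doubleton_eq_iff)
  ultimately show ?thesis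
    using assms(1) by (simp add: card_Un_disjoint finite_edges card_image)
qed

definition conf :: "nat \<Rightarrow> site set \<Rightarrow> config" where
  "conf L S = (\<lambda>x \<in> Lam L. if x \<in> S then 1 else 0)"

lemma conf_in_configs: "conf L S \<in> configs L"
  by (auto simp: conf_def configs_def)

lemma conf_occupied: "\<eta> \<in> configs L \<Longrightarrow> conf L {x \<in> Lam L. \<eta> x = 1} = \<eta>"
  by (rule ext) (auto simp: conf_def configs_def PiE_iff extensional_def)

lemma conf_eq_iff:
  assumes "S \<subseteq> Lam L" "T \<subseteq> Lam L"
  shows "conf L S = conf L T \<longleftrightarrow> S = T"
proof
  assume eq: "conf L S = conf L T"
  have "x \<in> S \<longleftrightarrow> x \<in> T" if "x \<in> Lam L" for x
    using fun_cong[OF eq, of x] that by (simp add: conf_def split: if_splits)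
  then show "S = T" using assms by blast
qed simp

lemma configs_eq_conf_image: "configs L = conf L ` Pow (Lam L)"
proof (intro subset_antisym subsetI)
  fix \<eta> assume "\<eta> \<in> configs L"
  then have "\<eta> = conf L {x \<in> Lam L. \<eta> x = 1}" by (rule conf_occupied[symmetric])
  then show "\<eta> \<in> conf L ` Pow (Lam L)" by blast
qed (use conf_in_configs in auto)

lemma empty_config_eq: "empty_config L = conf L {}"
  by (simp add: empty_config_def conf_def)

lemma full_config_eq: "full_config L = conf L (hexagon L)"
  by (simp add: full_config_def conf_def Lam_minus_eq_hexagon)

lemma hexagon_subset_Lam: "hexagon L \<subseteq> Lam L"
  by (auto simp: Lam_eq)

lemma Lam_bd_eq_diff: "Lam_bd L = Lam L - hexagon L"
  using Lam_minus_eq_hexagon[of L] Lam_bd_subset[of L] by (auto simp: Lam_minus_def)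

text \<open>A particle in the boundary layer is never bound: it costs exactly
  \<open>\<Delta>\<close>, whatever its neighbours.\<close>

definition energy :: "nat \<Rightarrow> real \<Rightarrow> real \<Rightarrow> site set \<Rightarrow> real" where
  "energy L U \<Delta> S = - U * card (edges (S \<inter> hexagon L)) + \<Delta> * card S"

lemma hamiltonian_conf:
  assumes "S \<subseteq> Lam L"
  shows "hamiltonian L U \<Delta> (conf L S) = energy L U \<Delta> S"
proof -
  let ?E = "edges (hexagon L)"
  have prod: "(\<Prod>z\<in>e. real (conf L S z)) = of_bool (e \<in> edges (S \<inter> hexagon L))" if e: "e \<in> ?E" for e
  proof -
    obtain x y where xy: "e = {x, y}" "x \<in> hexagon L" "y \<in> hexagon L" "nn x y"
      using e by (auto simp: edges_def)
    then have "x \<noteq> y" using not_nn_refl by blast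
    moreover have "e \<in> edges (S \<inter> hexagon L) \<longleftrightarrow> x \<in> S \<and> y \<in> S"
      using xy nn_commute by (auto simp: edges_def doubleton_eq_iff)
    ultimately show ?thesis using xy hexagon_subset_Lam[of L] by (auto simp: conf_def)
  qed
  have fin: "finite ?E" by (intro finite_edges finite_hexagon)
  have "(\<Sum>e\<in>?E. \<Prod>z\<in>e. real (conf L S z)) = (\<Sum>e\<in>?E. of_bool (e \<in> edges (S \<inter> hexagon L)))"
    by (intro sum.cong refl prod)
  also have "\<dots> = card (?E \<inter> edges (S \<inter> hexagon L))"
    using fin by simp
  also have "?E \<inter> edges (S \<inter> hexagon L) = edges (S \<inter> hexagon L)"
    using edges_mono[of "S \<inter> hexagon L" "hexagon L"] by blast
  finally have 1: "(\<Sum>e\<in>?E. \<Prod>z\<in>e. real (conf L S z)) = card (edges (S \<inter> hexagon L))" .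
  have "(\<Sum>x\<in>Lam L. real (conf L S x)) = (\<Sum>x\<in>Lam L. of_bool (x \<in> S))"
    by (intro sum.cong refl) (simp add: conf_def)
  also have "\<dots> = card S" using finite_Lam assms by (simp add: Int_absorb1)
  finally show ?thesis
    using 1 by (simp add: hamiltonian_def energy_def Lam_minus_eq_hexagon edges_def)
qed

text \<open>The moves that really change the occupied set, with the particle at \<open>x\<close> and
  the vacancy at \<open>y\<close>. The number of particles changes only in \<open>enter\<close> and
  \<open>exit\<close>, that is, in the boundary layer.\<close>

inductive adj :: "nat \<Rightarrow> site set \<Rightarrow> site set \<Rightarrow> bool" for L where
  swap: "x \<in> Lam L \<Longrightarrow> y \<in> Lam L \<Longrightarrow> nn x y \<Longrightarrow> x \<in> S \<Longrightarrow> y \<notin> S \<Longrightarrow> adj L S (insert y (S - {x}))"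
| enter: "y \<in> Lam_bd L \<Longrightarrow> y \<notin> S \<Longrightarrow> adj L S (insert y S)"
| exit: "y \<in> Lam_bd L \<Longrightarrow> y \<in> S \<Longrightarrow> adj L S (S - {y})"

lemma adj_sym: "adj L S T \<Longrightarrow> adj L T S"
proof (induction rule: adj.induct)
  case (swap x y S)
  have "adj L (insert y (S - {x})) (insert x (insert y (S - {x}) - {y}))"
    by (rule adj.swap) (use swap nn_commute not_nn_refl in auto)
  moreover have "insert x (insert y (S - {x}) - {y}) = S" using swap by auto
  ultimately show ?case by simp
next
  case (enter y S)
  then have "adj L (insert y S) (insert y S - {y})" by (intro adj.exit) auto
  then show ?case using enter by simp
next
  case (exit y S)
  then have "adj L (S - {y}) (insert y (S - {y}))" by (intro adj.enter) auto
  then show ?case using exit by (simp add: insert_absorb)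
qed

lemma adj_neq: "adj L S T \<Longrightarrow> S \<noteq> T"
  by (induction rule: adj.induct) auto

lemma adj_subset_Lam: "adj L S T \<Longrightarrow> S \<subseteq> Lam L \<Longrightarrow> T \<subseteq> Lam L"
  by (induction rule: adj.induct) (use Lam_bd_subset in auto)

lemma adj_imp_move: "adj L S T \<Longrightarrow> \<exists>b\<in>bonds L. conf L T = move L b (conf L S)"
proof (induction rule: adj.induct)
  case (swap x y S)
  then show ?case
    by (intro bexI[of _ "(x, y)"]) (auto simp: move_def conf_def bonds_def fun_eq_iff)
next
  case (enter y S)
  then obtain z where "z \<notin> Lam L" "nn y z" unfolding Lam_bd_eq by blast
  then show ?case using enter Lam_bd_subset[of L]
    by (intro bexI[of _ "(z, y)"]) (auto simp: move_def conf_def bonds_def nn_commute fun_eq_iff)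
next
  case (exit y S)
  then obtain z where "z \<notin> Lam L" "nn y z" unfolding Lam_bd_eq by blast
  then show ?case using exit Lam_bd_subset[of L]
    by (intro bexI[of _ "(y, z)"]) (auto simp: move_def conf_def bonds_def fun_eq_iff)
qed

lemma move_imp_adj:
  assumes "b \<in> bonds L" "conf L T = move L b (conf L S)" "S \<subseteq> Lam L" "T \<subseteq> Lam L" "S \<noteq> T"
  shows "adj L S T"
proof -
  obtain x y where b: "b = (x, y)" by (cases b)
  have nn: "nn x y" using assms(1) by (simp add: b bonds_def)
  have T: "T = T'" if "T' \<subseteq> Lam L" "move L b (conf L S) = conf L T'" for T'
    using that assms(2,4) conf_eq_iff by metis
  consider "x \<in> Lam L" "y \<in> Lam L" | "x \<in> Lam_bd L" "y \<notin> Lam L" | "x \<notin> Lam L" "y \<in> Lam_bd L"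
    using assms(1) by (auto simp: b bonds_def)
  then show ?thesis
  proof cases
    case 1
    consider "x \<in> S" "y \<notin> S" | "x \<notin> S" "y \<in> S" | "x \<in> S \<longleftrightarrow> y \<in> S" by blast
    then show ?thesis
    proof cases
      case a: 1
      then have "T = insert y (S - {x})" using 1 assms(3)
        by (intro T) (auto simp: b move_def conf_def fun_eq_iff)
      then show ?thesis using 1 a nn by (simp add: adj.swap)
    next
      case a: 2
      then have "T = insert x (S - {y})" using 1 assms(3)
        by (intro T) (auto simp: b move_def conf_def fun_eq_iff)
      then show ?thesis using 1 a nn nn_commute by (simp add: adj.swap)
    next
      case a: 3
      then have "T = S" using 1 assms(3)
        by (intro T) (auto simp: b move_def conf_def fun_eq_iff)
      then show ?thesis using assms(5) by simp
    qed
  next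
    case 2
    then have "T = S - {x}" using assms(3) Lam_bd_subset[of L]
      by (intro T) (auto simp: b move_def conf_def fun_eq_iff)
    then show ?thesis using 2 assms(5) by (auto intro: adj.exit)
  next
    case 3
    then have "T = insert y S" using assms(3) Lam_bd_subset[of L]
      by (intro T) (auto simp: b move_def conf_def fun_eq_iff)
    moreover from this have "y \<notin> S" using assms(5) by auto
    ultimately show ?thesis using 3 by (auto intro: adj.enter)
  qed
qed

lemma jump_prob_conf:
  assumes "S \<subseteq> Lam L" "T \<subseteq> Lam L" "S \<noteq> T"
  shows "jump_prob L U \<Delta> \<beta> (conf L S) (conf L T) =
    (if adj L S T then exp (- \<beta> * max 0 (energy L U \<Delta> T - energy L U \<Delta> S)) / card (bonds L) else 0)"
  using adj_imp_move[of L S T] move_imp_adj[of _ L T S] assms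
  by (auto simp: jump_prob_def hamiltonian_conf)

section \<open>Paths below an energy level and the limit of low temperature\<close>

definition low_step :: "nat \<Rightarrow> real \<Rightarrow> real \<Rightarrow> real \<Rightarrow> (site set \<times> site set) set" where
  "low_step L U \<Delta> \<Gamma> = {(S, T). S \<subseteq> Lam L \<and> T \<subseteq> Lam L \<and> adj L S T \<and>
     energy L U \<Delta> S < \<Gamma> \<and> energy L U \<Delta> T < \<Gamma>}"

definition reach :: "nat \<Rightarrow> real \<Rightarrow> real \<Rightarrow> real \<Rightarrow> site set \<Rightarrow> site set \<Rightarrow> bool" where
  "reach L U \<Delta> \<Gamma> S T \<longleftrightarrow> (S, T) \<in> (low_step L U \<Delta> \<Gamma>)\<^sup>*"

lemma reach_refl: "reach L U \<Delta> \<Gamma> S S"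
  by (simp add: reach_def)

lemma reach_trans: "reach L U \<Delta> \<Gamma> S T \<Longrightarrow> reach L U \<Delta> \<Gamma> T R \<Longrightarrow> reach L U \<Delta> \<Gamma> S R"
  unfolding reach_def by (rule rtrancl_trans)

lemma reach_sym: "reach L U \<Delta> \<Gamma> S T \<Longrightarrow> reach L U \<Delta> \<Gamma> T S"
  unfolding reach_def
  by (rule symD[OF sym_rtrancl]) (auto simp: sym_def low_step_def adj_sym)

lemma reach_step:
  assumes "adj L S T" "S \<subseteq> Lam L" "energy L U \<Delta> S < \<Gamma>" "energy L U \<Delta> T < \<Gamma>"
  shows "reach L U \<Delta> \<Gamma> S T"
  using assms adj_subset_Lam[OF assms(1)] unfolding reach_def low_step_def by (intro r_into_rtrancl) auto

lemma relpow_map: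
  assumes "(x, y) \<in> R ^^ k" "\<And>x y. (x, y) \<in> R \<Longrightarrow> (f x, f y) \<in> R'"
  shows "(f x, f y) \<in> R' ^^ k"
  using assms(1) by (induction k arbitrary: y) (use assms(2) in auto)

text \<open>With the Gibbs weights, the Metropolis rates have the conductances
  \<open>exp (- \<beta> * max (E S) (E T)) / n\<close>, where \<open>n\<close> is the number of
  bonds. They are at most \<open>exp (- \<beta> * \<Gamma>) / n\<close> across the cut and at least
  \<open>exp (- \<beta> * \<Gamma>') / n\<close> along the path, for some
  \<open>\<Gamma>' < \<Gamma>\<close>. The length of the path does not depend on
  \<open>\<beta>\<close>, and the ratio \<open>exp (- \<beta> * (\<Gamma> - \<Gamma>'))\<close>
  tends to 0.\<close>

lemma kawasaki_tendsto_1: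
  assumes "L \<ge> 1"
    and reach: "reach L U \<Delta> \<Gamma> S A"
    and sub: "S \<subseteq> Lam L" "A \<subseteq> Lam L" "B \<subseteq> Lam L"
    and A: "A \<in> \<A>" and B: "B \<notin> \<A>"
    and cut: "\<And>S T. S \<subseteq> Lam L \<Longrightarrow> T \<subseteq> Lam L \<Longrightarrow> adj L S T \<Longrightarrow> S \<in> \<A> \<Longrightarrow> T \<notin> \<A> \<Longrightarrow>
        \<Gamma> \<le> max (energy L U \<Delta> S) (energy L U \<Delta> T)"
  shows "((\<lambda>\<beta>. \<P>(\<omega> in kawasaki L U \<Delta> \<beta> (conf L S).
      hitting_time (conf L A) \<omega> < hitting_time (conf L B) \<omega>)) \<longlongrightarrow> 1) at_top"
proof -
  let ?E = "energy L U \<Delta>" and ?n = "real (card (bonds L))"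
  \<comment> \<open>Any bond will do; it makes the denominator \<open>?n\<close> positive.\<close>
  have "(Up 0 0, Dn (-1) 0) \<in> bonds L"
    using assms(1) hexagon_subset_Lam[of L]
    by (auto simp: bonds_def nn_simps Up_in_hexagon Dn_in_hexagon subset_eq)
  then have n: "?n > 0" using finite_bonds card_gt_0_iff by fastforce
  obtain \<Gamma>' where \<Gamma>': "\<Gamma>' < \<Gamma>" "\<And>S. S \<subseteq> Lam L \<Longrightarrow> ?E S < \<Gamma> \<Longrightarrow> ?E S \<le> \<Gamma>'"
  proof -
    \<comment> \<open>There are finitely many energies, hence a gap below \<open>\<Gamma>\<close>;
      \<open>\<Gamma> - 1\<close> keeps the set nonempty.\<close>
    let ?X = "insert (\<Gamma> - 1) {?E S | S. S \<subseteq> Lam L \<and> ?E S < \<Gamma>}"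
    have "{?E S | S. S \<subseteq> Lam L \<and> ?E S < \<Gamma>} \<subseteq> ?E ` Pow (Lam L)" by auto
    then have fin: "finite ?X" using finite_Lam by (simp add: finite_subset)
    have "Max ?X \<in> ?X" using fin by (intro Max_in) auto
    then have "Max ?X < \<Gamma>" by auto
    then show ?thesis using that[of "Max ?X"] fin by (metis (mono_tags, lifting) Max_ge insertCI mem_Collect_eq)
  qed
  obtain k where k: "(S, A) \<in> low_step L U \<Delta> \<Gamma> ^^ k"
    using reach by (auto simp: reach_def rtrancl_power)
  let ?P = "\<lambda>\<beta>. \<P>(\<omega> in kawasaki L U \<Delta> \<beta> (conf L S).
      hitting_time (conf L A) \<omega> < hitting_time (conf L B) \<omega>)"
  let ?m = "real (card (configs L))"
  have low: "1 - real k * (?m * sqrt (exp (- \<beta> * (\<Gamma> - \<Gamma>')))) \<le> ?P \<beta>" if \<beta>: "\<beta> > 0" for \<beta>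
  proof -
    let ?K = "kawasaki_kernel L U \<Delta> \<beta>"
    let ?H = "hamiltonian L U \<Delta>"
    define \<mu> where "\<mu> \<eta> = exp (- \<beta> * ?H \<eta>)" for \<eta>
    define c where "c \<eta> \<eta>' = \<mu> \<eta> * pmf (?K \<eta>) \<eta>'" for \<eta> \<eta>'
    have c_eq: "c (conf L S) (conf L T) = (if adj L S T then exp (- \<beta> * max (?E S) (?E T)) / ?n else 0)"
      if "S \<subseteq> Lam L" "T \<subseteq> Lam L" "S \<noteq> T" for S T
    proof -
      have "c (conf L S) (conf L T) = \<mu> (conf L S) * jump_prob L U \<Delta> \<beta> (conf L S) (conf L T)"
        using that \<beta> conf_eq_iff[of S L T]
        by (simp add: c_def pmf_kawasaki_kernel conf_in_configs trans_prob_def)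
      moreover have "exp (- \<beta> * ?E S) * exp (- \<beta> * max 0 (?E T - ?E S)) = exp (- \<beta> * max (?E S) (?E T))"
        unfolding exp_add[symmetric] by (simp add: max_def algebra_simps)
      ultimately show ?thesis
        using that by (simp add: jump_prob_conf \<mu>_def hamiltonian_conf)
    qed
    interpret reversible_chain ?K "configs L" c \<mu>
    proof
      show "finite (configs L)" by (rule finite_configs)
      fix \<eta> assume \<eta>: "\<eta> \<in> configs L"
      show "set_pmf (?K \<eta>) \<subseteq> configs L"
      proof
        fix \<zeta> assume "\<zeta> \<in> set_pmf (?K \<eta>)"
        then have "trans_prob L U \<Delta> \<beta> \<eta> \<zeta> \<noteq> 0"
          using pmf_kawasaki_kernel[OF \<eta>, of \<beta> U \<Delta> \<zeta>] \<beta> by (simp add: set_pmf_iff)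
        then show "\<zeta> \<in> configs L" using \<eta> move_in_configs
          by (auto simp: trans_prob_def jump_prob_def split: if_splits)
      qed
      fix \<eta>' assume \<eta>': "\<eta>' \<in> configs L"
      show "c \<eta> \<eta>' = \<mu> \<eta> * pmf (?K \<eta>) \<eta>'" by (simp add: c_def)
      show "0 \<le> c \<eta> \<eta>'" by (simp add: c_def \<mu>_def)
      obtain S T where ST: "\<eta> = conf L S" "\<eta>' = conf L T" "S \<subseteq> Lam L" "T \<subseteq> Lam L"
        using \<eta> \<eta>' configs_eq_conf_image by auto
      show "c \<eta> \<eta>' = c \<eta>' \<eta>"
        by (cases "S = T") (use ST adj_sym in \<open>auto simp: c_eq max.commute\<close>)
    qed
    have AB: "A \<noteq> B" using A B by blast
    have "1 - real k * (?m * sqrt (exp (- \<beta> * \<Gamma>) / ?n / (exp (- \<beta> * \<Gamma>') / ?n)))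
        \<le> win_prob (conf L A) (conf L B) (conf L S)"
    proof (rule win_prob_ge[where A = "conf L ` {S \<in> \<A>. S \<subseteq> Lam L}"])
      show "conf L A \<noteq> conf L B" using AB sub conf_eq_iff by blast
      show "conf L A \<in> conf L ` {S \<in> \<A>. S \<subseteq> Lam L}" using A sub by blast
      show "conf L B \<notin> conf L ` {S \<in> \<A>. S \<subseteq> Lam L}" using B sub conf_eq_iff by auto
      show "0 < exp (- \<beta> * \<Gamma>') / ?n" "0 \<le> exp (- \<beta> * \<Gamma>) / ?n" using n by simp_all
      show "conf L A \<in> configs L" "conf L B \<in> configs L" by (rule conf_in_configs)+
      show "c \<eta> \<eta>' \<le> exp (- \<beta> * \<Gamma>) / ?n"
        if \<eta>: "\<eta> \<in> configs L" "\<eta>' \<in> configs L" "\<eta> \<in> conf L ` {S \<in> \<A>. S \<subseteq> Lam L}"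
          "\<eta>' \<notin> conf L ` {S \<in> \<A>. S \<subseteq> Lam L}" for \<eta> \<eta>'
      proof -
        obtain S T where ST: "\<eta> = conf L S" "\<eta>' = conf L T" "S \<subseteq> Lam L" "T \<subseteq> Lam L" "S \<in> \<A>" "T \<notin> \<A>"
          using \<eta> configs_eq_conf_image by auto
        then have "S \<noteq> T" by blast
        show ?thesis
        proof (cases "adj L S T")
          case True
          then have "\<Gamma> \<le> max (?E S) (?E T)" using cut ST by blast
          then have "exp (- \<beta> * max (?E S) (?E T)) \<le> exp (- \<beta> * \<Gamma>)" using \<beta> by simp
          then show ?thesis using ST \<open>S \<noteq> T\<close> n True by (simp add: c_eq divide_right_mono)
        next
          case False
          then show ?thesis using ST \<open>S \<noteq> T\<close> n by (simp add: c_eq)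
        qed
      qed
      show "(conf L S, conf L A) \<in> {(\<eta>, \<zeta>). \<eta> \<in> configs L \<and> \<zeta> \<in> configs L \<and> exp (- \<beta> * \<Gamma>') / ?n \<le> c \<eta> \<zeta>} ^^ k"
      proof (rule relpow_map[OF k])
        fix S T assume "(S, T) \<in> low_step L U \<Delta> \<Gamma>"
        then have ST: "S \<subseteq> Lam L" "T \<subseteq> Lam L" "adj L S T" "?E S \<le> \<Gamma>'" "?E T \<le> \<Gamma>'"
          using \<Gamma>' by (auto simp: low_step_def)
        then have "exp (- \<beta> * \<Gamma>') / ?n \<le> c (conf L S) (conf L T)"
          using adj_neq[OF ST(3)] n \<beta> by (simp add: c_eq divide_right_mono)
        then show "(conf L S, conf L T) \<in> {(\<eta>, \<zeta>). \<eta> \<in> configs L \<and> \<zeta> \<in> configs L \<and> exp (- \<beta> * \<Gamma>') / ?n \<le> c \<eta> \<zeta>}"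
          using conf_in_configs by auto
      qed
    qed
    moreover have "exp (- \<beta> * \<Gamma>) / ?n / (exp (- \<beta> * \<Gamma>') / ?n) = exp (- \<beta> * (\<Gamma> - \<Gamma>'))"
      using n by (simp add: exp_diff right_diff_distrib exp_minus field_simps)
    ultimately show ?thesis by (simp add: win_prob_def kawasaki_def)
  qed
  have up: "?P \<beta> \<le> 1" for \<beta>
    unfolding kawasaki_def by (rule prob_space.prob_le_1[OF prob_space_chain_law])
  have "((\<lambda>\<beta>. sqrt (exp (- \<beta> * (\<Gamma> - \<Gamma>')))) \<longlongrightarrow> sqrt 0) at_top"
  proof (intro tendsto_real_sqrt filterlim_compose[OF exp_at_bot])
    show "filterlim (\<lambda>\<beta>. - \<beta> * (\<Gamma> - \<Gamma>')) at_bot at_top"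
      using filterlim_tendsto_neg_mult_at_bot[OF tendsto_const, of "- (\<Gamma> - \<Gamma>')" "\<lambda>\<beta>. \<beta>" at_top] \<Gamma>'(1)
      by (simp add: filterlim_ident algebra_simps)
  qed
  then have "((\<lambda>\<beta>. 1 - real k * (?m * sqrt (exp (- \<beta> * (\<Gamma> - \<Gamma>'))))) \<longlongrightarrow> 1 - real k * (?m * sqrt 0)) at_top"
    by (intro tendsto_diff tendsto_mult tendsto_const)
  then have lim: "((\<lambda>\<beta>. 1 - real k * (?m * sqrt (exp (- \<beta> * (\<Gamma> - \<Gamma>'))))) \<longlongrightarrow> 1) at_top"
    by simp
  show ?thesis
  proof (rule tendsto_sandwich[OF _ _ lim tendsto_const])
    show "eventually (\<lambda>\<beta>. 1 - real k * (?m * sqrt (exp (- \<beta> * (\<Gamma> - \<Gamma>')))) \<le> ?P \<beta>) at_top"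
      using eventually_gt_at_top[of 0] by eventually_elim (rule low)
    show "eventually (\<lambda>\<beta>. ?P \<beta> \<le> 1) at_top" using up by simp
  qed
qed

section \<open>An isoperimetric inequality for polyiamonds\<close>

text \<open>Peel off the row of the least \<open>a\<close> and the column of the greatest
  \<open>b\<close>. Sums in the row are at most the sum at their common corner, sums in the column
  at least that, so all of them are distinct and at most \<open>card C\<close> pairs are lost. After
  \<open>t\<close> rounds a rectangle with sides \<open>card A - t\<close> and
  \<open>card B - t\<close> is left.\<close>

lemma card_sumset_pairs_le:
  fixes A B C :: "int set"
  assumes "finite A" "finite B" "finite C" "t \<le> card A" "t \<le> card B"
  shows "card {(a, b) \<in> A \<times> B. a + b \<in> C} \<le> t * card C + (card A - t) * (card B - t)"
  using assms
proof (induction t arbitrary: A B)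
  case 0
  have "card {(a, b) \<in> A \<times> B. a + b \<in> C} \<le> card (A \<times> B)"
    using 0 by (intro card_mono) auto
  then show ?case by (simp add: card_cartesian_product)
next
  case (Suc t)
  let ?N = "\<lambda>A B. {(a, b) \<in> A \<times> B. a + b \<in> C}"
  have ne: "A \<noteq> {}" "B \<noteq> {}" using Suc.prems by auto
  define a0 b0 where "a0 = Min A" "b0 = Max B"
  let ?A = "A - {a0}" and ?B = "B - {b0}"
  let ?P = "{(a, b) \<in> ?N A B. a = a0 \<or> b = b0}"
  have card: "card ?A = card A - 1" "card ?B = card B - 1"
    using ne Suc.prems(1,2) by (simp_all add: a0_b0_def)
  have "inj_on (\<lambda>(a, b). a + b) ?P"
  proof (intro inj_onI; clarsimp)
    fix a b a' b'
    assume *: "a + b = a' + b'" "a = a0 \<or> b = b0" "a' = a0 \<or> b' = b0"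
      and "a \<in> A" "a' \<in> A" "b \<in> B" "b' \<in> B"
    then have "a0 \<le> a" "a0 \<le> a'" "b \<le> b0" "b' \<le> b0"
      using Suc.prems by (auto simp: a0_b0_def)
    then show "a = a' \<and> b = b'" using * by auto
  qed
  then have P: "card ?P \<le> card C"
    by (rule card_inj_on_le) (auto simp: Suc.prems(3))
  have "?N A B = ?P \<union> ?N ?A ?B" by auto
  from arg_cong[OF this, of card] have "card (?N A B) \<le> card ?P + card (?N ?A ?B)"
    by (rule ord_eq_le_trans[OF _ card_Un_le])
  also have "card (?N ?A ?B) \<le> t * card C + (card ?A - t) * (card ?B - t)"
    by (rule Suc.IH) (use Suc.prems ne card in auto)
  finally show ?case using P card by simp
qed

text \<open>A strip consists of the faces between two adjacent parallel lattice lines. The functions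
  \<open>coordA\<close>, \<open>coordB\<close> and \<open>coordC\<close> number the strips of the
  three directions, and \<open>stepA\<close>, \<open>stepB\<close> and \<open>stepC\<close> go to
  the next face of the same strip.\<close>

fun stepA :: "site \<Rightarrow> site" where
  "stepA (Up a b) = Dn a b"
| "stepA (Dn a b) = Up a (b + 1)"

fun stepB :: "site \<Rightarrow> site" where
  "stepB (Up a b) = Dn a b"
| "stepB (Dn a b) = Up (a + 1) b"

fun stepC :: "site \<Rightarrow> site" where
  "stepC (Up a b) = Dn (a - 1) b"
| "stepC (Dn a b) = Up a (b + 1)"

fun coordA :: "site \<Rightarrow> int" where
  "coordA (Up a b) = a"
| "coordA (Dn a b) = a"

fun coordB :: "site \<Rightarrow> int" where
  "coordB (Up a b) = b"
| "coordB (Dn a b) = b"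

fun coordC :: "site \<Rightarrow> int" where
  "coordC (Up a b) = a + b"
| "coordC (Dn a b) = a + b + 1"

fun is_Dn :: "site \<Rightarrow> bool" where
  "is_Dn (Up a b) \<longleftrightarrow> False"
| "is_Dn (Dn a b) \<longleftrightarrow> True"

text \<open>In each strip of faces, the leftmost face is not a successor.\<close>

lemma card_strips:
  fixes pos :: "'a \<Rightarrow> int"
  assumes "finite S" "inj f" "\<And>s. strip (f s) = strip s" "\<And>s. pos (f s) = pos s + 1"
  shows "card {s \<in> S. f s \<in> S} + card (strip ` S) \<le> card S"
proof -
  let ?T = "{s \<in> S. f s \<in> S}"
  have "strip ` S \<subseteq> strip ` (S - f ` ?T)"
  proof
    fix i assume "i \<in> strip ` S"
    then have X: "finite {s \<in> S. strip s = i}" "{s \<in> S. strip s = i} \<noteq> {}" using assms(1) by auto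
    obtain s where s: "s \<in> S" "strip s = i" "\<And>s'. s' \<in> S \<Longrightarrow> strip s' = i \<Longrightarrow> pos s \<le> pos s'"
      using arg_min_if_finite[OF X, of pos] by (metis (mono_tags, lifting) leI mem_Collect_eq)
    have "s \<notin> f ` ?T"
    proof
      assume "s \<in> f ` ?T"
      then obtain s' where "s' \<in> S" "s = f s'" by blast
      then show False using s(3)[of s'] s(2) assms(3,4)[of s'] by simp
    qed
    then show "i \<in> strip ` (S - f ` ?T)" using s by blast
  qed
  then have "card (strip ` S) \<le> card (strip ` (S - f ` ?T))"
    using assms(1) by (intro card_mono) auto
  also have "\<dots> \<le> card (S - f ` ?T)" using assms(1) by (intro card_image_le) auto
  also have "\<dots> = card S - card (f ` ?T)" using assms(1) by (intro card_Diff_subset) auto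
  also have "card (f ` ?T) = card ?T" using assms(2) by (intro card_image) (auto intro: inj_on_subset)
  finally show ?thesis
    using card_mono[OF assms(1), of ?T] by auto
qed

text \<open>Every edge of the hexagonal lattice lies in exactly two of the three strips of its ends.\<close>

lemma edges_strips:
  assumes S: "finite S"
  shows "2 * card (edges S) + card (coordA ` S) + card (coordB ` S) + card (coordC ` S) \<le> 3 * card S"
proof -
  \<comment> \<open>The edges by direction: those in \<open>T1\<close> lie within a strip of the
    kinds A and B, those in \<open>T2\<close> of the kinds B and C, those in \<open>T3\<close> of
    the kinds A and C.\<close>
  define T1 where "T1 = {(a, b). Up a b \<in> S \<and> Dn a b \<in> S}"
  define T2 where "T2 = {(a, b). Dn a b \<in> S \<and> Up (a + 1) b \<in> S}"
  define T3 where "T3 = {(a, b). Dn a b \<in> S \<and> Up a (b + 1) \<in> S}"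
  have "case_prod Dn ` T1 \<subseteq> S" "case_prod Dn ` T2 \<subseteq> S" "case_prod Dn ` T3 \<subseteq> S"
    by (auto simp: T1_def T2_def T3_def)
  moreover have inj: "inj_on (case_prod Up) X" "inj_on (case_prod Dn) X" "inj_on (\<lambda>(a, b). Up (a + 1) b) X" for X
    by (auto intro!: inj_onI)
  ultimately have fin: "finite T1" "finite T2" "finite T3"
    using S by (meson finite_subset finite_imageD)+
  have A: "card {s \<in> S. stepA s \<in> S} = card T1 + card T3"
  proof -
    have "{s \<in> S. stepA s \<in> S} = case_prod Up ` T1 \<union> case_prod Dn ` T3"
    proof (intro set_eqI)
      fix s show "s \<in> {s \<in> S. stepA s \<in> S} \<longleftrightarrow> s \<in> case_prod Up ` T1 \<union> case_prod Dn ` T3"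
        by (cases s) (auto simp: T1_def T3_def image_iff)
    qed
    moreover have "case_prod Up ` T1 \<inter> case_prod Dn ` T3 = {}" by auto
    ultimately show ?thesis using fin inj by (simp add: card_Un_disjoint card_image)
  qed
  have B: "card {s \<in> S. stepB s \<in> S} = card T1 + card T2"
  proof -
    have "{s \<in> S. stepB s \<in> S} = case_prod Up ` T1 \<union> case_prod Dn ` T2"
    proof (intro set_eqI)
      fix s show "s \<in> {s \<in> S. stepB s \<in> S} \<longleftrightarrow> s \<in> case_prod Up ` T1 \<union> case_prod Dn ` T2"
        by (cases s) (auto simp: T1_def T2_def image_iff)
    qed
    moreover have "case_prod Up ` T1 \<inter> case_prod Dn ` T2 = {}" by auto
    ultimately show ?thesis using fin inj by (simp add: card_Un_disjoint card_image)
  qed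
  have C: "card {s \<in> S. stepC s \<in> S} = card T2 + card T3"
  proof -
    have "{s \<in> S. stepC s \<in> S} = (\<lambda>(a, b). Up (a + 1) b) ` T2 \<union> case_prod Dn ` T3"
    proof (intro set_eqI)
      fix s show "s \<in> {s \<in> S. stepC s \<in> S} \<longleftrightarrow> s \<in> (\<lambda>(a, b). Up (a + 1) b) ` T2 \<union> case_prod Dn ` T3"
      proof (cases s)
        case (Up a b)
        then show ?thesis by (auto simp: T2_def image_iff intro!: exI[of _ "a - 1"])
      qed (auto simp: T2_def T3_def image_iff)
    qed
    moreover have "(\<lambda>(a, b). Up (a + 1) b) ` T2 \<inter> case_prod Dn ` T3 = {}" by auto
    ultimately show ?thesis using fin inj by (simp add: card_Un_disjoint card_image)
  qed
  have "edges S \<subseteq> (\<lambda>(a, b). {Up a b, Dn a b}) ` T1 \<union> (\<lambda>(a, b). {Dn a b, Up (a + 1) b}) ` T2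
      \<union> (\<lambda>(a, b). {Dn a b, Up a (b + 1)}) ` T3"
  proof
    have UD: "{Up a b, Dn c d} \<in> (\<lambda>(a, b). {Up a b, Dn a b}) ` T1 \<union> (\<lambda>(a, b). {Dn a b, Up (a + 1) b}) ` T2
      \<union> (\<lambda>(a, b). {Dn a b, Up a (b + 1)}) ` T3"
      if e: "Up a b \<in> S" "Dn c d \<in> S" "nn (Up a b) (Dn c d)" for a b c d
    proof -
      consider "(c, d) = (a, b)" | "(c, d) = (a - 1, b)" | "(c, d) = (a, b - 1)"
        using e(3) by (auto simp: nn_simps)
      then show ?thesis
      proof cases
        case 1
        have "{Up a b, Dn c d} \<in> (\<lambda>(a, b). {Up a b, Dn a b}) ` T1"
          by (rule rev_image_eqI[of "(a, b)"]) (use e 1 in \<open>auto simp: T1_def\<close>)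
        then show ?thesis by blast
      next
        case 2
        have "{Up a b, Dn c d} \<in> (\<lambda>(a, b). {Dn a b, Up (a + 1) b}) ` T2"
          by (rule rev_image_eqI[of "(c, d)"]) (use e 2 in \<open>auto simp: T2_def\<close>)
        then show ?thesis by blast
      next
        case 3
        have "{Up a b, Dn c d} \<in> (\<lambda>(a, b). {Dn a b, Up a (b + 1)}) ` T3"
          by (rule rev_image_eqI[of "(c, d)"]) (use e 3 in \<open>auto simp: T3_def\<close>)
        then show ?thesis by blast
      qed
    qed
    fix e assume "e \<in> edges S"
    then obtain x y where e: "e = {x, y}" "x \<in> S" "y \<in> S" "nn x y" by (auto simp: edges_def)
    show "e \<in> (\<lambda>(a, b). {Up a b, Dn a b}) ` T1 \<union> (\<lambda>(a, b). {Dn a b, Up (a + 1) b}) ` T2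
      \<union> (\<lambda>(a, b). {Dn a b, Up a (b + 1)}) ` T3"
    proof (cases x)
      case (Up a b)
      then show ?thesis using e UD by (cases y) (auto simp: nn_Up_Up)
    next
      case (Dn a b)
      then show ?thesis using e UD[of _ _ a b] nn_commute
        by (cases y) (simp_all add: nn_Dn_Dn insert_commute)
    qed
  qed
  then have "card (edges S) \<le> card ((\<lambda>(a, b). {Up a b, Dn a b}) ` T1 \<union> (\<lambda>(a, b). {Dn a b, Up (a + 1) b}) ` T2
      \<union> (\<lambda>(a, b). {Dn a b, Up a (b + 1)}) ` T3)"
    using fin by (intro card_mono) auto
  also have "\<dots> \<le> card T1 + card T2 + card T3"
    using card_image_le[OF fin(1)] card_image_le[OF fin(2)] card_image_le[OF fin(3)]
    by (intro order_trans[OF card_Un_le] add_mono) auto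
  finally have E: "card (edges S) \<le> card T1 + card T2 + card T3" .
  have injs: "inj stepA" "inj stepB" "inj stepC"
  proof -
    show "inj stepA"
    proof (rule injI)
      fix x y assume "stepA x = stepA y" then show "x = y" by (cases x; cases y) auto
    qed
    show "inj stepB"
    proof (rule injI)
      fix x y assume "stepB x = stepB y" then show "x = y" by (cases x; cases y) auto
    qed
    show "inj stepC"
    proof (rule injI)
      fix x y assume "stepC x = stepC y" then show "x = y" by (cases x; cases y) auto
    qed
  qed
  have "coordA (stepA s) = coordA s" "coordB (stepB s) = coordB s" "coordC (stepC s) = coordC s" for s
    by (cases s; simp)+
  \<comment> \<open>The position of a face in its strip; downward faces sit halfway between
    consecutive upward ones, hence the factor 2.\<close>
  moreover have "2 * coordB (stepA s) + of_bool (is_Dn (stepA s)) = 2 * coordB s + of_bool (is_Dn s) + 1"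
    "2 * coordA (stepB s) + of_bool (is_Dn (stepB s)) = 2 * coordA s + of_bool (is_Dn s) + 1"
    "2 * coordB (stepC s) + of_bool (is_Dn (stepC s)) = 2 * coordB s + of_bool (is_Dn s) + 1" for s
    by (cases s; simp)+
  ultimately have
    "card {s \<in> S. stepA s \<in> S} + card (coordA ` S) \<le> card S"
    "card {s \<in> S. stepB s \<in> S} + card (coordB ` S) \<le> card S"
    "card {s \<in> S. stepC s \<in> S} + card (coordC ` S) \<le> card S"
    using card_strips[OF S injs(1), of coordA "\<lambda>s. 2 * coordB s + of_bool (is_Dn s)"]
      card_strips[OF S injs(2), of coordB "\<lambda>s. 2 * coordA s + of_bool (is_Dn s)"]
      card_strips[OF S injs(3), of coordC "\<lambda>s. 2 * coordB s + of_bool (is_Dn s)"] by blast+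
  then show ?thesis using A B C E by simp
qed

text \<open>An upward face is a pair of strip numbers with sum in the third set. For a downward face
  the sum is smaller by one than its third strip number, so the same count applies to the translated
  set.\<close>

lemma card_le_strips:
  assumes S: "finite S" and t: "t \<le> card (coordA ` S)" "t \<le> card (coordB ` S)"
  shows "card S \<le> 2 * (t * card (coordC ` S) + (card (coordA ` S) - t) * (card (coordB ` S) - t))"
proof -
  let ?A = "coordA ` S" and ?B = "coordB ` S" and ?C = "coordC ` S"
  let ?N = "\<lambda>C. {(a, b) \<in> ?A \<times> ?B. a + b \<in> C}"
  let ?C' = "(\<lambda>c. c - 1) ` ?C"
  have fin: "finite (?N C)" for C by (rule finite_subset[of _ "?A \<times> ?B"]) (use S in auto)
  have "S \<subseteq> case_prod Up ` ?N ?C \<union> case_prod Dn ` ?N ?C'"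
  proof
    fix s assume s: "s \<in> S"
    show "s \<in> case_prod Up ` ?N ?C \<union> case_prod Dn ` ?N ?C'"
    proof (cases s)
      case (Up a b)
      have "a \<in> ?A" "b \<in> ?B" "a + b \<in> ?C"
        using s Up by (auto intro!: image_eqI[of _ _ s])
      then have "(a, b) \<in> ?N ?C" by simp
      then have "s \<in> case_prod Up ` ?N ?C" unfolding Up by (rule rev_image_eqI) simp
      then show ?thesis by blast
    next
      case (Dn a b)
      have "a \<in> ?A" "b \<in> ?B" "a + b + 1 \<in> ?C"
        using s Dn by (auto intro!: image_eqI[of _ _ s])
      then have "(a, b) \<in> ?N ?C'" by (auto intro!: image_eqI[of _ _ "a + b + 1"] simp del: image_image)
      then have "s \<in> case_prod Dn ` ?N ?C'" unfolding Dn by (rule rev_image_eqI) simp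
      then show ?thesis by blast
    qed
  qed
  then have "card S \<le> card (case_prod Up ` ?N ?C \<union> case_prod Dn ` ?N ?C')"
    using fin by (intro card_mono) auto
  also have "\<dots> \<le> card (?N ?C) + card (?N ?C')"
    using card_image_le[OF fin] by (intro order_trans[OF card_Un_le] add_mono) auto
  also have "card (?N ?C) \<le> t * card ?C + (card ?A - t) * (card ?B - t)"
    using S t by (intro card_sumset_pairs_le) auto
  also have "card (?N ?C') \<le> t * card ?C' + (card ?A - t) * (card ?B - t)"
    using S t by (intro card_sumset_pairs_le) auto
  also have "card ?C' = card ?C" by (intro card_image) (auto intro: inj_onI)
  finally show ?thesis by simp
qed

text \<open>
  Without the term 3 this is the sharp isoperimetric inequality; the loss comes from an odd value
  of \<open>x + y - z\<close> below.
\<close>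

lemma isoperimetric:
  assumes S: "finite S"
  defines "p \<equiv> int (card (coordA ` S)) + int (card (coordB ` S)) + int (card (coordC ` S))"
  shows "6 * int (card S) \<le> p\<^sup>2 + 3"
proof -
  define x y z where "x = int (card (coordA ` S))" "y = int (card (coordB ` S))" "z = int (card (coordC ` S))"
  have nn: "0 \<le> x" "0 \<le> y" "0 \<le> z" by (simp_all add: x_y_z_def)
  have main: "int (card S) \<le> 2 * (t * z + (x - t) * (y - t))" if t: "0 \<le> t" "t \<le> x" "t \<le> y" for t
  proof -
    have "nat t \<le> card (coordA ` S)" "nat t \<le> card (coordB ` S)" using t by (simp_all add: x_y_z_def)
    from card_le_strips[OF S this] have
      "int (card S) \<le> int (2 * (nat t * card (coordC ` S) + (card (coordA ` S) - nat t) * (card (coordB ` S) - nat t)))"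
      by (rule of_nat_mono)
    also have "\<dots> = 2 * (t * z + (x - t) * (y - t))"
      using t by (simp add: x_y_z_def of_nat_diff nat_le_iff)
    finally show ?thesis .
  qed
  have sq: "0 \<le> (x - y)\<^sup>2" "0 \<le> (y - z)\<^sup>2" "0 \<le> (x - z)\<^sup>2" by simp_all
  \<comment> \<open>If one strip number is at least the sum of the other two, counting all pairs of
    those two is enough: this is \<open>t = 0\<close>, \<open>t = y\<close> or
    \<open>t = x\<close>.\<close>
  consider "x + y \<le> z" | "y + z \<le> x" | "x + z \<le> y" | "z < x + y" "x < y + z" "y < x + z" by linarith
  then have "6 * int (card S) \<le> (x + y + z)\<^sup>2 + 3"
  proof cases
    case 1
    then have "(2 * (x + y))\<^sup>2 \<le> (x + y + z)\<^sup>2" using nn by (intro power_mono) auto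
    then show ?thesis using main[of 0] nn sq mult_nonneg_nonneg[OF nn(1,2)] by (simp add: power2_eq_square algebra_simps)
  next
    case 2
    then have "(2 * (y + z))\<^sup>2 \<le> (x + y + z)\<^sup>2" using nn by (intro power_mono) auto
    then show ?thesis using main[of y] 2 nn sq mult_nonneg_nonneg[OF nn(2,3)] by (simp add: power2_eq_square algebra_simps)
  next
    case 3
    then have "(2 * (x + z))\<^sup>2 \<le> (x + y + z)\<^sup>2" using nn by (intro power_mono) auto
    then show ?thesis using main[of x] 3 nn sq mult_nonneg_nonneg[OF nn(1,3)] by (simp add: power2_eq_square algebra_simps)
  next
    case 4
    \<comment> \<open>The quadratic \<open>t * z + (x - t) * (y - t)\<close> is least at half of
      \<open>x + y - z\<close>, here rounded down.\<close>
    define t where "t = (x + y - z) div 2"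
    have t: "0 \<le> t" "t \<le> x" "t \<le> y" using 4 by (auto simp: t_def)
    have "z = x + y - 2 * t \<or> z = x + y - 2 * t - 1" unfolding t_def by linarith
    then show ?thesis
    proof
      assume z: "z = x + y - 2 * t"
      have "0 \<le> (x + y - 4 * t)\<^sup>2" by simp
      then show ?thesis using main[OF t] sq(1) unfolding z by (simp add: power2_eq_square algebra_simps)
    next
      assume z: "z = x + y - 2 * t - 1"
      have "0 \<le> (x + y - 2 * (2 * t + 1))\<^sup>2" by simp
      then show ?thesis using main[OF t] sq(1) unfolding z by (simp add: power2_eq_square algebra_simps)
    qed
  qed
  then show ?thesis by (simp add: p_def x_y_z_def)
qed

text \<open>The perimeter \<open>q\<close> is at least the number of strips met, so the
  isoperimetric inequality gives \<open>p < q\<close>. Parity turns this into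
  \<open>p + 2 \<le> q\<close>: \<open>q\<close> has the parity of \<open>card S\<close>, and
  \<open>p\<close> is odd as well.\<close>

lemma card_edges_upper_bound:
  assumes "finite S" "odd (card S)" "odd p" "p\<^sup>2 + 3 < 6 * int (card S)" "0 \<le> p"
  shows "2 * int (card (edges S)) \<le> 3 * int (card S) - p - 2"
proof -
  define q where "q = 3 * int (card S) - 2 * int (card (edges S))"
  define s where "s = int (card (coordA ` S)) + int (card (coordB ` S)) + int (card (coordC ` S))"
  have s: "0 \<le> s" "s \<le> q" using edges_strips[OF assms(1)] by (auto simp: s_def q_def)
  have "p < q"
  proof (rule ccontr)
    assume "\<not> p < q"
    then have "s\<^sup>2 \<le> p\<^sup>2" using s by (intro power_mono) auto
    then show False using isoperimetric[OF assms(1)] assms(4) by (simp add: s_def)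
  qed
  moreover have "odd q" using assms(2) by (simp add: q_def)
  ultimately have "p + 2 \<le> q" using assms(3) by presburger
  then show ?thesis by (simp add: q_def)
qed

section \<open>Attaching bars\<close>

text \<open>The position within a strip of constant \<open>coordA\<close>, counted in applications
  of \<open>stepA\<close>. It is used to send particles straight up and out.\<close>

fun altitude :: "site \<Rightarrow> int" where
  "altitude (Up a b) = 2 * b"
| "altitude (Dn a b) = 2 * b + 1"

lemma nn_stepA: "nn x (stepA x)"
  by (cases x) (simp_all add: nn_simps)

lemma coordA_stepA_pow: "coordA ((stepA ^^ i) x) = coordA x"
proof (induction i)
  case (Suc i)
  have "coordA (stepA y) = coordA y" for y by (cases y) auto
  then show ?case using Suc by simp
qed simp

lemma altitude_stepA_pow: "altitude ((stepA ^^ i) x) = altitude x + int i"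
proof (induction i)
  case (Suc i)
  have "altitude (stepA y) = altitude y + 1" for y by (cases y) auto
  then show ?case using Suc by simp
qed simp

lemma altitude_hexagon: "x \<in> hexagon L \<Longrightarrow> altitude x < 2 * int L"
  by (cases x) (auto simp: Up_in_hexagon Dn_in_hexagon)

lemma finite_subset_Lam: "S \<subseteq> Lam L \<Longrightarrow> finite S"
  using finite_Lam finite_subset by blast

lemma finite_subset_hexagon: "S \<subseteq> hexagon L \<Longrightarrow> finite S"
  using finite_hexagon finite_subset by blast

lemma energy_hexagon:
  "S \<subseteq> hexagon L \<Longrightarrow> energy L U \<Delta> S = - U * card (edges S) + \<Delta> * card S"
  by (simp add: energy_def Int_absorb2)

lemma energy_insert_le:
  assumes "S \<subseteq> Lam L" "x \<notin> S" "0 \<le> U"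
  shows "energy L U \<Delta> (insert x S) \<le> energy L U \<Delta> S + \<Delta>"
proof -
  have "finite S" using assms finite_subset_Lam by blast
  then have "card (edges (S \<inter> hexagon L)) \<le> card (edges (insert x S \<inter> hexagon L))"
    by (intro card_mono finite_edges edges_mono) auto
  then have "U * card (edges (S \<inter> hexagon L)) \<le> U * card (edges (insert x S \<inter> hexagon L))"
    using assms by (intro mult_left_mono) auto
  then show ?thesis using assms \<open>finite S\<close> by (simp add: energy_def algebra_simps)
qed

lemma energy_insert_bd:
  assumes "S \<subseteq> Lam L" "x \<notin> S" "x \<in> Lam_bd L"
  shows "energy L U \<Delta> (insert x S) = energy L U \<Delta> S + \<Delta>"
proof -
  have "insert x S \<inter> hexagon L = S \<inter> hexagon L" using assms by (auto simp: Lam_bd_eq_diff)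
  then show ?thesis using assms finite_subset_Lam[of S L] by (simp add: energy_def algebra_simps)
qed

text \<open>
  A particle entering at the boundary walks along vacant sites; on its way it cannot raise the
  energy above its value when isolated.
\<close>

lemma reach_insert_path:
  assumes S: "S \<subseteq> hexagon L" and nn: "\<And>i. nn (q i) (q (Suc i))" and vac: "\<And>i. q i \<notin> S"
    and q0: "q 0 \<in> hexagon L" and out: "q k \<notin> hexagon L"
    and "0 \<le> U" "0 \<le> \<Delta>" "energy L U \<Delta> S + \<Delta> < \<Gamma>"
  shows "reach L U \<Delta> \<Gamma> S (insert (q 0) S)"
proof -
  have SL: "S \<subseteq> Lam L" using S hexagon_subset_Lam by blast
  \<comment> \<open>The first site outside the hexagon is adjacent to a site inside, hence belongs
    to the boundary layer.\<close>
  define m where "m = (LEAST i. q i \<notin> hexagon L)"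
  have m: "q m \<notin> hexagon L" "\<And>i. i < m \<Longrightarrow> q i \<in> hexagon L"
    using LeastI[of "\<lambda>i. q i \<notin> hexagon L", OF out] not_less_Least unfolding m_def by blast+
  obtain m' where m': "m = Suc m'" using m q0 by (cases m) auto
  have "nn (q m) (q m')" using nn[of m'] nn_commute by (simp add: m')
  then have "q m \<in> Lam L" using m(2)[of m'] unfolding Lam_eq m' by blast
  then have bd: "q m \<in> Lam_bd L" using m by (simp add: Lam_bd_eq_diff)
  have low: "energy L U \<Delta> (insert (q i) S) < \<Gamma>" for i
    using energy_insert_le[OF SL vac[of i] assms(6), where \<Delta> = \<Delta>] assms(8) by simp
  have qL: "q i \<in> Lam L" if "i \<le> m" for i
    using that m bd Lam_bd_subset hexagon_subset_Lam by (metis le_neq_implies_less subsetD)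
  have "reach L U \<Delta> \<Gamma> S (insert (q i) S)" if "i \<le> m" for i
    using that
  \<comment> \<open>The walk is traversed backwards, from the entry at \<open>q m\<close> to
    \<open>q 0\<close>.\<close>
  proof (induction i rule: inc_induct)
    case base
    show ?case using assms(7,8) low SL
      by (intro reach_step adj.enter bd vac) auto
  next
    case (step i)
    have "q i \<noteq> q (Suc i)" using nn[of i] not_nn_refl by metis
    then have "adj L (insert (q (Suc i)) S) (insert (q i) (insert (q (Suc i)) S - {q (Suc i)}))"
      using qL[of i] qL[of "Suc i"] step nn[of i] vac nn_commute by (intro adj.swap) auto
    then have "adj L (insert (q (Suc i)) S) (insert (q i) S)" using vac by simp
    then have "reach L U \<Delta> \<Gamma> (insert (q (Suc i)) S) (insert (q i) S)"
      using qL[of "Suc i"] step SL low by (intro reach_step) auto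
    then show ?case using step reach_trans by blast
  qed
  then show ?thesis by simp
qed

text \<open>Nothing of \<open>S\<close> lies above \<open>x\<close> in its strip, so the strip
  itself is a vacant corridor to the outside.\<close>

lemma reach_insert_above:
  assumes "S \<subseteq> hexagon L" "x \<in> hexagon L"
    and above: "\<And>y. y \<in> S \<Longrightarrow> coordA y = coordA x \<Longrightarrow> altitude y < altitude x"
    and "0 \<le> U" "0 \<le> \<Delta>" "energy L U \<Delta> S + \<Delta> < \<Gamma>"
  shows "reach L U \<Delta> \<Gamma> S (insert x S)"
proof -
  let ?q = "\<lambda>i. (stepA ^^ i) x"
  have "reach L U \<Delta> \<Gamma> S (insert (?q 0) S)"
  proof (rule reach_insert_path[where k = "nat (2 * int L - altitude x)"])
    show "nn (?q i) (?q (Suc i))" for i using nn_stepA by simp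
    show "?q i \<notin> S" for i
      using above[of "?q i"] by (auto simp: coordA_stepA_pow altitude_stepA_pow)
    show "?q (nat (2 * int L - altitude x)) \<notin> hexagon L"
      using altitude_hexagon[of "?q (nat (2 * int L - altitude x))" L]
      unfolding altitude_stepA_pow by linarith
  qed (use assms in auto)
  then show ?thesis by simp
qed

text \<open>A bar lying on a horizontal side: \<open>l\<close> upward faces rest on the side, with
  the \<open>l - 1\<close> downward faces between them.\<close>

definition top_bar :: "int \<Rightarrow> int \<Rightarrow> nat \<Rightarrow> site set" where
  "top_bar h a0 l = {Up a h | a. a0 \<le> a \<and> a < a0 + int l} \<union> {Dn a h | a. a0 \<le> a \<and> a + 1 < a0 + int l}"

lemma in_top_bar:
  "Up a b \<in> top_bar h a0 l \<longleftrightarrow> b = h \<and> a0 \<le> a \<and> a < a0 + int l"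
  "Dn a b \<in> top_bar h a0 l \<longleftrightarrow> b = h \<and> a0 \<le> a \<and> a + 1 < a0 + int l"
  by (auto simp: top_bar_def)

lemma top_bar_1: "top_bar h a0 1 = {Up a0 h}"
proof (rule set_eqI)
  fix x show "x \<in> top_bar h a0 1 \<longleftrightarrow> x \<in> {Up a0 h}" by (cases x) (auto simp: in_top_bar)
qed

lemma top_bar_Suc:
  assumes "k \<ge> 1"
  shows "top_bar h a0 (Suc k) = insert (Up (a0 + int k) h) (insert (Dn (a0 + int k - 1) h) (top_bar h a0 k))"
proof (rule set_eqI)
  fix x show "x \<in> top_bar h a0 (Suc k) \<longleftrightarrow>
      x \<in> insert (Up (a0 + int k) h) (insert (Dn (a0 + int k - 1) h) (top_bar h a0 k))"
    using assms by (cases x) (auto simp: in_top_bar)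
qed

locale attachable =
  fixes D :: "site set" and h a0 :: int and l :: nat
  assumes finite_D: "finite D" and below: "\<And>x. x \<in> D \<Longrightarrow> coordB x < h"
    and support: "\<And>a. a0 \<le> a \<Longrightarrow> a < a0 + int l \<Longrightarrow> Dn a (h - 1) \<in> D"
begin

abbreviation "T k \<equiv> D \<union> top_bar h a0 k"
abbreviation "T' k \<equiv> insert (Dn (a0 + int k - 1) h) (T k)"

lemma fresh:
  "Up a b \<in> T k \<Longrightarrow> b \<ge> h \<Longrightarrow> b = h \<and> a0 \<le> a \<and> a < a0 + int k"
  "Dn a b \<in> T k \<Longrightarrow> b \<ge> h \<Longrightarrow> b = h \<and> a0 \<le> a \<and> a + 1 < a0 + int k"
  using below[of "Up a b"] below[of "Dn a b"] by (auto simp: in_top_bar)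

lemma finite_T: "finite (T k)"
proof -
  have "top_bar h a0 k \<subseteq> (\<lambda>a. Up a h) ` {a0..a0 + int k} \<union> (\<lambda>a. Dn a h) ` {a0..a0 + int k}"
    by (auto simp: top_bar_def)
  then show ?thesis using finite_D by (simp add: finite_subset)
qed

lemma T_Suc: "k \<ge> 1 \<Longrightarrow> T (Suc k) = insert (Up (a0 + int k) h) (T' k)"
  by (simp add: top_bar_Suc)

lemma notin_T:
  shows "k \<ge> 1 \<Longrightarrow> Dn (a0 + int k - 1) h \<notin> T k" "Up (a0 + int k) h \<notin> T' k"
  using fresh[of "a0 + int k - 1" h k] fresh[of "a0 + int k" h k] by auto

lemma card_neighbours_T_1:
  assumes "l \<ge> 1" shows "card {y \<in> D. nn (Up a0 h) y} = 1"
proof -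
  have "{y \<in> D. nn (Up a0 h) y} = {Dn a0 (h - 1)}"
  proof (rule set_eqI)
    fix x show "x \<in> {y \<in> D. nn (Up a0 h) y} \<longleftrightarrow> x \<in> {Dn a0 (h - 1)}"
      using assms support[of a0] below[of x] by (cases x) (auto simp: nn_simps)
  qed
  then show ?thesis by simp
qed

lemma card_neighbours_T':
  assumes "k \<ge> 1" shows "card {y \<in> T k. nn (Dn (a0 + int k - 1) h) y} = 1"
proof -
  have "{y \<in> T k. nn (Dn (a0 + int k - 1) h) y} = {Up (a0 + int k - 1) h}"
  proof (rule set_eqI)
    fix x show "x \<in> {y \<in> T k. nn (Dn (a0 + int k - 1) h) y} \<longleftrightarrow> x \<in> {Up (a0 + int k - 1) h}"
    proof (cases x)
      case (Up a b)
      then show ?thesis using assms fresh(1)[of a b k] by (auto simp: nn_simps in_top_bar)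
    qed (simp add: nn_simps)
  qed
  then show ?thesis by simp
qed

lemma card_neighbours_T_Suc:
  assumes "k \<ge> 1" "k < l" shows "card {y \<in> T' k. nn (Up (a0 + int k) h) y} = 2"
proof -
  have "{y \<in> T' k. nn (Up (a0 + int k) h) y} = {Dn (a0 + int k - 1) h, Dn (a0 + int k) (h - 1)}"
  proof (rule set_eqI)
    fix x show "x \<in> {y \<in> T' k. nn (Up (a0 + int k) h) y} \<longleftrightarrow>
        x \<in> {Dn (a0 + int k - 1) h, Dn (a0 + int k) (h - 1)}"
    proof (cases x)
      case (Dn a b)
      then show ?thesis using assms fresh(2)[of a b k] support[of "a0 + int k"]
        by (auto simp: nn_simps in_top_bar)
    qed (simp add: nn_simps)
  qed
  then show ?thesis by simp
qed

text \<open>The first upward face touches only \<open>D\<close>. Each downward face touches only the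
  upward face before it, and each further upward face touches \<open>D\<close> and the downward face
  before it. So every further pair of particles brings three bonds.\<close>

lemma card_T_T':
  assumes "1 \<le> k" "k \<le> l"
  shows "card (edges (T k)) + 2 = card (edges D) + 3 * k" "card (T k) + 1 = card D + 2 * k"
    "card (edges (T' k)) + 1 = card (edges D) + 3 * k" "card (T' k) = card D + 2 * k"
proof -
  have *: "card (edges (T k)) + 2 = card (edges D) + 3 * k \<and> card (T k) + 1 = card D + 2 * k"
    using assms
  proof (induction k rule: dec_induct)
    case base
    have "Up a0 h \<notin> D" using below[of "Up a0 h"] by auto
    then show ?case using card_neighbours_T_1 base finite_D
      by (simp add: top_bar_1[simplified] card_edges_insert)
  next
    case (step k)
    then show ?case using finite_T[of k] notin_T[of k] card_neighbours_T'[of k] card_neighbours_T_Suc[of k]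
      by (simp only: T_Suc) (simp add: card_edges_insert)
  qed
  then show "card (edges (T k)) + 2 = card (edges D) + 3 * k" "card (T k) + 1 = card D + 2 * k" by auto
  show "card (edges (T' k)) + 1 = card (edges D) + 3 * k" "card (T' k) = card D + 2 * k"
    using * finite_T[of k] notin_T[of k] card_neighbours_T'[of k] assms by (simp_all add: card_edges_insert)
qed

text \<open>
  The bar is filled from left to right.  The highest energy is that of the third particle of the
  bar when it is still isolated.
\<close>

lemma reach_bar:
  assumes sub: "T l \<subseteq> hexagon L" and U: "0 < U" "U < \<Delta>" "\<Delta> < 3 / 2 * U"
    and low: "energy L U \<Delta> D + (3 * \<Delta> - 2 * U) < \<Gamma>" and l: "l \<ge> 1"
  shows "reach L U \<Delta> \<Gamma> D (T l)"
proof -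
  let ?E = "energy L U \<Delta>"
  have subk: "T k \<subseteq> T l" if "k \<le> l" for k
    using that by (fastforce simp: top_bar_def)
  have E: "?E (T k) = ?E D - U * (3 * real k - 2) + \<Delta> * (2 * real k - 1)"
      "?E (T' k) = ?E D - U * (3 * real k - 1) + \<Delta> * (2 * real k)"
      "T' k \<subseteq> hexagon L" "T k \<subseteq> hexagon L" if k: "1 \<le> k" "k < l" for k
  proof -
    have "T' k \<subseteq> T (Suc k)" by (simp only: T_Suc[OF k(1)]) blast
    then show s: "T' k \<subseteq> hexagon L" using subk[of "Suc k"] k sub by auto
    then show s': "T k \<subseteq> hexagon L" by auto
    then have s'': "D \<subseteq> hexagon L" by auto
    have c: "real (card (edges (T k))) = card (edges D) + 3 * real k - 2"
      "real (card (T k)) = card D + 2 * real k - 1"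
      "real (card (edges (T' k))) = card (edges D) + 3 * real k - 1"
      "real (card (T' k)) = card D + 2 * real k"
      using card_T_T'[of k] k by linarith+
    show "?E (T k) = ?E D - U * (3 * real k - 2) + \<Delta> * (2 * real k - 1)"
      unfolding energy_hexagon[OF s'] energy_hexagon[OF s''] c by (simp add: algebra_simps)
    show "?E (T' k) = ?E D - U * (3 * real k - 1) + \<Delta> * (2 * real k)"
      unfolding energy_hexagon[OF s] energy_hexagon[OF s''] c by (simp add: algebra_simps)
  qed
  have lowT: "?E (T k) + \<Delta> < \<Gamma>" "?E (T' k) + \<Delta> < \<Gamma>" if k: "1 \<le> k" "k < l" for k
  proof -
    \<comment> \<open>A complete pair changes the energy by \<open>2 * \<Delta> - 3 * U < 0\<close>,
      so the first pair, \<open>k = 1\<close>, is the worst.\<close>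
    have "(real k - 1) * (2 * \<Delta> - 3 * U) \<le> 0"
      using k U by (intro mult_nonneg_nonpos) auto
    then have "?E (T k) \<le> ?E D - U + \<Delta>" "?E (T' k) \<le> ?E D - 2 * U + 2 * \<Delta>"
      unfolding E[OF k] by (simp_all add: algebra_simps)
    then show "?E (T k) + \<Delta> < \<Gamma>" "?E (T' k) + \<Delta> < \<Gamma>" using low U by linarith+
  qed
  have "reach L U \<Delta> \<Gamma> D (T k)" if "1 \<le> k" "k \<le> l" for k
    using that
  proof (induction k rule: dec_induct)
    case base
    have x: "Up a0 h \<in> hexagon L" using subk[OF l] sub by (auto simp: top_bar_1[simplified])
    have "altitude y < altitude (Up a0 h)" if "y \<in> D" for y
      using below[OF that] by (cases y) auto
    then have "reach L U \<Delta> \<Gamma> D (insert (Up a0 h) D)"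
      using sub U low x by (intro reach_insert_above) auto
    then show ?case by (simp add: top_bar_1[simplified])
  next
    case (step k)
    then have k: "1 \<le> k" "k < l" by auto
    have "T (Suc k) \<subseteq> hexagon L" using subk[of "Suc k"] k sub by auto
    then have x: "Dn (a0 + int k - 1) h \<in> hexagon L" "Up (a0 + int k) h \<in> hexagon L"
      using T_Suc[OF k(1)] by auto
    have "altitude y < altitude (Dn (a0 + int k - 1) h)"
      if "y \<in> T k" "coordA y = coordA (Dn (a0 + int k - 1) h)" for y
    proof (cases y)
      case (Up a b) then show ?thesis using fresh(1)[of a b k] that by (cases "h \<le> b") auto
    next
      case (Dn a b) then show ?thesis using fresh(2)[of a b k] that by (cases "h \<le> b") auto
    qed
    then have 1: "reach L U \<Delta> \<Gamma> (T k) (T' k)"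
      using E(4)[OF k] x U lowT(1)[OF k] by (intro reach_insert_above) auto
    have "altitude y < altitude (Up (a0 + int k) h)"
      if "y \<in> T' k" "coordA y = coordA (Up (a0 + int k) h)" for y
    proof (cases y)
      case (Up a b) then show ?thesis using fresh(1)[of a b k] that by (cases "h \<le> b") auto
    next
      case (Dn a b) then show ?thesis using fresh(2)[of a b k] that by (cases "h \<le> b") auto
    qed
    then have "reach L U \<Delta> \<Gamma> (T' k) (insert (Up (a0 + int k) h) (T' k))"
      using E(3)[OF k] x U lowT(2)[OF k] by (intro reach_insert_above) auto
    then have "reach L U \<Delta> \<Gamma> (T' k) (T (Suc k))" by (simp only: T_Suc[OF k(1)])
    then show ?case using step.IH k 1 reach_trans by (meson less_imp_le)
  qed
  then show ?thesis using l by simp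
qed

end

section \<open>Rotations\<close>

text \<open>The rotation by \<pi>/3 about the origin, as a map of faces. It preserves the container
  and the dynamics, so it suffices to build bars on the top side.\<close>

fun rotate_site :: "site \<Rightarrow> site" where
  "rotate_site (Up a b) = Dn (- b - 1) (a + b)"
| "rotate_site (Dn a b) = Up (- b - 1) (a + b + 1)"

lemma verts_rotate_site: "verts (rotate_site x) = rot_ccw ` verts x"
  by (cases x) (auto simp: rot_ccw_def)

lemma inj_rotate_site: "inj rotate_site"
proof (rule injI)
  fix x y assume "rotate_site x = rotate_site y" then show "x = y" by (cases x; cases y) auto
qed

lemma nn_rotate_site: "nn (rotate_site x) (rotate_site y) \<longleftrightarrow> nn x y"
  by (cases x; cases y) (auto simp: nn_simps)

lemma rotate_site_in_hexagon: "rotate_site x \<in> hexagon L \<longleftrightarrow> x \<in> hexagon L"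
  by (cases x) (auto simp: Up_in_hexagon Dn_in_hexagon)

lemma surj_rotate_site: "surj rotate_site"
proof (rule surjI)
  fix x show "rotate_site (case x of Up a b \<Rightarrow> Dn (a + b) (- a - 1) | Dn a b \<Rightarrow> Up (a + b + 1) (- a - 1)) = x"
    by (cases x) auto
qed

lemma rotate_site_in_Lam: "rotate_site x \<in> Lam L \<longleftrightarrow> x \<in> Lam L"
proof -
  have "(\<exists>y\<in>hexagon L. nn (rotate_site x) y) \<longleftrightarrow> (\<exists>y. rotate_site y \<in> hexagon L \<and> nn (rotate_site x) (rotate_site y))"
    using surj_rotate_site by (metis surjD)
  then show ?thesis by (auto simp: Lam_eq nn_rotate_site rotate_site_in_hexagon)
qed

lemma rotate_image_subset:
  "rotate_site ` S \<subseteq> hexagon L \<longleftrightarrow> S \<subseteq> hexagon L" "rotate_site ` S \<subseteq> Lam L \<longleftrightarrow> S \<subseteq> Lam L"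
  by (auto simp: rotate_site_in_hexagon rotate_site_in_Lam)

lemma card_rotate: "card (rotate_site ` S) = card S"
  by (rule card_image) (rule inj_on_subset[OF inj_rotate_site], simp)

lemma card_edges_rotate: "card (edges (rotate_site ` S)) = card (edges S)"
  by (rule card_edges_image) (auto simp: nn_rotate_site intro: inj_on_subset[OF inj_rotate_site])

lemma energy_rotate: "energy L U \<Delta> (rotate_site ` S) = energy L U \<Delta> S"
proof -
  have "rotate_site ` S \<inter> hexagon L = rotate_site ` (S \<inter> hexagon L)"
    by (auto simp: rotate_site_in_hexagon)
  then show ?thesis by (simp add: energy_def card_rotate card_edges_rotate)
qed

lemma adj_rotate: "adj L S T \<Longrightarrow> adj L (rotate_site ` S) (rotate_site ` T)"
proof (induction rule: adj.induct)
  case (swap x y S)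
  have "rotate_site ` insert y (S - {x}) = insert (rotate_site y) (rotate_site ` S - {rotate_site x})"
    using inj_rotate_site by (simp add: image_set_diff)
  then show ?case using swap
    by (simp only:) (intro adj.swap; simp add: rotate_site_in_Lam nn_rotate_site inj_image_mem_iff[OF inj_rotate_site])
next
  case (enter y S)
  then show ?case
    by (simp add: adj.enter Lam_bd_eq_diff rotate_site_in_Lam rotate_site_in_hexagon
        inj_image_mem_iff[OF inj_rotate_site])
next
  case (exit y S)
  have "rotate_site ` (S - {y}) = rotate_site ` S - {rotate_site y}"
    using inj_rotate_site by (simp add: image_set_diff)
  then show ?case using exit
    by (simp add: adj.exit Lam_bd_eq_diff rotate_site_in_Lam rotate_site_in_hexagon
        inj_image_mem_iff[OF inj_rotate_site])
qed

lemma reach_rotate: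
  assumes "reach L U \<Delta> \<Gamma> S T"
  shows "reach L U \<Delta> \<Gamma> (rotate_site ` S) (rotate_site ` T)"
  using assms unfolding reach_def
proof (induction rule: rtrancl_induct)
  case (step S' T')
  then have "(rotate_site ` S', rotate_site ` T') \<in> low_step L U \<Delta> \<Gamma>"
    by (auto simp: low_step_def adj_rotate energy_rotate rotate_site_in_Lam subset_eq)
  then show ?case using step by simp
qed simp

section \<open>Hexagons with sides along the lattice\<close>

text \<open>The parameters are the values of the support function in the six directions normal to
  the sides, in cyclic order. A rotation permutes them cyclically, and attaching a bar raises one of
  them by 1.\<close>

definition hexa :: "int \<Rightarrow> int \<Rightarrow> int \<Rightarrow> int \<Rightarrow> int \<Rightarrow> int \<Rightarrow> site set" where
  "hexa h0 h1 h2 h3 h4 h5 =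
     faces_in {(a, b). a \<le> h0 \<and> a + b \<le> h1 \<and> b \<le> h2 \<and> - h3 \<le> a \<and> - h4 \<le> a + b \<and> - h5 \<le> b}"

lemma in_hexa:
  "Up a b \<in> hexa h0 h1 h2 h3 h4 h5 \<longleftrightarrow>
     a < h0 \<and> a + b < h1 \<and> b < h2 \<and> - h3 \<le> a \<and> - h4 \<le> a + b \<and> - h5 \<le> b"
  "Dn a b \<in> hexa h0 h1 h2 h3 h4 h5 \<longleftrightarrow>
     a < h0 \<and> a + b + 1 < h1 \<and> b < h2 \<and> - h3 \<le> a \<and> - h4 \<le> a + b + 1 \<and> - h5 \<le> b"
  by (auto simp: hexa_def faces_in_def)

lemma hexagon_eq_hexa: "hexagon r = hexa (int r) (int r) (int r) (int r) (int r) (int r)"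
proof (rule set_eqI)
  fix x show "x \<in> hexagon r \<longleftrightarrow> x \<in> hexa (int r) (int r) (int r) (int r) (int r) (int r)"
    by (cases x) (auto simp: Up_in_hexagon Dn_in_hexagon in_hexa)
qed

lemma hexa_subset_hexagon:
  assumes "h0 \<le> int L" "h1 \<le> int L" "h2 \<le> int L" "h3 \<le> int L" "h4 \<le> int L" "h5 \<le> int L"
  shows "hexa h0 h1 h2 h3 h4 h5 \<subseteq> hexagon L"
proof
  fix x show "x \<in> hexa h0 h1 h2 h3 h4 h5 \<Longrightarrow> x \<in> hexagon L"
    using assms by (cases x) (auto simp: Up_in_hexagon Dn_in_hexagon in_hexa)
qed

lemma finite_hexa: "finite (hexa h0 h1 h2 h3 h4 h5)"
proof (rule finite_subset[OF hexa_subset_hexagon finite_hexagon])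
  let ?M = "\<bar>h0\<bar> + \<bar>h1\<bar> + \<bar>h2\<bar> + \<bar>h3\<bar> + \<bar>h4\<bar> + \<bar>h5\<bar>"
  show "h0 \<le> int (nat ?M)" "h1 \<le> int (nat ?M)" "h2 \<le> int (nat ?M)"
    "h3 \<le> int (nat ?M)" "h4 \<le> int (nat ?M)" "h5 \<le> int (nat ?M)" by auto
qed

lemma rotate_hexa: "rotate_site ` hexa h0 h1 h2 h3 h4 h5 = hexa h5 h0 h1 h2 h3 h4"
proof -
  have "rotate_site x \<in> hexa h5 h0 h1 h2 h3 h4 \<longleftrightarrow> x \<in> hexa h0 h1 h2 h3 h4 h5" for x
    by (cases x) (auto simp: in_hexa)
  then have "rotate_site -` hexa h5 h0 h1 h2 h3 h4 = hexa h0 h1 h2 h3 h4 h5" by auto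
  then show ?thesis using surj_image_vimage_eq[OF surj_rotate_site] by metis
qed

text \<open>What attaching a bar of larger base \<open>l\<close> does to the counts and to the
  energy landscape, in a form that rotations preserve. Containment is required only for the path, so
  the counts are available for droplets of any size.\<close>

definition grows :: "nat \<Rightarrow> real \<Rightarrow> real \<Rightarrow> nat \<Rightarrow> site set \<Rightarrow> site set \<Rightarrow> bool" where
  "grows L U \<Delta> l D D' \<longleftrightarrow> card D' + 1 = card D + 2 * l \<and>
     card (edges D') + 2 = card (edges D) + 3 * l \<and>
     (\<forall>\<Gamma>. D' \<subseteq> hexagon L \<longrightarrow> energy L U \<Delta> D + (3 * \<Delta> - 2 * U) < \<Gamma> \<longrightarrow> reach L U \<Delta> \<Gamma> D D')"

lemma grows_rotate: "grows L U \<Delta> l D D' \<Longrightarrow> grows L U \<Delta> l (rotate_site ` D) (rotate_site ` D')"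
  unfolding grows_def
  by (simp add: card_rotate card_edges_rotate rotate_image_subset energy_rotate reach_rotate)

text \<open>Side number \<open>i\<close> has length \<open>h(i-1) + h(i+1) - h(i)\<close>, with
  indices modulo 6. The first six conditions say that no length is negative, the last three that
  opposite sides are at least one strip apart.\<close>

definition convex_hexa :: "int \<Rightarrow> int \<Rightarrow> int \<Rightarrow> int \<Rightarrow> int \<Rightarrow> int \<Rightarrow> bool" where
  "convex_hexa h0 h1 h2 h3 h4 h5 \<longleftrightarrow>
     0 \<le> h5 + h1 - h0 \<and> 0 \<le> h0 + h2 - h1 \<and> 0 \<le> h1 + h3 - h2 \<and>
     0 \<le> h2 + h4 - h3 \<and> 0 \<le> h3 + h5 - h4 \<and> 0 \<le> h4 + h0 - h5 \<and>
     1 \<le> h0 + h3 \<and> 1 \<le> h1 + h4 \<and> 1 \<le> h2 + h5"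

locale parameters =
  fixes L :: nat and U \<Delta> :: real
  assumes U_pos: "0 < U" and U_less: "U < \<Delta>" and \<Delta>_less: "\<Delta> < 3 / 2 * U"
begin

lemma grows_2:
  assumes "convex_hexa h0 h1 h2 h3 h4 h5" "h1 + h3 - h2 = int l" "l \<ge> 1"
  shows "grows L U \<Delta> l (hexa h0 h1 h2 h3 h4 h5) (hexa h0 h1 (h2 + 1) h3 h4 h5)"
proof -
  interpret attachable "hexa h0 h1 h2 h3 h4 h5" h2 "- h3" l
  proof
    show "finite (hexa h0 h1 h2 h3 h4 h5)" by (rule finite_hexa)
    show "coordB x < h2" if "x \<in> hexa h0 h1 h2 h3 h4 h5" for x
      using that by (cases x) (auto simp: in_hexa)
    show "Dn a (h2 - 1) \<in> hexa h0 h1 h2 h3 h4 h5" if "- h3 \<le> a" "a < - h3 + int l" for a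
      using that assms by (auto simp: in_hexa convex_hexa_def)
  qed
  have eq: "hexa h0 h1 (h2 + 1) h3 h4 h5 = T l"
  proof (rule set_eqI)
    fix x show "x \<in> hexa h0 h1 (h2 + 1) h3 h4 h5 \<longleftrightarrow> x \<in> T l"
      using assms by (cases x) (auto simp: in_hexa in_top_bar convex_hexa_def)
  qed
  show ?thesis unfolding grows_def eq
    using card_T_T'[of l] assms(3) reach_bar U_pos U_less \<Delta>_less by auto
qed

lemma convex_hexa_rotate: "convex_hexa h0 h1 h2 h3 h4 h5 \<Longrightarrow> convex_hexa h1 h2 h3 h4 h5 h0"
  by (auto simp: convex_hexa_def)

text \<open>Each rotation shifts the side in question by one, so the other five sides follow from
  the top side one after the other.\<close>

lemma grows_3:
  assumes "convex_hexa h0 h1 h2 h3 h4 h5" "h2 + h4 - h3 = int l" "l \<ge> 1"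
  shows "grows L U \<Delta> l (hexa h0 h1 h2 h3 h4 h5) (hexa h0 h1 h2 (h3 + 1) h4 h5)"
  using grows_rotate[OF grows_2[OF convex_hexa_rotate]] assms by (simp add: rotate_hexa)

lemma grows_4:
  assumes "convex_hexa h0 h1 h2 h3 h4 h5" "h3 + h5 - h4 = int l" "l \<ge> 1"
  shows "grows L U \<Delta> l (hexa h0 h1 h2 h3 h4 h5) (hexa h0 h1 h2 h3 (h4 + 1) h5)"
  using grows_rotate[OF grows_3[OF convex_hexa_rotate]] assms by (simp add: rotate_hexa)

lemma grows_5:
  assumes "convex_hexa h0 h1 h2 h3 h4 h5" "h4 + h0 - h5 = int l" "l \<ge> 1"
  shows "grows L U \<Delta> l (hexa h0 h1 h2 h3 h4 h5) (hexa h0 h1 h2 h3 h4 (h5 + 1))"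
  using grows_rotate[OF grows_4[OF convex_hexa_rotate]] assms by (simp add: rotate_hexa)

lemma grows_0:
  assumes "convex_hexa h0 h1 h2 h3 h4 h5" "h5 + h1 - h0 = int l" "l \<ge> 1"
  shows "grows L U \<Delta> l (hexa h0 h1 h2 h3 h4 h5) (hexa (h0 + 1) h1 h2 h3 h4 h5)"
  using grows_rotate[OF grows_5[OF convex_hexa_rotate]] assms by (simp add: rotate_hexa)

lemma grows_1:
  assumes "convex_hexa h0 h1 h2 h3 h4 h5" "h0 + h2 - h1 = int l" "l \<ge> 1"
  shows "grows L U \<Delta> l (hexa h0 h1 h2 h3 h4 h5) (hexa h0 (h1 + 1) h2 h3 h4 h5)"
  using grows_rotate[OF grows_0[OF convex_hexa_rotate]] assms by (simp add: rotate_hexa)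

end

section \<open>Quasi-regular hexagons\<close>

text \<open>The hexagon \<open>quasi_hexagon i r\<close> translated by \<open>(p, q)\<close>.\<close>

definition qhexa :: "nat \<Rightarrow> nat \<Rightarrow> int \<Rightarrow> int \<Rightarrow> site set" where
  "qhexa i r p q = hexa (int r + p + of_bool (3 \<le> i)) (int r + p + q + of_bool (2 \<le> i))
     (int r + q + of_bool (1 \<le> i)) (int r - p + of_bool (6 \<le> i))
     (int r - p - q + of_bool (5 \<le> i)) (int r - q + of_bool (4 \<le> i))"

definition bar_len :: "nat \<Rightarrow> nat \<Rightarrow> nat" where
  "bar_len i r = (if i = 0 then r else if i < 5 then r + 1 else r + 2)"

text \<open>The number of faces of the quasi-regular hexagon. The first bar has
  \<open>2 * r - 1\<close> faces and the following ones, up to \<open>i = 5\<close>, have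
  \<open>2 * r + 1\<close>, which gives the correction \<open>i - 2\<close>. The perimeter is
  \<open>6 * r + i\<close>, as used in \<open>droplet_energy\<close>.\<close>

definition area :: "nat \<Rightarrow> nat \<Rightarrow> int" where
  "area i r = 6 * (int r)\<^sup>2 + 2 * int i * int r + (if i = 0 then 0 else int i - 2)"

definition droplet_energy :: "real \<Rightarrow> real \<Rightarrow> nat \<Rightarrow> nat \<Rightarrow> real" where
  "droplet_energy U \<Delta> i r = (U * (6 * real r + real i) - (3 * U - 2 * \<Delta>) * area i r) / 2"

lemma qhexa_6: "qhexa 6 r p q = qhexa 0 (Suc r) p q"
  by (simp add: qhexa_def algebra_simps)

lemma less_6_cases:
  assumes "i < (6::nat)"
  obtains "i = 0" | "i = 1" | "i = 2" | "i = 3" | "i = 4" | "i = 5"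
  using assms by linarith

lemma finite_qhexa: "finite (qhexa i r p q)"
  by (simp add: qhexa_def finite_hexa)

lemma hexa_mono:
  assumes "h0 \<le> g0" "h1 \<le> g1" "h2 \<le> g2" "h3 \<le> g3" "h4 \<le> g4" "h5 \<le> g5"
  shows "hexa h0 h1 h2 h3 h4 h5 \<subseteq> hexa g0 g1 g2 g3 g4 g5"
proof
  fix x show "x \<in> hexa h0 h1 h2 h3 h4 h5 \<Longrightarrow> x \<in> hexa g0 g1 g2 g3 g4 g5"
    using assms by (cases x) (auto simp: in_hexa)
qed

lemma qhexa_mono: "i \<le> j \<Longrightarrow> qhexa i r p q \<subseteq> qhexa j r p q"
  unfolding qhexa_def by (intro hexa_mono) auto

text \<open>Clockwise from the top, the sides are those numbered 2, 1, 0, 5, 4, 3. Their lengths at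
  the moment of attachment are \<open>r\<close>, four times \<open>r + 1\<close>, and
  \<open>r + 2\<close>.\<close>

lemma (in parameters) grows_qhexa:
  assumes "i < 6" "r \<ge> 1"
  shows "grows L U \<Delta> (bar_len i r) (qhexa i r p q) (qhexa (Suc i) r p q)"
  using assms(1)
proof (cases rule: less_6_cases)
  case 1
  then show ?thesis using assms unfolding qhexa_def bar_len_def
    by simp (intro grows_2; simp add: convex_hexa_def)
next
  case 2
  then show ?thesis using assms unfolding qhexa_def bar_len_def
    by simp (intro grows_1; simp add: convex_hexa_def)
next
  case 3
  then show ?thesis using assms unfolding qhexa_def bar_len_def
    by simp (intro grows_0; simp add: convex_hexa_def)
next
  case 4
  then show ?thesis using assms unfolding qhexa_def bar_len_def
    by simp (intro grows_5; simp add: convex_hexa_def)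
next
  case 5
  then show ?thesis using assms unfolding qhexa_def bar_len_def
    by simp (intro grows_4; simp add: convex_hexa_def)
next
  case 6
  then show ?thesis using assms unfolding qhexa_def bar_len_def
    by simp (intro grows_3; simp add: convex_hexa_def)
qed

text \<open>The order of the six faces matters for nucleation: read from right to left, each strip
  of constant \<open>coordA\<close> is filled from below, so every new particle can come from
  above.\<close>

lemma qhexa_0_1:
  "qhexa 0 1 p q = {Up p q, Dn p (q - 1), Up p (q - 1), Dn (p - 1) q, Up (p - 1) q, Dn (p - 1) (q - 1)}"
proof (rule set_eqI)
  fix x show "x \<in> qhexa 0 1 p q \<longleftrightarrow>
      x \<in> {Up p q, Dn p (q - 1), Up p (q - 1), Dn (p - 1) q, Up (p - 1) q, Dn (p - 1) (q - 1)}"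
    by (cases x) (auto simp: qhexa_def in_hexa)
qed

lemma card_edges_insert_sum:
  assumes "finite S" "x \<notin> S"
  shows "card (edges (insert x S)) = card (edges S) + (\<Sum>y\<in>S. of_bool (nn x y))"
  using assms by (simp add: card_edges_insert Int_def)

lemma qhexa_0_1_counts: "card (qhexa 0 1 p q) = 6" "card (edges (qhexa 0 1 p q)) = 6"
proof -
  have "edges {} = {}" by (simp add: edges_def)
  then show "card (qhexa 0 1 p q) = 6" "card (edges (qhexa 0 1 p q)) = 6"
    unfolding qhexa_0_1 by (simp_all add: card_edges_insert_sum nn_simps)
qed

lemma qhexa_counts:
  assumes "r \<ge> 1" "i \<le> 5"
  shows "int (card (qhexa i r p q)) = area i r \<and>
    2 * int (card (edges (qhexa i r p q))) = 3 * area i r - (6 * int r + int i)"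
proof -
  \<comment> \<open>Only the counts in \<open>grows\<close> are wanted here; the values 5 and 6
    merely satisfy the inequalities between the two energies.\<close>
  interpret parameters 0 "5::real" 6 by unfold_locales auto
  have bar: "int (card (qhexa (Suc i) r p q)) = int (card (qhexa i r p q)) + 2 * int (bar_len i r) - 1"
    "int (card (edges (qhexa (Suc i) r p q))) = int (card (edges (qhexa i r p q))) + 3 * int (bar_len i r) - 2"
    if "i < 6" "r \<ge> 1" for i r
    using grows_qhexa[OF that, of p q] unfolding grows_def by linarith+
  have side: "int (card (qhexa i r p q)) = area i r \<and>
    2 * int (card (edges (qhexa i r p q))) = 3 * area i r - (6 * int r + int i)"
    if "r \<ge> 1" "i \<le> 5" "int (card (qhexa 0 r p q)) = 6 * (int r)\<^sup>2 \<and>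
      2 * int (card (edges (qhexa 0 r p q))) = 18 * (int r)\<^sup>2 - 6 * int r" for i r
    using that(2)
  proof (induction i)
    case 0
    then show ?case using that(3) by (simp add: area_def)
  next
    case (Suc i)
    then have "i < 5" "int (card (qhexa i r p q)) = area i r"
      "2 * int (card (edges (qhexa i r p q))) = 3 * area i r - (6 * int r + int i)" by auto
    then show ?case using bar[of i r] that(1)
      by (cases "i = 0") (auto simp: area_def bar_len_def algebra_simps)
  qed
  have "int (card (qhexa 0 r p q)) = 6 * (int r)\<^sup>2 \<and>
      2 * int (card (edges (qhexa 0 r p q))) = 18 * (int r)\<^sup>2 - 6 * int r" if "r \<ge> 1" for r
    using that
  proof (induction r rule: dec_induct)
    case base
    show ?case by (simp only: qhexa_0_1_counts) simp
  next
    case (step n)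
    then show ?case
      using side[of n 5] bar[of 5 n]
      by (simp add: area_def bar_len_def qhexa_6 power2_eq_square algebra_simps)
  qed
  then show ?thesis using side assms by blast
qed

lemma energy_qhexa:
  assumes "qhexa i r p q \<subseteq> hexagon L" "r \<ge> 1" "i \<le> 5"
  shows "energy L U \<Delta> (qhexa i r p q) = droplet_energy U \<Delta> i r"
proof -
  have "real_of_int (2 * int (card (edges (qhexa i r p q)))) = real_of_int (3 * area i r - (6 * int r + int i))"
    "real_of_int (int (card (qhexa i r p q))) = real_of_int (area i r)"
    using qhexa_counts[OF assms(2,3), of p q] by simp_all
  then have c: "real (card (edges (qhexa i r p q))) = (3 * real_of_int (area i r) - (6 * real r + real i)) / 2"
    "real (card (qhexa i r p q)) = real_of_int (area i r)" by simp_all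
  show ?thesis unfolding energy_hexagon[OF assms(1)] droplet_energy_def c
    by (simp add: field_simps)
qed

lemma energy_le_card: "0 \<le> U \<Longrightarrow> energy L U \<Delta> S \<le> \<Delta> * card S"
  by (simp add: energy_def)

section \<open>Nucleation and dissolution paths\<close>

context parameters begin

lemma reach_empty_qhexa_0_1:
  assumes "qhexa 0 1 p q \<subseteq> hexagon L" "6 * \<Delta> < \<Gamma>"
  shows "reach L U \<Delta> \<Gamma> {} (qhexa 0 1 p q)"
proof -
  have pos: "0 \<le> U" "0 \<le> \<Delta>" using U_pos U_less by auto
  have add: "reach L U \<Delta> \<Gamma> {} (insert x S)"
    if "reach L U \<Delta> \<Gamma> {} S" "insert x S \<subseteq> hexagon L" "card S \<le> 5"
      "\<forall>y\<in>S. coordA y = coordA x \<longrightarrow> altitude y < altitude x" for x S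
  proof (rule reach_trans[OF that(1)], rule reach_insert_above)
    have "\<Delta> * real (card S) \<le> \<Delta> * 5"
      using that pos by (intro mult_left_mono) auto
    then show "energy L U \<Delta> S + \<Delta> < \<Gamma>"
      using energy_le_card[OF pos(1), of L \<Delta> S] assms(2) by simp
  qed (use that pos in auto)
  show ?thesis using assms(1) unfolding qhexa_0_1
    by (intro add reach_refl) (simp_all add: card_insert_if)
qed

text \<open>Bars are attached in clockwise order from the hexagon of radius 1 on. The level is
  compared only with droplets strictly before \<open>(r, i)\<close>, from which bars start, so the
  critical droplet itself is a possible end.\<close>

lemma reach_empty_qhexa:
  assumes "r \<ge> 1" "i \<le> 5" "qhexa i r p q \<subseteq> hexagon L" "6 * \<Delta> < \<Gamma>"
    and low: "\<And>j s. s \<ge> 1 \<Longrightarrow> j \<le> 5 \<Longrightarrow> s < r \<or> s = r \<and> j < i \<Longrightarrow>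
      droplet_energy U \<Delta> j s + (3 * \<Delta> - 2 * U) < \<Gamma>"
  shows "reach L U \<Delta> \<Gamma> {} (qhexa i r p q)"
proof -
  have bar: "reach L U \<Delta> \<Gamma> (qhexa j s p q) (qhexa (Suc j) s p q)"
    if "qhexa (Suc j) s p q \<subseteq> hexagon L" "s \<ge> 1" "j \<le> 5" "s < r \<or> s = r \<and> j < i" for j s
  proof -
    have "qhexa j s p q \<subseteq> hexagon L" using that(1) qhexa_mono[of j "Suc j" s p q] by auto
    then show ?thesis
      using grows_qhexa[of j s p q] low[of s j] that energy_qhexa[of j s p q L U \<Delta>]
      unfolding grows_def by auto
  qed
  have base: "reach L U \<Delta> \<Gamma> {} (qhexa 0 s p q)" if "1 \<le> s" "s \<le> r" "qhexa 0 s p q \<subseteq> hexagon L" for s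
    using that
  proof (induction s rule: dec_induct)
    case base
    then show ?case using reach_empty_qhexa_0_1 assms(4) by simp
  next
    case (step s)
    have sub: "qhexa j s p q \<subseteq> hexagon L" if "j \<le> 6" for j
      using step.prems(2) qhexa_mono[OF that, of s p q] by (simp add: qhexa_6)
    have "reach L U \<Delta> \<Gamma> {} (qhexa j s p q)" if "j \<le> 6" for j
      using that
    proof (induction j)
      case 0 then show ?case using step sub[of 0] by simp
    next
      case (Suc j)
      have "reach L U \<Delta> \<Gamma> (qhexa j s p q) (qhexa (Suc j) s p q)"
      proof (rule bar)
        show "qhexa (Suc j) s p q \<subseteq> hexagon L" using sub Suc.prems by blast
      qed (use step.hyps step.prems(1) Suc.prems in auto)
      with Suc.IH Suc.prems show ?case by (metis Suc_leD reach_trans)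
    qed
    from this[of 6] show ?case by (simp add: qhexa_6)
  qed
  have "reach L U \<Delta> \<Gamma> {} (qhexa j r p q)" if "j \<le> i" for j
    using that
  proof (induction j)
    case 0
    show ?case using base[of r] assms(1,3) qhexa_mono[of 0 i r p q] by auto
  next
    case (Suc j)
    then have "reach L U \<Delta> \<Gamma> (qhexa j r p q) (qhexa (Suc j) r p q)"
      using assms(1-3) qhexa_mono[of "Suc j" i r p q] by (intro bar) auto
    then show ?case using Suc reach_trans by auto
  qed
  then show ?thesis by simp
qed

text \<open>
  The excesses \<open>f\<^sub>i\<close> of the sides over those of the regular hexagon of radius \<open>s\<close> satisfy
  \<open>f\<^sub>i \<ge> f\<^bsub>i-1\<^esub> + f\<^bsub>i+1\<^esub>\<close> at each side that is away from the wall and shorter than \<open>s + 1\<close>.  If all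
  sides away from the wall were of this kind, then all excesses would vanish.
\<close>

lemma free_long_side:
  fixes M :: int
  assumes "h0 \<le> M" "h1 \<le> M" "h2 \<le> M" "h3 \<le> M" "h4 \<le> M" "h5 \<le> M"
    and "p + s \<le> h0" "p + q + s \<le> h1" "q + s \<le> h2" "s - p \<le> h3" "s - p - q \<le> h4" "s - q \<le> h5"
    and "6 * s < h0 + h1 + h2 + h3 + h4 + h5"
    and "h0 \<noteq> M \<or> h1 \<noteq> M \<or> h2 \<noteq> M \<or> h3 \<noteq> M \<or> h4 \<noteq> M \<or> h5 \<noteq> M"
    and "s < M"
  obtains "h0 < M" "s + 1 \<le> h5 + h1 - h0" | "h1 < M" "s + 1 \<le> h0 + h2 - h1"
    | "h2 < M" "s + 1 \<le> h1 + h3 - h2" | "h3 < M" "s + 1 \<le> h2 + h4 - h3"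
    | "h4 < M" "s + 1 \<le> h3 + h5 - h4" | "h5 < M" "s + 1 \<le> h4 + h0 - h5"
  using assms by (smt (verit))

text \<open>A regular hexagon of radius \<open>s\<close> about \<open>(p, q)\<close> stays inside
  the droplet, which yields a free side of length at least \<open>s + 1\<close> until the container
  is full. By \<open>U\<close>, a bar on such a side does not raise the energy, so the assumption on
  the energy persists while the room left decreases.\<close>

lemma reach_hexagon:
  assumes "h0 \<le> int L" "h1 \<le> int L" "h2 \<le> int L" "h3 \<le> int L" "h4 \<le> int L" "h5 \<le> int L"
    and "p + s \<le> h0" "p + q + s \<le> h1" "q + s \<le> h2" "s - p \<le> h3" "s - p - q \<le> h4" "s - q \<le> h5"
    and "6 * s < h0 + h1 + h2 + h3 + h4 + h5"
    and "1 \<le> s" "s < int L" "convex_hexa h0 h1 h2 h3 h4 h5"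
    and U: "U < (3 * U - 2 * \<Delta>) * (2 * s + 1)"
    and "energy L U \<Delta> (hexa h0 h1 h2 h3 h4 h5) + (3 * \<Delta> - 2 * U) < \<Gamma>"
  shows "reach L U \<Delta> \<Gamma> (hexa h0 h1 h2 h3 h4 h5) (hexagon L)"
  using assms
proof (induction "nat (6 * int L - h0 - h1 - h2 - h3 - h4 - h5)" arbitrary: h0 h1 h2 h3 h4 h5 rule: less_induct)
  case less
  note prems = less.prems
  let ?D = "hexa h0 h1 h2 h3 h4 h5"
  have IH: "reach L U \<Delta> \<Gamma> (hexa g0 g1 g2 g3 g4 g5) (hexagon L)"
    if "energy L U \<Delta> (hexa g0 g1 g2 g3 g4 g5) + (3 * \<Delta> - 2 * U) < \<Gamma>"
      "convex_hexa g0 g1 g2 g3 g4 g5"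
      "h0 \<le> g0" "h1 \<le> g1" "h2 \<le> g2" "h3 \<le> g3" "h4 \<le> g4" "h5 \<le> g5"
      "g0 + g1 + g2 + g3 + g4 + g5 = h0 + h1 + h2 + h3 + h4 + h5 + 1"
      "g0 \<le> max h0 (int L)" "g1 \<le> max h1 (int L)" "g2 \<le> max h2 (int L)"
      "g3 \<le> max h3 (int L)" "g4 \<le> max h4 (int L)" "g5 \<le> max h5 (int L)" for g0 g1 g2 g3 g4 g5
  proof (rule less.hyps)
    have g: "g0 \<le> int L" "g1 \<le> int L" "g2 \<le> int L" "g3 \<le> int L" "g4 \<le> int L" "g5 \<le> int L"
      using prems(1-6) that(10-15) by simp_all
    then show "g0 \<le> int L" "g1 \<le> int L" "g2 \<le> int L" "g3 \<le> int L" "g4 \<le> int L" "g5 \<le> int L" .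
    show "nat (6 * int L - g0 - g1 - g2 - g3 - g4 - g5) < nat (6 * int L - h0 - h1 - h2 - h3 - h4 - h5)"
      using g that(9) by linarith
    show "p + s \<le> g0" "p + q + s \<le> g1" "q + s \<le> g2" "s - p \<le> g3" "s - p - q \<le> g4" "s - q \<le> g5"
      using prems(7-12) that(3-8) by (blast intro: order_trans)+
    show "6 * s < g0 + g1 + g2 + g3 + g4 + g5" using prems(13) that(9) by simp
  qed (use prems that in blast)+
  have step: "reach L U \<Delta> \<Gamma> ?D (hexagon L)"
    if "grows L U \<Delta> (nat l) ?D D'" "s + 1 \<le> l" "D' \<subseteq> hexagon L" "?D \<subseteq> hexagon L"
      "energy L U \<Delta> D' + (3 * \<Delta> - 2 * U) < \<Gamma> \<Longrightarrow> reach L U \<Delta> \<Gamma> D' (hexagon L)" for D' l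
  proof -
    have l: "real (nat l) = real_of_int l" using that(2) prems by simp
    have c: "real (card D') = card ?D + 2 * real_of_int l - 1"
        "real (card (edges D')) = card (edges ?D) + 3 * real_of_int l - 2"
      using that(1) unfolding grows_def l[symmetric] by linarith+
    then have "energy L U \<Delta> D' = energy L U \<Delta> ?D + (U - (3 * U - 2 * \<Delta>) * (2 * real_of_int l - 1)) / 2"
      unfolding energy_hexagon[OF that(3)] energy_hexagon[OF that(4)] c by (simp add: field_simps)
    moreover have "(3 * U - 2 * \<Delta>) * (2 * s + 1) \<le> (3 * U - 2 * \<Delta>) * (2 * real_of_int l - 1)"
      using that(2) \<Delta>_less by (intro mult_left_mono) auto
    ultimately have "energy L U \<Delta> D' \<le> energy L U \<Delta> ?D" using prems(17) by simp
    then have "reach L U \<Delta> \<Gamma> D' (hexagon L)" using that(5) prems(18) by linarith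
    moreover have "reach L U \<Delta> \<Gamma> ?D D'" using that(1,3) prems(18) unfolding grows_def by blast
    ultimately show ?thesis using reach_trans by blast
  qed
  have sub: "?D \<subseteq> hexagon L" using prems by (intro hexa_subset_hexagon) auto
  show ?case
  proof (cases "h0 = int L \<and> h1 = int L \<and> h2 = int L \<and> h3 = int L \<and> h4 = int L \<and> h5 = int L")
    case True
    then show ?thesis using reach_refl by (simp add: hexagon_eq_hexa)
  next
    case False
    then have "h0 \<noteq> int L \<or> h1 \<noteq> int L \<or> h2 \<noteq> int L \<or> h3 \<noteq> int L \<or> h4 \<noteq> int L \<or> h5 \<noteq> int L" by blast
    from free_long_side[OF prems(1-13) this prems(15)] show ?thesis
    proof cases
      case 1
      show ?thesis
      proof (rule step[OF _ 1(2) _ sub])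
        show "grows L U \<Delta> (nat (h5 + h1 - h0)) ?D (hexa (h0 + 1) h1 h2 h3 h4 h5)"
          using prems(1-16) 1 by (intro grows_0) auto
        show "hexa (h0 + 1) h1 h2 h3 h4 h5 \<subseteq> hexagon L" using prems(1-16) 1 by (intro hexa_subset_hexagon) auto
        show "reach L U \<Delta> \<Gamma> (hexa (h0 + 1) h1 h2 h3 h4 h5) (hexagon L)"
          if "energy L U \<Delta> (hexa (h0 + 1) h1 h2 h3 h4 h5) + (3 * \<Delta> - 2 * U) < \<Gamma>"
          by (rule IH[OF that]) (use prems(14,16) 1 in \<open>simp_all add: convex_hexa_def\<close>)
      qed
    next
      case 2
      show ?thesis
      proof (rule step[OF _ 2(2) _ sub])
        show "grows L U \<Delta> (nat (h0 + h2 - h1)) ?D (hexa h0 (h1 + 1) h2 h3 h4 h5)"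
          using prems(1-16) 2 by (intro grows_1) auto
        show "hexa h0 (h1 + 1) h2 h3 h4 h5 \<subseteq> hexagon L" using prems(1-16) 2 by (intro hexa_subset_hexagon) auto
        show "reach L U \<Delta> \<Gamma> (hexa h0 (h1 + 1) h2 h3 h4 h5) (hexagon L)"
          if "energy L U \<Delta> (hexa h0 (h1 + 1) h2 h3 h4 h5) + (3 * \<Delta> - 2 * U) < \<Gamma>"
          by (rule IH[OF that]) (use prems(14,16) 2 in \<open>simp_all add: convex_hexa_def\<close>)
      qed
    next
      case 3
      show ?thesis
      proof (rule step[OF _ 3(2) _ sub])
        show "grows L U \<Delta> (nat (h1 + h3 - h2)) ?D (hexa h0 h1 (h2 + 1) h3 h4 h5)"
          using prems(1-16) 3 by (intro grows_2) auto
        show "hexa h0 h1 (h2 + 1) h3 h4 h5 \<subseteq> hexagon L" using prems(1-16) 3 by (intro hexa_subset_hexagon) auto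
        show "reach L U \<Delta> \<Gamma> (hexa h0 h1 (h2 + 1) h3 h4 h5) (hexagon L)"
          if "energy L U \<Delta> (hexa h0 h1 (h2 + 1) h3 h4 h5) + (3 * \<Delta> - 2 * U) < \<Gamma>"
          by (rule IH[OF that]) (use prems(14,16) 3 in \<open>simp_all add: convex_hexa_def\<close>)
      qed
    next
      case 4
      show ?thesis
      proof (rule step[OF _ 4(2) _ sub])
        show "grows L U \<Delta> (nat (h2 + h4 - h3)) ?D (hexa h0 h1 h2 (h3 + 1) h4 h5)"
          using prems(1-16) 4 by (intro grows_3) auto
        show "hexa h0 h1 h2 (h3 + 1) h4 h5 \<subseteq> hexagon L" using prems(1-16) 4 by (intro hexa_subset_hexagon) auto
        show "reach L U \<Delta> \<Gamma> (hexa h0 h1 h2 (h3 + 1) h4 h5) (hexagon L)"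
          if "energy L U \<Delta> (hexa h0 h1 h2 (h3 + 1) h4 h5) + (3 * \<Delta> - 2 * U) < \<Gamma>"
          by (rule IH[OF that]) (use prems(14,16) 4 in \<open>simp_all add: convex_hexa_def\<close>)
      qed
    next
      case 5
      show ?thesis
      proof (rule step[OF _ 5(2) _ sub])
        show "grows L U \<Delta> (nat (h3 + h5 - h4)) ?D (hexa h0 h1 h2 h3 (h4 + 1) h5)"
          using prems(1-16) 5 by (intro grows_4) auto
        show "hexa h0 h1 h2 h3 (h4 + 1) h5 \<subseteq> hexagon L" using prems(1-16) 5 by (intro hexa_subset_hexagon) auto
        show "reach L U \<Delta> \<Gamma> (hexa h0 h1 h2 h3 (h4 + 1) h5) (hexagon L)"
          if "energy L U \<Delta> (hexa h0 h1 h2 h3 (h4 + 1) h5) + (3 * \<Delta> - 2 * U) < \<Gamma>"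
          by (rule IH[OF that]) (use prems(14,16) 5 in \<open>simp_all add: convex_hexa_def\<close>)
      qed
    next
      case 6
      show ?thesis
      proof (rule step[OF _ 6(2) _ sub])
        show "grows L U \<Delta> (nat (h4 + h0 - h5)) ?D (hexa h0 h1 h2 h3 h4 (h5 + 1))"
          using prems(1-16) 6 by (intro grows_5) auto
        show "hexa h0 h1 h2 h3 h4 (h5 + 1) \<subseteq> hexagon L" using prems(1-16) 6 by (intro hexa_subset_hexagon) auto
        show "reach L U \<Delta> \<Gamma> (hexa h0 h1 h2 h3 h4 (h5 + 1)) (hexagon L)"
          if "energy L U \<Delta> (hexa h0 h1 h2 h3 h4 (h5 + 1)) + (3 * \<Delta> - 2 * U) < \<Gamma>"
          by (rule IH[OF that]) (use prems(14,16) 6 in \<open>simp_all add: convex_hexa_def\<close>)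
      qed
    qed
  qed
qed

end

section \<open>Shapes up to rotations and translations\<close>

fun shift_site :: "int \<Rightarrow> int \<Rightarrow> site \<Rightarrow> site" where
  "shift_site p q (Up a b) = Up (a + p) (b + q)"
| "shift_site p q (Dn a b) = Dn (a + p) (b + q)"

lemma verts_shift_site: "verts (shift_site p q x) = (\<lambda>v. v + (p, q)) ` verts x"
  by (cases x) auto

lemma shift_qhexa: "shift_site p q ` qhexa i r 0 0 = qhexa i r p q"
proof -
  have "shift_site p q x \<in> qhexa i r p q \<longleftrightarrow> x \<in> qhexa i r 0 0" for x
    by (cases x) (auto simp: qhexa_def in_hexa)
  then have "shift_site p q -` qhexa i r p q = qhexa i r 0 0" by auto
  moreover have "surj (shift_site p q)"
  proof (rule surjI)
    fix x show "shift_site p q (shift_site (- p) (- q) x) = x" by (cases x) auto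
  qed
  ultimately show ?thesis using surj_image_vimage_eq by metis
qed

lemma inj_verts: "inj verts"
proof (rule injI)
  fix x y assume eq: "verts x = verts y"
  \<comment> \<open>The coordinate sums over the three vertices are 1 modulo 3 for an upward face
    and 2 for a downward one, so they determine both orientation and position.\<close>
  have sums: "sum fst (verts z) = 3 * coordA z + (if is_Dn z then 2 else 1)"
    "sum snd (verts z) = 3 * coordB z + (if is_Dn z then 2 else 1)" for z
    by (cases z; simp)+
  have "3 * coordA x + (if is_Dn x then 2 else 1) = 3 * coordA y + (if is_Dn y then 2 else 1)"
    "3 * coordB x + (if is_Dn x then 2 else 1) = 3 * coordB y + (if is_Dn y then 2 else 1)"
    by (simp_all only: sums[symmetric] eq)
  then have "coordA x = coordA y" "coordB x = coordB y" "is_Dn x = is_Dn y"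
    by (auto split: if_splits) presburger+
  then show "x = y" by (cases x; cases y; simp)
qed

lemma rot_ccw_pow_add: "(rot_ccw ^^ k) (x + y) = (rot_ccw ^^ k) x + (rot_ccw ^^ k) y"
proof (induction k)
  case (Suc k)
  have "rot_ccw (u + v) = rot_ccw u + rot_ccw v" for u v
    by (cases u; cases v) (simp add: rot_ccw_def)
  then show ?case using Suc by simp
qed simp

lemma surj_rot_ccw_pow: "surj (rot_ccw ^^ k)"
proof (rule surj_fn)
  show "surj rot_ccw"
  proof (rule surjI)
    fix v show "rot_ccw (rot_cw v) = v" by (cases v) (simp add: rot_ccw_def rot_cw_def)
  qed
qed

lemma verts_rotate_site_pow: "verts ((rotate_site ^^ k) x) = (rot_ccw ^^ k) ` verts x"
  by (induction k) (simp_all add: verts_rotate_site image_comp)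

lemma same_shape_obtain:
  assumes "same_shape Q T"
  obtains k p q where "Q = (rotate_site ^^ k) ` shift_site p q ` T"
proof -
  obtain k v where kv: "verts ` Q = (\<lambda>V. (\<lambda>p. (rot_ccw ^^ k) p + v) ` V) ` verts ` T"
    using assms by (auto simp: same_shape_def)
  \<comment> \<open>The translation is moved to the right of the rotation: there
    \<open>qhexa\<close> absorbs it, while the rotation about the origin is a symmetry of the
    dynamics.\<close>
  obtain w where w: "v = (rot_ccw ^^ k) w" using surj_rot_ccw_pow by (metis surjD)
  obtain p q where pq: "w = (p, q)" by (cases w)
  have "verts ((rotate_site ^^ k) (shift_site p q x)) = (\<lambda>p. (rot_ccw ^^ k) p + v) ` verts x" for x
    by (simp add: verts_rotate_site_pow verts_shift_site image_comp o_def w pq rot_ccw_pow_add)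
  then have "verts ` Q = verts ` (rotate_site ^^ k) ` shift_site p q ` T"
    unfolding kv image_image by simp
  then have "Q = (rotate_site ^^ k) ` shift_site p q ` T"
    using inj_verts by (simp add: inj_image_eq_iff)
  then show ?thesis using that by blast
qed

text \<open>In each of the five directions of the sides that receive bars, the coordinates along
  \<open>d\<close> and \<open>rot_ccw d\<close> are integral linear functions of the vertex, so the
  triangle is cut out by three linear inequalities.\<close>

lemma triangle_eq_faces_in:
  "triangle (c1, c2) (1, 0) l = faces_in {(x, y). c1 \<le> x \<and> c2 \<le> y \<and> x + y \<le> c1 + c2 + int l}"
  "triangle (c1, c2) (1, - 1) l = faces_in {(x, y). y \<le> c2 \<and> c1 + c2 \<le> x + y \<and> x \<le> c1 + int l}"
  "triangle (c1, c2) (0, - 1) l = faces_in {(x, y). x + y \<le> c1 + c2 \<and> c1 \<le> x \<and> c2 \<le> y + int l}"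
  "triangle (c1, c2) (- 1, 0) l = faces_in {(x, y). x \<le> c1 \<and> y \<le> c2 \<and> c1 + c2 \<le> x + y + int l}"
  "triangle (c1, c2) (- 1, 1) l = faces_in {(x, y). c2 \<le> y \<and> x + y \<le> c1 + c2 \<and> c1 \<le> x + int l}"
proof -
  have *: "triangle (c1, c2) (d1, d2) l = faces_in {(x, y). 0 \<le> u x y \<and> 0 \<le> v x y \<and> u x y + v x y \<le> int l}"
    if that: "\<And>x y i j. x = c1 + i * d1 - j * d2 \<and> y = c2 + i * d2 + j * (d1 + d2) \<longleftrightarrow> i = u x y \<and> j = v x y"
    for d1 d2 u v
    unfolding triangle_def
  proof (rule arg_cong[where f = faces_in], intro subset_antisym subsetI; clarify)
    fix i j :: nat and x y
    assume ij: "i + j \<le> l" "(x, y) = (c1, c2) + vscale (int i) (d1, d2) + vscale (int j) (rot_ccw (d1, d2))"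
    then have "x = c1 + int i * d1 - int j * d2" "y = c2 + int i * d2 + int j * (d1 + d2)"
      by (auto simp: vscale_def rot_ccw_def)
    then have "int i = u x y" "int j = v x y" using that[of x "int i" "int j" y] by auto
    then show "0 \<le> u x y \<and> 0 \<le> v x y \<and> u x y + v x y \<le> int l" using ij(1) by auto
  next
    fix x y
    assume uv: "0 \<le> u x y" "0 \<le> v x y" "u x y + v x y \<le> int l"
    then have "(x, y) = (c1, c2) + vscale (int (nat (u x y))) (d1, d2) + vscale (int (nat (v x y))) (rot_ccw (d1, d2))"
      using that[of x "u x y" "v x y" y] by (simp add: vscale_def rot_ccw_def)
    moreover have "nat (u x y) + nat (v x y) \<le> l" using uv by linarith
    ultimately show "\<exists>i j. (x, y) = (c1, c2) + vscale (int i) (d1, d2) + vscale (int j) (rot_ccw (d1, d2)) \<and> i + j \<le> l"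
      by blast
  qed
  show "triangle (c1, c2) (1, 0) l = faces_in {(x, y). c1 \<le> x \<and> c2 \<le> y \<and> x + y \<le> c1 + c2 + int l}"
    by (subst *[of 1 0 "\<lambda>x y. x - c1" "\<lambda>x y. y - c2"]) (auto intro!: arg_cong[where f = faces_in])
  show "triangle (c1, c2) (1, - 1) l = faces_in {(x, y). y \<le> c2 \<and> c1 + c2 \<le> x + y \<and> x \<le> c1 + int l}"
    by (subst *[of 1 "- 1" "\<lambda>x y. c2 - y" "\<lambda>x y. x + y - c1 - c2"]) (auto intro!: arg_cong[where f = faces_in])
  show "triangle (c1, c2) (0, - 1) l = faces_in {(x, y). x + y \<le> c1 + c2 \<and> c1 \<le> x \<and> c2 \<le> y + int l}"
    by (subst *[of 0 "- 1" "\<lambda>x y. c1 + c2 - x - y" "\<lambda>x y. x - c1"]) (auto intro!: arg_cong[where f = faces_in])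
  show "triangle (c1, c2) (- 1, 0) l = faces_in {(x, y). x \<le> c1 \<and> y \<le> c2 \<and> c1 + c2 \<le> x + y + int l}"
    by (subst *[of "- 1" 0 "\<lambda>x y. c1 - x" "\<lambda>x y. c2 - y"]) (auto intro!: arg_cong[where f = faces_in])
  show "triangle (c1, c2) (- 1, 1) l = faces_in {(x, y). c2 \<le> y \<and> x + y \<le> c1 + c2 \<and> c1 \<le> x + int l}"
    by (subst *[of "- 1" 1 "\<lambda>x y. y - c2" "\<lambda>x y. c1 + c2 - x - y"]) (auto intro!: arg_cong[where f = faces_in])
qed

lemma less_5_cases:
  assumes "i < (5::nat)"
  obtains "i = 0" | "i = 1" | "i = 2" | "i = 3" | "i = 4"
  using assms by linarith

lemma qhexa_Suc_bar:
  assumes "r \<ge> 1" "i < 5"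
  shows "qhexa (Suc i) r 0 0 = qhexa i r 0 0 \<union>
     (let c = (rot_cw ^^ i) (- int r, int r); d = (rot_cw ^^ i) (1, 0)
      in if i = 0 then bar c d r else bar (c - d) d (if i < 5 then r + 1 else r + 2))"
proof -
  have faces: "Up a b \<in> faces_in V \<longleftrightarrow> (a, b) \<in> V \<and> (a + 1, b) \<in> V \<and> (a, b + 1) \<in> V"
    "Dn a b \<in> faces_in V \<longleftrightarrow> (a + 1, b) \<in> V \<and> (a + 1, b + 1) \<in> V \<and> (a, b + 1) \<in> V" for a b V
    by (auto simp: faces_in_def)
  have r: "int (r - Suc 0) = int r - 1" using assms(1) by simp
  have rot: "rot_cw (a, b) = (a + b, - a)" "rot_ccw (a, b) = (- b, a + b)" for a b
    by (simp_all add: rot_cw_def rot_ccw_def)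
  note simps = bar_def rot faces triangle_eq_faces_in qhexa_def in_hexa Let_def r
  from assms(2) show ?thesis
  proof (cases rule: less_5_cases)
    case 1
    show ?thesis
    proof (rule set_eqI)
      fix x show "(x \<in> qhexa (Suc i) r 0 0) = (x \<in> qhexa i r 0 0 \<union>
     (let c = (rot_cw ^^ i) (- int r, int r); d = (rot_cw ^^ i) (1, 0)
      in if i = 0 then bar c d r else bar (c - d) d (if i < 5 then r + 1 else r + 2)))"
        using 1 assms(1) by (cases x) (auto simp: simps)
    qed
  next
    case 2
    show ?thesis
    proof (rule set_eqI)
      fix x show "(x \<in> qhexa (Suc i) r 0 0) = (x \<in> qhexa i r 0 0 \<union>
     (let c = (rot_cw ^^ i) (- int r, int r); d = (rot_cw ^^ i) (1, 0)
      in if i = 0 then bar c d r else bar (c - d) d (if i < 5 then r + 1 else r + 2)))"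
        using 2 assms(1) by (cases x) (auto simp: simps)
    qed
  next
    case 3
    show ?thesis
    proof (rule set_eqI)
      fix x show "(x \<in> qhexa (Suc i) r 0 0) = (x \<in> qhexa i r 0 0 \<union>
     (let c = (rot_cw ^^ i) (- int r, int r); d = (rot_cw ^^ i) (1, 0)
      in if i = 0 then bar c d r else bar (c - d) d (if i < 5 then r + 1 else r + 2)))"
        using 3 assms(1) by (cases x) (auto simp: simps numeral_2_eq_2)
    qed
  next
    case 4
    show ?thesis
    proof (rule set_eqI)
      fix x show "(x \<in> qhexa (Suc i) r 0 0) = (x \<in> qhexa i r 0 0 \<union>
     (let c = (rot_cw ^^ i) (- int r, int r); d = (rot_cw ^^ i) (1, 0)
      in if i = 0 then bar c d r else bar (c - d) d (if i < 5 then r + 1 else r + 2)))"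
        using 4 assms(1) by (cases x) (auto simp: simps numeral_3_eq_3)
    qed
  next
    case 5
    show ?thesis
    proof (rule set_eqI)
      fix x show "(x \<in> qhexa (Suc i) r 0 0) = (x \<in> qhexa i r 0 0 \<union>
     (let c = (rot_cw ^^ i) (- int r, int r); d = (rot_cw ^^ i) (1, 0)
      in if i = 0 then bar c d r else bar (c - d) d (if i < 5 then r + 1 else r + 2)))"
        using 5 assms(1) by (cases x) (auto simp: simps eval_nat_numeral)
    qed
  qed
qed

lemma quasi_hexagon_eq_qhexa:
  assumes "r \<ge> 1" "i \<le> 5"
  shows "quasi_hexagon i r = qhexa i r 0 0"
  using assms(2)
proof (induction i)
  case 0
  show ?case by (simp add: hexagon_eq_hexa qhexa_def)
next
  case (Suc i)
  then show ?case using qhexa_Suc_bar[of r i] assms(1) by simp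
qed

text \<open>Three upward faces in alternate corners touch all six sides, two each. The last three
  assumptions make the sides 1, 3 and 5 nonempty, so that these faces belong to the droplet.\<close>

lemma hexa_subset_hexagonD:
  assumes "hexa h0 h1 h2 h3 h4 h5 \<subseteq> hexagon L" "convex_hexa h0 h1 h2 h3 h4 h5"
    "h1 < h0 + h2" "h3 < h2 + h4" "h5 < h4 + h0"
  shows "h0 \<le> int L" "h1 \<le> int L" "h2 \<le> int L" "h3 \<le> int L" "h4 \<le> int L" "h5 \<le> int L"
proof -
  have "Up (h0 - 1) (h1 - h0) \<in> hexa h0 h1 h2 h3 h4 h5" "Up (- h3) (h2 - 1) \<in> hexa h0 h1 h2 h3 h4 h5"
    "Up (h5 - h4) (- h5) \<in> hexa h0 h1 h2 h3 h4 h5"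
    using assms(2-5) by (simp_all add: in_hexa convex_hexa_def)
  then have "Up (h0 - 1) (h1 - h0) \<in> hexagon L" "Up (- h3) (h2 - 1) \<in> hexagon L" "Up (h5 - h4) (- h5) \<in> hexagon L"
    using assms(1) by auto
  then show "h0 \<le> int L" "h1 \<le> int L" "h2 \<le> int L" "h3 \<le> int L" "h4 \<le> int L" "h5 \<le> int L"
    by (simp_all add: Up_in_hexagon)
qed

context parameters begin

text \<open>The regular hexagon of radius \<open>s\<close> with the same centre lies inside, and
  properly so by \<open>1 \<le> i \<or> s < r\<close>.\<close>

lemma reach_qhexa_hexagon:
  assumes sub: "qhexa i r p q \<subseteq> hexagon L" and "i \<le> 5" "1 \<le> s" "s \<le> r" "1 \<le> i \<or> s < r" "s < L"
    and "U < (3 * U - 2 * \<Delta>) * (2 * real s + 1)"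
    and "droplet_energy U \<Delta> i r + (3 * \<Delta> - 2 * U) < \<Gamma>"
  shows "reach L U \<Delta> \<Gamma> (qhexa i r p q) (hexagon L)"
proof -
  have "i < 6" using assms(2) by simp
  then have conv: "convex_hexa (int r + p + of_bool (3 \<le> i)) (int r + p + q + of_bool (2 \<le> i))
     (int r + q + of_bool (1 \<le> i)) (int r - p + of_bool (6 \<le> i))
     (int r - p - q + of_bool (5 \<le> i)) (int r - q + of_bool (4 \<le> i))"
    and long: "int r + p + q + of_bool (2 \<le> i) < int r + p + of_bool (3 \<le> i) + (int r + q + of_bool (1 \<le> i))"
      "int r - p + of_bool (6 \<le> i) < int r + q + of_bool (1 \<le> i) + (int r - p - q + of_bool (5 \<le> i))"
      "int r - q + of_bool (4 \<le> i) < int r - p - q + of_bool (5 \<le> i) + (int r + p + of_bool (3 \<le> i))"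
    and big: "6 * int s < int r + p + of_bool (3 \<le> i) + (int r + p + q + of_bool (2 \<le> i))
     + (int r + q + of_bool (1 \<le> i)) + (int r - p + of_bool (6 \<le> i))
     + (int r - p - q + of_bool (5 \<le> i)) + (int r - q + of_bool (4 \<le> i))"
    using assms(3-5) by (cases rule: less_6_cases; simp add: convex_hexa_def)+
  show ?thesis unfolding qhexa_def
  proof (rule reach_hexagon[where s = "int s" and p = p and q = q])
    note bounds = hexa_subset_hexagonD[OF sub[unfolded qhexa_def] conv long]
    show "int r + p + of_bool (3 \<le> i) \<le> int L" "int r + p + q + of_bool (2 \<le> i) \<le> int L"
      "int r + q + of_bool (1 \<le> i) \<le> int L" "int r - p + of_bool (6 \<le> i) \<le> int L"
      "int r - p - q + of_bool (5 \<le> i) \<le> int L" "int r - q + of_bool (4 \<le> i) \<le> int L"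
      by (rule bounds)+
    show "energy L U \<Delta> (hexa (int r + p + of_bool (3 \<le> i)) (int r + p + q + of_bool (2 \<le> i))
     (int r + q + of_bool (1 \<le> i)) (int r - p + of_bool (6 \<le> i))
     (int r - p - q + of_bool (5 \<le> i)) (int r - q + of_bool (4 \<le> i))) + (3 * \<Delta> - 2 * U) < \<Gamma>"
      using assms(8) energy_qhexa[OF sub _ assms(2), of U \<Delta>] assms(3,4) by (simp add: qhexa_def)
  qed (use assms conv big in simp_all)
qed

text \<open>All sides have length \<open>s\<close>, so one bar of base \<open>s\<close> has to be
  attached before a side of length \<open>s + 1\<close> appears; this step may go uphill. The level
  is therefore compared with the droplets \<open>(s, 0)\<close> and \<open>(s, 1)\<close>.\<close>

lemma reach_qhexa_0_hexagon:
  assumes sub: "qhexa 0 s p q \<subseteq> hexagon L" and s: "1 \<le> s" "s < L"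
    and U: "U < (3 * U - 2 * \<Delta>) * (2 * real s + 1)"
    and low: "droplet_energy U \<Delta> 0 s + (3 * \<Delta> - 2 * U) < \<Gamma>" "droplet_energy U \<Delta> 1 s + (3 * \<Delta> - 2 * U) < \<Gamma>"
  shows "reach L U \<Delta> \<Gamma> (qhexa 0 s p q) (hexagon L)"
proof -
  let ?s = "int s"
  let ?D = "hexa (?s + p) (?s + p + q) (?s + q) (?s - p) (?s - p - q) (?s - q)"
  have D: "qhexa 0 s p q = ?D" by (simp add: qhexa_def)
  have conv: "convex_hexa (?s + p) (?s + p + q) (?s + q) (?s - p) (?s - p - q) (?s - q)"
    using s by (simp add: convex_hexa_def)
  note bounds = hexa_subset_hexagonD[OF sub[unfolded D] conv]
  have ED: "energy L U \<Delta> ?D = droplet_energy U \<Delta> 0 s"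
    using energy_qhexa[OF sub] s by (simp add: D)
  have step: "energy L U \<Delta> D' = droplet_energy U \<Delta> 1 s" "reach L U \<Delta> \<Gamma> ?D D'"
    if "grows L U \<Delta> s ?D D'" "D' \<subseteq> hexagon L" for D'
  proof -
    have c: "real (card D') = card ?D + 2 * real s - 1"
        "real (card (edges D')) = card (edges ?D) + 3 * real s - 2"
      using that(1) unfolding grows_def by linarith+
    have "energy L U \<Delta> D' = energy L U \<Delta> ?D + (U - (3 * U - 2 * \<Delta>) * (2 * real s - 1)) / 2"
      unfolding energy_hexagon[OF that(2)] energy_hexagon[OF sub[unfolded D]] c by (simp add: field_simps)
    then show "energy L U \<Delta> D' = droplet_energy U \<Delta> 1 s"
      unfolding ED by (simp add: droplet_energy_def area_def field_simps)
    show "reach L U \<Delta> \<Gamma> ?D D'"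
      using that low(1) ED unfolding grows_def by simp
  qed
  have conv': "convex_hexa (?s + p + 1) (?s + p + q) (?s + q) (?s - p) (?s - p - q) (?s - q)"
    "convex_hexa (?s + p) (?s + p + q) (?s + q) (?s - p + 1) (?s - p - q) (?s - q)"
    using s by (simp_all add: convex_hexa_def)
  \<comment> \<open>The top side may be at the wall, but two opposite sides cannot both be, since
    \<open>s < L\<close>.\<close>
  consider "?s + p < int L" | "?s - p < int L" using s by linarith
  then show ?thesis
  proof cases
    case 1
    let ?D' = "hexa (?s + p + 1) (?s + p + q) (?s + q) (?s - p) (?s - p - q) (?s - q)"
    have sub': "?D' \<subseteq> hexagon L" using bounds s 1 by (intro hexa_subset_hexagon) simp_all
    have "grows L U \<Delta> s ?D ?D'" using conv s by (intro grows_0) auto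
    note 2 = step[OF this sub']
    have "reach L U \<Delta> \<Gamma> ?D' (hexagon L)"
      by (rule reach_hexagon[where s = ?s and p = p and q = q])
         (use conv' 2(1) low(2) U s bounds 1 in simp_all)
    then show ?thesis using 2(2) reach_trans unfolding D by blast
  next
    case 2
    let ?D' = "hexa (?s + p) (?s + p + q) (?s + q) (?s - p + 1) (?s - p - q) (?s - q)"
    have sub': "?D' \<subseteq> hexagon L" using bounds s 2 by (intro hexa_subset_hexagon) simp_all
    have "grows L U \<Delta> s ?D ?D'" using conv s by (intro grows_3) auto
    note 3 = step[OF this sub']
    have "reach L U \<Delta> \<Gamma> ?D' (hexagon L)"
      by (rule reach_hexagon[where s = ?s and p = p and q = q])
         (use conv' 3(1) low(2) U s bounds 2 in simp_all)
    then show ?thesis using 3(2) reach_trans unfolding D by blast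
  qed
qed

text \<open>
  A new particle enters isolated, so the energy at the moment of crossing is \<open>\<Delta>\<close> above the
  isoperimetric bound for the particles that are already there.
\<close>

lemma crossing_energy:
  assumes adj: "adj L S T" and S: "S \<subseteq> Lam L" and N: "card S \<le> N" "N < card T"
    and Ni: "int N = area i r + 2" and odd: "odd N" "odd P" and P: "P = 6 * int r + int i" "P\<^sup>2 + 3 < 6 * int N"
  shows "droplet_energy U \<Delta> i r + (3 * \<Delta> - 2 * U) \<le> energy L U \<Delta> T"
  using adj
proof cases
  case (swap x y)
  have "finite S" using S finite_subset_Lam by blast
  then have "card T = card S" using swap
    by (metis card.remove card_insert_disjoint finite_Diff Diff_iff)
  then show ?thesis using N by simp
next
  case (exit y)
  then have "card T \<le> card S" using S finite_subset_Lam by (metis Diff_subset card_mono)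
  then show ?thesis using N by simp
next
  case (enter y)
  have fin: "finite S" using S finite_subset_Lam by blast
  then have card: "card S = N" using enter N by simp
  have "card (edges (S \<inter> hexagon L)) \<le> card (edges S)"
    using fin by (intro card_mono finite_edges edges_mono) auto
  moreover have "2 * int (card (edges S)) \<le> 3 * int (card S) - P - 2"
    using card_edges_upper_bound[OF fin, of P] odd P by (simp add: card)
  ultimately have "real_of_int (2 * int (card (edges (S \<inter> hexagon L)))) \<le> real_of_int (3 * (area i r + 2) - P - 2)"
    unfolding Ni[symmetric] card by (intro of_int_le_iff[THEN iffD2]) linarith
  then have "U * real (card (edges (S \<inter> hexagon L))) \<le> U * ((3 * real_of_int (area i r) + 4 - (6 * real r + real i)) / 2)"
    using U_pos by (intro mult_left_mono) (simp_all add: P)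
  moreover have "real (card S) = real_of_int (area i r) + 2"
    using Ni card by (metis of_int_add of_int_numeral of_int_of_nat_eq)
  moreover have "energy L U \<Delta> T = energy L U \<Delta> S + \<Delta>"
    unfolding enter(1) using energy_insert_bd[OF S] enter by simp
  \<comment> \<open>Two more particles and perimeter \<open>P + 2\<close> add
    \<open>U - (3 * U - 2 * \<Delta>) = 2 * \<Delta> - 2 * U\<close> to the energy of the droplet,
    and the entering particle adds \<open>\<Delta>\<close>.\<close>
  ultimately show ?thesis by (simp add: energy_def droplet_energy_def field_simps)
qed

end

section \<open>Initial droplets up to rotation and their order by area\<close>

lemma rotate_pow_Suc: "(rotate_site ^^ Suc k) ` S = rotate_site ` (rotate_site ^^ k) ` S"
  by (simp add: image_image)

lemma reach_rotate_pow:
  "reach L U \<Delta> \<Gamma> S T \<Longrightarrow> reach L U \<Delta> \<Gamma> ((rotate_site ^^ k) ` S) ((rotate_site ^^ k) ` T)"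
  by (induction k) (simp_all add: rotate_pow_Suc reach_rotate del: funpow.simps(2))

lemma rotate_pow_subset_hexagon: "(rotate_site ^^ k) ` S \<subseteq> hexagon L \<longleftrightarrow> S \<subseteq> hexagon L"
  by (induction k) (simp_all add: rotate_pow_Suc rotate_image_subset del: funpow.simps(2))

lemma rotate_pow_hexagon: "(rotate_site ^^ k) ` hexagon L = hexagon L"
  by (induction k) (simp_all add: rotate_pow_Suc hexagon_eq_hexa rotate_hexa del: funpow.simps(2))

lemma card_rotate_pow: "card ((rotate_site ^^ k) ` S) = card S"
  by (induction k) (simp_all add: rotate_pow_Suc card_rotate del: funpow.simps(2))

lemma same_shape_quasi_hexagon_obtain:
  assumes "same_shape Q (quasi_hexagon i r)" "r \<ge> 1" "i \<le> 5"
  obtains k p q where "Q = (rotate_site ^^ k) ` qhexa i r p q" "int (card Q) = area i r"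
proof -
  obtain k p q where "Q = (rotate_site ^^ k) ` shift_site p q ` quasi_hexagon i r"
    using assms(1) by (rule same_shape_obtain)
  then have Q: "Q = (rotate_site ^^ k) ` qhexa i r p q"
    using quasi_hexagon_eq_qhexa[OF assms(2,3)] shift_qhexa by simp
  then have "int (card Q) = area i r" using qhexa_counts[OF assms(2,3)] by (simp add: card_rotate_pow)
  then show ?thesis using that Q by blast
qed

lemma single_quasi_hexagon_obtain:
  assumes "single_quasi_hexagon L \<eta>"
  obtains k i r p q Q where "i \<le> 5" "r \<ge> 1" "Q = (rotate_site ^^ k) ` qhexa i r p q"
    "int (card Q) = area i r" "{x \<in> Lam L. \<eta> x = 1} = Q" "\<eta> = conf L Q" "Q \<subseteq> hexagon L"
    "qhexa i r p q \<subseteq> hexagon L"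
proof -
  obtain Q where Q: "\<eta> \<in> configs L" "quasi_regular Q" "Q \<subseteq> hexagon L" "{x \<in> Lam L. \<eta> x = 1} = Q"
    using assms by (auto simp: single_quasi_hexagon_def Lam_minus_eq_hexagon)
  then obtain i r where ir: "i \<le> 5" "r \<ge> 1" "same_shape Q (quasi_hexagon i r)"
    by (auto simp: quasi_regular_def)
  obtain k p q where k: "Q = (rotate_site ^^ k) ` qhexa i r p q" "int (card Q) = area i r"
    by (rule same_shape_quasi_hexagon_obtain[OF ir(3,2,1)])
  have "qhexa i r p q \<subseteq> hexagon L" using Q(3) k(1) rotate_pow_subset_hexagon by blast
  moreover have "\<eta> = conf L Q" using conf_occupied[OF Q(1)] Q(4) by simp
  ultimately show ?thesis using that ir k Q by blast
qed

text \<open>Containment is passed on only as an inequality of areas, which already locates the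
  droplet in the sequence of quasi-regular hexagons.\<close>

lemma E_minus_obtain:
  assumes "\<eta> \<in> E_minus L j s" "s \<ge> 1" "j \<le> 5"
  obtains k i r p q where "i \<le> 5" "r \<ge> 1" "\<eta> = conf L ((rotate_site ^^ k) ` qhexa i r p q)"
    "qhexa i r p q \<subseteq> hexagon L" "area i r \<le> area j s"
proof -
  obtain S where S: "single_quasi_hexagon L \<eta>" "same_shape S (quasi_hexagon j s)" "{x \<in> Lam L. \<eta> x = 1} \<subseteq> S"
    using assms(1) by (auto simp: E_minus_def)
  obtain k i r p q Q where Q: "i \<le> 5" "r \<ge> 1" "Q = (rotate_site ^^ k) ` qhexa i r p q"
    "int (card Q) = area i r" "{x \<in> Lam L. \<eta> x = 1} = Q" "\<eta> = conf L Q" "Q \<subseteq> hexagon L"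
    "qhexa i r p q \<subseteq> hexagon L"
    using S(1) by (rule single_quasi_hexagon_obtain)
  obtain k' p' q' where S': "S = (rotate_site ^^ k') ` qhexa j s p' q'" "int (card S) = area j s"
    by (rule same_shape_quasi_hexagon_obtain[OF S(2) assms(2,3)])
  have "card Q \<le> card S" using S(3) Q(5) S'(1) by (intro card_mono) (auto simp: finite_qhexa)
  then show ?thesis using that[OF Q(1,2) _ Q(8)] Q S' by simp
qed

lemma E_plus_obtain:
  assumes "\<eta> \<in> E_plus L j s" "s \<ge> 1" "j \<le> 5"
  obtains k i r p q where "i \<le> 5" "r \<ge> 1" "\<eta> = conf L ((rotate_site ^^ k) ` qhexa i r p q)"
    "qhexa i r p q \<subseteq> hexagon L" "area j s \<le> area i r"
proof -
  obtain S where S: "single_quasi_hexagon L \<eta>" "same_shape S (quasi_hexagon j s)" "S \<subseteq> {x \<in> Lam L. \<eta> x = 1}"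
    using assms(1) by (auto simp: E_plus_def)
  obtain k i r p q Q where Q: "i \<le> 5" "r \<ge> 1" "Q = (rotate_site ^^ k) ` qhexa i r p q"
    "int (card Q) = area i r" "{x \<in> Lam L. \<eta> x = 1} = Q" "\<eta> = conf L Q" "Q \<subseteq> hexagon L"
    "qhexa i r p q \<subseteq> hexagon L"
    using S(1) by (rule single_quasi_hexagon_obtain)
  obtain k' p' q' where S': "S = (rotate_site ^^ k') ` qhexa j s p' q'" "int (card S) = area j s"
    by (rule same_shape_quasi_hexagon_obtain[OF S(2) assms(2,3)])
  have "card S \<le> card Q" using S(3) Q(5,7) by (intro card_mono) (auto intro: finite_subset_hexagon)
  then show ?thesis using that[OF Q(1,2) _ Q(8)] Q S' by simp
qed

text \<open>The area increases along the sequence of attached bars: the largest value for radius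
  \<open>r\<close> is \<open>6 * r\<^sup>2 + 10 * r + 3\<close>, below the area
  \<open>6 * (r + 1)\<^sup>2\<close> of the next regular hexagon.\<close>

lemma area_less_iff:
  assumes "i \<le> 5" "j \<le> 5" "r \<ge> 1"
  shows "area i r < area j s \<longleftrightarrow> r < s \<or> r = s \<and> i < j"
proof -
  have less: "area i r < area j s" if "i \<le> 5" "j \<le> 5" "r < s" for i j r s
  proof -
    have "0 \<le> int s" by simp
    have "int i * int r \<le> 5 * int r" using that by (intro mult_right_mono) auto
    then have 1: "area i r \<le> 6 * (int r)\<^sup>2 + 10 * int r + 3" using that by (simp add: area_def)
    have "6 * (int r + 1)\<^sup>2 \<le> 6 * (int s)\<^sup>2" using that by (intro mult_left_mono power_mono) auto
    moreover have "6 * (int s)\<^sup>2 + (if j = 0 then 0 else 2 * int s + int j - 2) \<le> area j s"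
    proof (cases "j = 0")
      case False
      then have "1 * int s \<le> int j * int s" by (intro mult_right_mono) auto
      then show ?thesis by (simp add: area_def)
    qed (simp add: area_def)
    ultimately show ?thesis using 1 that by (cases "j = 0") (simp_all add: power2_eq_square algebra_simps)
  qed
  have same: "area i r < area j r" if "i < j" "r \<ge> 1" for i j r
  proof -
    have "(int i + 1) * int r \<le> int j * int r" using that by (intro mult_right_mono) auto
    then have "int i * int r + int r \<le> int j * int r" by (simp only: distrib_right mult_1)
    moreover have "area j r = 6 * (int r)\<^sup>2 + 2 * (int j * int r) + int j - 2"
      "area i r \<le> 6 * (int r)\<^sup>2 + 2 * (int i * int r) + int i"
      "i \<noteq> 0 \<Longrightarrow> area i r = 6 * (int r)\<^sup>2 + 2 * (int i * int r) + int i - 2"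
      using that by (simp_all add: area_def)
    ultimately show ?thesis using that by (cases "i = 0") linarith+
  qed
  have "r < s \<or> r = s \<and> i < j \<or> s < r \<or> r = s \<and> j < i \<or> r = s \<and> i = j" by linarith
  then show ?thesis
    using less[OF assms(1,2), of r s] less[OF assms(2,1), of s r] same[of i j r] same[of j i r] assms(3) by auto
qed

section \<open>The critical droplet\<close>

text \<open>The energy of \<open>E\<^bsub>B\<^sub>i\<^esub>(r\<^sup>* + d)\<close> up to the factor \<open>\<epsilon> / 2\<close> and an additive constant.\<close>

definition energy_profile :: "real \<Rightarrow> real \<Rightarrow> real \<Rightarrow> real" where
  "energy_profile \<delta> d i = (1 + 2 * \<delta>) * (6 * d + i) - 6 * d\<^sup>2 - 2 * d * i - (if i = 0 then 0 else i - 2)"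

lemma droplet_energy_eq:
  assumes "U = \<epsilon> * (2 * R + 1 + 2 * \<delta>)" "\<epsilon> = 3 * U - 2 * \<Delta>"
  shows "droplet_energy U \<Delta> i r =
    \<epsilon> / 2 * (6 * R\<^sup>2 + (6 + 12 * \<delta>) * R + energy_profile \<delta> (real r - R) (real i))"
proof -
  have "U * (6 * real r + real i) - \<epsilon> * area i r = \<epsilon> * (6 * R\<^sup>2 + (6 + 12 * \<delta>) * R + energy_profile \<delta> (real r - R) (real i))"
    unfolding assms(1) by (simp add: area_def energy_profile_def power2_eq_square algebra_simps)
  then show ?thesis by (simp add: droplet_energy_def assms(2)[symmetric])
qed

text \<open>The values \<open>2 + 10 * \<delta>\<close> and \<open>14 * \<delta>\<close> are those
  of the profile at \<open>(0, 5)\<close> and \<open>(1, 1)\<close>; they coincide for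
  \<open>\<delta> = 1 / 2\<close>.\<close>

lemma energy_profile_less:
  fixes d :: int and i :: nat
  assumes "i \<le> 5" "0 < \<delta>" "\<delta> < 1"
  shows "\<delta> < 1 / 2 \<Longrightarrow> \<not> (d = 0 \<and> i = 5) \<Longrightarrow> energy_profile \<delta> d i < 2 + 10 * \<delta>"
    and "1 / 2 < \<delta> \<Longrightarrow> \<not> (d = 1 \<and> i = 1) \<Longrightarrow> energy_profile \<delta> d i < 14 * \<delta>"
proof -
  have "i < 6" using assms(1) by simp
  then have i: "i = 0 \<or> i = 1 \<or> i = 2 \<or> i = 3 \<or> i = 4 \<or> i = 5" by (auto elim: less_6_cases)
  consider "d \<le> - 1" | "d = 0" | "d = 1" | "d \<ge> 2" by linarith
  then have "(\<delta> < 1 / 2 \<longrightarrow> \<not> (d = 0 \<and> i = 5) \<longrightarrow> energy_profile \<delta> d i < 2 + 10 * \<delta>) \<and>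
    (1 / 2 < \<delta> \<longrightarrow> \<not> (d = 1 \<and> i = 1) \<longrightarrow> energy_profile \<delta> d i < 14 * \<delta>)"
  proof cases
    case 1
    define e where "e = - 1 - real_of_int d"
    have e: "0 \<le> e" "real_of_int d = - 1 - e" using 1 by (auto simp: e_def)
    \<comment> \<open>For fixed \<open>i\<close> the claim is linear in \<open>e\<close>,
      \<open>x\<close>, \<open>y\<close> and \<open>\<delta>\<close>, with only their signs
      needed.\<close>
    define x y where xy: "x = e * e" "y = e * \<delta>"
    then have pos: "0 \<le> x" "0 \<le> y" using e assms by simp_all
    have "energy_profile \<delta> d i = - 12 - 18 * e + 3 * real i - 12 * \<delta> - 12 * y + 2 * \<delta> * real i - 6 * x
        + 2 * e * real i - (if i = 0 then 0 else real i - 2)"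
      unfolding e(2) by (simp add: energy_profile_def power2_eq_square algebra_simps xy)
    then show ?thesis using i e(1) pos assms by auto
  next
    case 2
    then show ?thesis using i assms by (auto simp: energy_profile_def)
  next
    case 3
    then show ?thesis using i assms by (auto simp: energy_profile_def)
  next
    case 4
    define e where "e = real_of_int d - 2"
    have e: "0 \<le> e" "real_of_int d = e + 2" using 4 by (auto simp: e_def)
    define x y where xy: "x = e * e" "y = e * \<delta>"
    then have pos: "0 \<le> x" "0 \<le> y" "y \<le> e" using e assms mult_left_mono[of \<delta> 1 e] by simp_all
    have "energy_profile \<delta> d i = - 12 - 18 * e - 3 * real i + 24 * \<delta> + 12 * y + 2 * \<delta> * real i - 6 * x
        - 2 * e * real i - (if i = 0 then 0 else real i - 2)"
      unfolding e(2) by (simp add: energy_profile_def power2_eq_square algebra_simps xy)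
    then show ?thesis using i e(1) pos assms by auto
  qed
  then show "\<delta> < 1 / 2 \<Longrightarrow> \<not> (d = 0 \<and> i = 5) \<Longrightarrow> energy_profile \<delta> d i < 2 + 10 * \<delta>"
    and "1 / 2 < \<delta> \<Longrightarrow> \<not> (d = 1 \<and> i = 1) \<Longrightarrow> energy_profile \<delta> d i < 14 * \<delta>" by blast+
qed


text \<open>One cut serves both directions: at most \<open>N\<close> particles against more than
  \<open>N\<close>. The rotation in the initial configuration is harmless because it fixes both the
  empty and the full droplet.\<close>

lemma (in parameters) kawasaki_tendsto:
  assumes L: "L \<ge> 1" and N: "int N = area i\<^sub>0 r\<^sub>0 + 2" "N < card (hexagon L)"
    and odd: "odd N" "odd P" and P: "P = 6 * int r\<^sub>0 + int i\<^sub>0" "P\<^sup>2 + 3 < 6 * int N"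
    and \<Gamma>: "\<Gamma> = droplet_energy U \<Delta> i\<^sub>0 r\<^sub>0 + (3 * \<Delta> - 2 * U)"
    and D: "D \<subseteq> hexagon L"
  shows "reach L U \<Delta> \<Gamma> {} D \<Longrightarrow>
      ((\<lambda>\<beta>. \<P>(\<omega> in kawasaki L U \<Delta> \<beta> (conf L ((rotate_site ^^ k) ` D)).
        hitting_time (empty_config L) \<omega> < hitting_time (full_config L) \<omega>)) \<longlongrightarrow> 1) at_top"
    and "reach L U \<Delta> \<Gamma> D (hexagon L) \<Longrightarrow>
      ((\<lambda>\<beta>. \<P>(\<omega> in kawasaki L U \<Delta> \<beta> (conf L ((rotate_site ^^ k) ` D)).
        hitting_time (full_config L) \<omega> < hitting_time (empty_config L) \<omega>)) \<longlongrightarrow> 1) at_top"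
proof -
  have sub: "(rotate_site ^^ k) ` D \<subseteq> Lam L"
    using D rotate_pow_subset_hexagon hexagon_subset_Lam by (metis order_trans)
  have cross: "\<Gamma> \<le> energy L U \<Delta> T"
    if "adj L S T" "S \<subseteq> Lam L" "card S \<le> N" "N < card T" for S T
    unfolding \<Gamma> using crossing_energy[OF that N(1) odd P] .
  show "((\<lambda>\<beta>. \<P>(\<omega> in kawasaki L U \<Delta> \<beta> (conf L ((rotate_site ^^ k) ` D)).
        hitting_time (empty_config L) \<omega> < hitting_time (full_config L) \<omega>)) \<longlongrightarrow> 1) at_top"
    if "reach L U \<Delta> \<Gamma> {} D"
    unfolding empty_config_eq full_config_eq
  proof (rule kawasaki_tendsto_1[OF L _ sub, where \<A> = "{S. card S \<le> N}"])
    show "reach L U \<Delta> \<Gamma> ((rotate_site ^^ k) ` D) {}"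
      using reach_rotate_pow[OF that, of k] by (simp add: reach_sym)
    show "\<Gamma> \<le> max (energy L U \<Delta> S) (energy L U \<Delta> T)"
      if "S \<subseteq> Lam L" "adj L S T" "S \<in> {S. card S \<le> N}" "T \<notin> {S. card S \<le> N}" for S T
      using cross[OF that(2,1)] that by auto
  qed (use N hexagon_subset_Lam in auto)
  show "((\<lambda>\<beta>. \<P>(\<omega> in kawasaki L U \<Delta> \<beta> (conf L ((rotate_site ^^ k) ` D)).
        hitting_time (full_config L) \<omega> < hitting_time (empty_config L) \<omega>)) \<longlongrightarrow> 1) at_top"
    if "reach L U \<Delta> \<Gamma> D (hexagon L)"
    unfolding empty_config_eq full_config_eq
  proof (rule kawasaki_tendsto_1[OF L _ sub, where \<A> = "{S. N < card S}"])
    show "reach L U \<Delta> \<Gamma> ((rotate_site ^^ k) ` D) (hexagon L)"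
      using reach_rotate_pow[OF that, of k] by (simp add: rotate_pow_hexagon)
    show "\<Gamma> \<le> max (energy L U \<Delta> S) (energy L U \<Delta> T)"
      if "T \<subseteq> Lam L" "adj L S T" "S \<in> {S. N < card S}" "T \<notin> {S. N < card S}" for S T
      using cross[OF adj_sym[OF that(2)] that(1)] that by auto
  qed (use N hexagon_subset_Lam in auto)
qed

theorem theorem2p7:
  fixes L :: nat and U \<Delta> :: real
  assumes "L \<ge> 1"
    and "U > 0"
    and "U < \<Delta>" and "\<Delta> < 3 / 2 * U"
    and "3 * U - 2 * \<Delta> \<le> U / 100"
    and "crit_param U \<Delta> \<notin> \<int>"
    and "L > 2 * crit_radius U \<Delta> + 3"
  shows "(0 < frac (crit_param U \<Delta>) \<and> frac (crit_param U \<Delta>) < 1 / 2 \<longrightarrow>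
      (\<forall>\<eta> \<in> E_minus L 5 (crit_radius U \<Delta>).
         ((\<lambda>\<beta>. \<P>(\<omega> in kawasaki L U \<Delta> \<beta> \<eta>.
             hitting_time (empty_config L) \<omega> < hitting_time (full_config L) \<omega>)) \<longlongrightarrow> 1) at_top) \<and>
      (\<forall>\<eta> \<in> E_plus L 0 (crit_radius U \<Delta> + 1).
         ((\<lambda>\<beta>. \<P>(\<omega> in kawasaki L U \<Delta> \<beta> \<eta>.
             hitting_time (full_config L) \<omega> < hitting_time (empty_config L) \<omega>)) \<longlongrightarrow> 1) at_top)) \<and>
    (1 / 2 < frac (crit_param U \<Delta>) \<and> frac (crit_param U \<Delta>) < 1 \<longrightarrow>
      (\<forall>\<eta> \<in> E_minus L 1 (crit_radius U \<Delta> + 1).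
         ((\<lambda>\<beta>. \<P>(\<omega> in kawasaki L U \<Delta> \<beta> \<eta>.
             hitting_time (empty_config L) \<omega> < hitting_time (full_config L) \<omega>)) \<longlongrightarrow> 1) at_top) \<and>
      (\<forall>\<eta> \<in> E_plus L 2 (crit_radius U \<Delta> + 1).
         ((\<lambda>\<beta>. \<P>(\<omega> in kawasaki L U \<Delta> \<beta> \<eta>.
             hitting_time (full_config L) \<omega> < hitting_time (empty_config L) \<omega>)) \<longlongrightarrow> 1) at_top))"
proof -
  interpret parameters L U \<Delta> by unfold_locales (use assms in auto)
  define \<epsilon> \<delta> R where "\<epsilon> = 3 * U - 2 * \<Delta>" and "\<delta> = frac (crit_param U \<Delta>)" and "R = crit_radius U \<Delta>"
  have \<epsilon>: "0 < \<epsilon>" "100 * \<epsilon> \<le> U" using assms by (auto simp: \<epsilon>_def)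
  \<comment> \<open>The smallness of \<open>\<epsilon>\<close> makes the critical radius at least
    49.\<close>
  then have "50 \<le> U / (2 * \<epsilon>)" by (simp add: field_simps)
  then have "49 \<le> \<lfloor>crit_param U \<Delta>\<rfloor>" by (simp add: crit_param_def \<epsilon>_def le_floor_iff)
  then have floor: "int R = \<lfloor>crit_param U \<Delta>\<rfloor>" "49 \<le> int R" by (simp_all only: R_def crit_radius_def)
  have "real R = real_of_int \<lfloor>crit_param U \<Delta>\<rfloor>"
    using arg_cong[OF floor(1), of real_of_int] by simp
  then have R: "49 \<le> R" "crit_param U \<Delta> = real R + \<delta>"
    using floor(2) by (simp_all add: \<delta>_def frac_def)
  have "U / (2 * \<epsilon>) = real R + \<delta> + 1 / 2"
    using R(2) unfolding crit_param_def \<epsilon>_def by linarith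
  then have U: "U = \<epsilon> * (2 * real R + 1 + 2 * \<delta>)"
    using \<epsilon> by (simp add: field_simps)
  let ?H = "droplet_energy U \<Delta>" and ?K = "3 * \<Delta> - 2 * U"
  have H: "?H i r = \<epsilon> / 2 * (6 * (real R)\<^sup>2 + (6 + 12 * \<delta>) * real R
      + energy_profile \<delta> (real_of_int (int r - int R)) (real i))" for i r
    using droplet_energy_eq[OF U \<epsilon>_def, of i r] by simp
  have H_less: "?H i r < ?H j s"
    if "energy_profile \<delta> (real_of_int (int r - int R)) (real i) < energy_profile \<delta> (real_of_int (int s - int R)) (real j)"
    for i j r s
    unfolding H using that \<epsilon> by simp
  \<comment> \<open>Nucleating the hexagon of radius 1 needs at most
    \<open>6 * \<Delta> < 9 * U\<close>. In units of \<open>\<epsilon>\<close> this is linear in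
    \<open>R\<close>, whereas the critical energy is quadratic, and \<open>49 \<le> R\<close> leaves
    ample room.\<close>
  have small: "6 * \<Delta> < ?H j s + ?K" if "0 \<le> energy_profile \<delta> (real_of_int (int s - int R)) (real j)" "0 < \<delta>" "\<delta> < 1" for j s
  proof -
    have "6 * \<Delta> < 9 * U" using assms by simp
    also have "9 * U \<le> 9 * (\<epsilon> * (2 * real R + 3))"
      unfolding U using \<epsilon> that by simp
    also have "\<dots> \<le> \<epsilon> / 2 * (6 * (real R)\<^sup>2 + 6 * real R)"
    proof -
      have "49 * real R \<le> (real R)\<^sup>2" using R(1) by (simp add: power2_eq_square)
      then have "9 * (2 * real R + 3) \<le> 3 * (real R)\<^sup>2 + 3 * real R" using R(1) by simp
      then have "\<epsilon> * (9 * (2 * real R + 3)) \<le> \<epsilon> * (3 * (real R)\<^sup>2 + 3 * real R)"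
        using \<epsilon> by (intro mult_left_mono) auto
      then show ?thesis by (simp add: field_simps)
    qed
    also have "\<dots> \<le> ?H j s" unfolding H using \<epsilon> that by (simp add: algebra_simps)
    also have "\<dots> < ?H j s + ?K" using assms by simp
    finally show ?thesis .
  qed
  have L: "R + 2 \<le> L" "R + 1 < L" using assms(7) by (simp_all add: R_def)
  \<comment> \<open>The container must hold more than \<open>N\<close> particles, so that the full
    configuration lies beyond the cut.\<close>
  have "(int R + 2)\<^sup>2 \<le> (int L)\<^sup>2" using L by (intro power_mono) auto
  moreover have "int (card (hexagon L)) = 6 * (int L)\<^sup>2"
    using qhexa_counts[of L 0 0 0] assms(1) by (simp add: qhexa_def hexagon_eq_hexa area_def)
  ultimately have card_L: "6 * (int R + 2)\<^sup>2 \<le> int (card (hexagon L))" by simp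
  \<comment> \<open>Bars of base at least \<open>R + 2\<close> lower the energy; this is the growth
    condition with \<open>s = R + 1\<close>.\<close>
  have U_less: "U < (3 * U - 2 * \<Delta>) * (2 * real (R + 1) + 1)" if "\<delta> < 1"
  proof -
    have "\<epsilon> * (2 * real R + 1 + 2 * \<delta>) < \<epsilon> * (2 * real (R + 1) + 1)"
      using \<epsilon> that by (intro mult_strict_left_mono) auto
    then show ?thesis by (simp only: U[symmetric] \<epsilon>_def[symmetric])
  qed
  have R1: "R \<ge> 1" "R + 1 \<ge> 1" using R by auto
  have case1: "(\<forall>\<eta> \<in> E_minus L 5 R. ((\<lambda>\<beta>. \<P>(\<omega> in kawasaki L U \<Delta> \<beta> \<eta>.
             hitting_time (empty_config L) \<omega> < hitting_time (full_config L) \<omega>)) \<longlongrightarrow> 1) at_top) \<and>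
      (\<forall>\<eta> \<in> E_plus L 0 (R + 1). ((\<lambda>\<beta>. \<P>(\<omega> in kawasaki L U \<Delta> \<beta> \<eta>.
             hitting_time (full_config L) \<omega> < hitting_time (empty_config L) \<omega>)) \<longlongrightarrow> 1) at_top)"
    if \<delta>: "0 < \<delta>" "\<delta> < 1 / 2"
  proof -
    have top: "energy_profile \<delta> (real_of_int (int R - int R)) (real 5) = 2 + 10 * \<delta>"
      by (simp add: energy_profile_def)
    have low: "?H i r + ?K < ?H 5 R + ?K" if "i \<le> 5" "\<not> (r = R \<and> i = 5)" for i r
      using H_less[of r i R 5] energy_profile_less(1)[of i \<delta> "int r - int R"] that \<delta> top by simp
    have "int (nat (area 5 R + 2)) = area 5 R + 2" "odd (area 5 R + 2)"
      by (simp_all add: area_def)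
    then have N: "int (nat (area 5 R + 2)) = area 5 R + 2" "odd (nat (area 5 R + 2))"
      by (simp_all only: even_of_nat[where ?'a = int, symmetric] not_False_eq_True)
    \<comment> \<open>The two sides are \<open>36 * R\<^sup>2 + 60 * R + 28\<close> and
      \<open>36 * R\<^sup>2 + 60 * R + 30\<close>: the loss of 3 in the isoperimetric inequality is
      just affordable.\<close>
    have P: "odd (6 * int R + int 5)" "(6 * int R + int 5)\<^sup>2 + 3 < 6 * int (nat (area 5 R + 2))"
      unfolding N(1) by (simp_all add: area_def power2_eq_square algebra_simps)
    have card: "nat (area 5 R + 2) < card (hexagon L)"
      using card_L unfolding of_nat_less_iff[where ?'a = int, symmetric] N(1)
      by (simp add: area_def power2_eq_square algebra_simps)
    note lim = kawasaki_tendsto[OF assms(1) N(1) card N(2) P(1) refl P(2) refl]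
    have shrink: "((\<lambda>\<beta>. \<P>(\<omega> in kawasaki L U \<Delta> \<beta> \<eta>.
             hitting_time (empty_config L) \<omega> < hitting_time (full_config L) \<omega>)) \<longlongrightarrow> 1) at_top"
      if \<eta>: "\<eta> \<in> E_minus L 5 R" for \<eta>
    proof -
      obtain k i r p q where D: "i \<le> 5" "r \<ge> 1" "\<eta> = conf L ((rotate_site ^^ k) ` qhexa i r p q)"
        "qhexa i r p q \<subseteq> hexagon L" "area i r \<le> area 5 R"
        by (rule E_minus_obtain[OF \<eta> R1(1)]) auto
      have "r \<le> R" using D area_less_iff[of 5 i R r] R1 by auto
      then have "reach L U \<Delta> (?H 5 R + ?K) {} (qhexa i r p q)"
        using D(1,2,4) small[of R 5] low top \<delta> by (intro reach_empty_qhexa) auto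
      from lim(1)[OF D(4) this] show ?thesis by (simp add: D(3))
    qed
    have grow: "((\<lambda>\<beta>. \<P>(\<omega> in kawasaki L U \<Delta> \<beta> \<eta>.
             hitting_time (full_config L) \<omega> < hitting_time (empty_config L) \<omega>)) \<longlongrightarrow> 1) at_top"
      if \<eta>: "\<eta> \<in> E_plus L 0 (R + 1)" for \<eta>
    proof -
      obtain k i r p q where D: "i \<le> 5" "r \<ge> 1" "\<eta> = conf L ((rotate_site ^^ k) ` qhexa i r p q)"
        "qhexa i r p q \<subseteq> hexagon L" "area 0 (R + 1) \<le> area i r"
        by (rule E_plus_obtain[OF \<eta> R1(2)]) auto
      have r: "R + 1 \<le> r" using D area_less_iff[of i 0 r "R + 1"] by auto
      have "reach L U \<Delta> (?H 5 R + ?K) (qhexa i r p q) (hexagon L)"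
      proof (cases "1 \<le> i \<or> R + 1 < r")
        case True
        then show ?thesis using D(1,4) r R1 L U_less low[of i r] \<delta>
          by (intro reach_qhexa_hexagon[where s = "R + 1"]) auto
      next
        \<comment> \<open>The regular hexagon of radius \<open>R + 1\<close> must climb once, to
          \<open>(R + 1, 1)\<close>. This droplet is still lower than the critical one because
          \<open>\<delta> < 1 / 2\<close>.\<close>
        case False
        then have "i = 0" "r = R + 1" using r by auto
        then show ?thesis using D(4) R1 L U_less low[of 0 "R + 1"] low[of 1 "R + 1"] \<delta>
          by (simp only:) (intro reach_qhexa_0_hexagon, auto)
      qed
      from lim(2)[OF D(4) this] show ?thesis by (simp add: D(3))
    qed
    show ?thesis using shrink grow by blast
  qed
  have case3: "(\<forall>\<eta> \<in> E_minus L 1 (R + 1). ((\<lambda>\<beta>. \<P>(\<omega> in kawasaki L U \<Delta> \<beta> \<eta>.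
             hitting_time (empty_config L) \<omega> < hitting_time (full_config L) \<omega>)) \<longlongrightarrow> 1) at_top) \<and>
      (\<forall>\<eta> \<in> E_plus L 2 (R + 1). ((\<lambda>\<beta>. \<P>(\<omega> in kawasaki L U \<Delta> \<beta> \<eta>.
             hitting_time (full_config L) \<omega> < hitting_time (empty_config L) \<omega>)) \<longlongrightarrow> 1) at_top)"
    if \<delta>: "1 / 2 < \<delta>" "\<delta> < 1"
  proof -
    have top: "energy_profile \<delta> (real_of_int (int (R + 1) - int R)) (real 1) = 14 * \<delta>"
      by (simp add: energy_profile_def)
    have low: "?H i r + ?K < ?H 1 (R + 1) + ?K" if "i \<le> 5" "\<not> (r = R + 1 \<and> i = 1)" for i r
      using H_less[of r i "R + 1" 1] energy_profile_less(2)[of i \<delta> "int r - int R"] that \<delta> top by simp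
    have "int (nat (area 1 (R + 1) + 2)) = area 1 (R + 1) + 2" "odd (area 1 (R + 1) + 2)"
      by (simp_all add: area_def)
    then have N: "int (nat (area 1 (R + 1) + 2)) = area 1 (R + 1) + 2" "odd (nat (area 1 (R + 1) + 2))"
      by (simp_all only: even_of_nat[where ?'a = int, symmetric] not_False_eq_True)
    \<comment> \<open>With \<open>r = R + 1\<close> the two sides are
      \<open>36 * r\<^sup>2 + 12 * r + 4\<close> and
      \<open>36 * r\<^sup>2 + 12 * r + 6\<close>.\<close>
    have P: "odd (6 * int (R + 1) + int 1)" "(6 * int (R + 1) + int 1)\<^sup>2 + 3 < 6 * int (nat (area 1 (R + 1) + 2))"
      unfolding N(1) by (simp_all add: area_def power2_eq_square algebra_simps)
    have card: "nat (area 1 (R + 1) + 2) < card (hexagon L)"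
      using card_L unfolding of_nat_less_iff[where ?'a = int, symmetric] N(1)
      by (simp add: area_def power2_eq_square algebra_simps)
    note lim = kawasaki_tendsto[OF assms(1) N(1) card N(2) P(1) refl P(2) refl]
    have shrink: "((\<lambda>\<beta>. \<P>(\<omega> in kawasaki L U \<Delta> \<beta> \<eta>.
             hitting_time (empty_config L) \<omega> < hitting_time (full_config L) \<omega>)) \<longlongrightarrow> 1) at_top"
      if \<eta>: "\<eta> \<in> E_minus L 1 (R + 1)" for \<eta>
    proof -
      obtain k i r p q where D: "i \<le> 5" "r \<ge> 1" "\<eta> = conf L ((rotate_site ^^ k) ` qhexa i r p q)"
        "qhexa i r p q \<subseteq> hexagon L" "area i r \<le> area 1 (R + 1)"
        by (rule E_minus_obtain[OF \<eta> R1(2)]) auto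
      have "r \<le> R + 1 \<and> (r = R + 1 \<longrightarrow> i \<le> 1)" using D area_less_iff[of 1 i "R + 1" r] by auto
      then have "reach L U \<Delta> (?H 1 (R + 1) + ?K) {} (qhexa i r p q)"
        using D(1,2,4) small[of "R + 1" 1] low top \<delta> by (intro reach_empty_qhexa) auto
      from lim(1)[OF D(4) this] show ?thesis by (simp add: D(3))
    qed
    have grow: "((\<lambda>\<beta>. \<P>(\<omega> in kawasaki L U \<Delta> \<beta> \<eta>.
             hitting_time (full_config L) \<omega> < hitting_time (empty_config L) \<omega>)) \<longlongrightarrow> 1) at_top"
      if \<eta>: "\<eta> \<in> E_plus L 2 (R + 1)" for \<eta>
    proof -
      obtain k i r p q where D: "i \<le> 5" "r \<ge> 1" "\<eta> = conf L ((rotate_site ^^ k) ` qhexa i r p q)"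
        "qhexa i r p q \<subseteq> hexagon L" "area 2 (R + 1) \<le> area i r"
        by (rule E_plus_obtain[OF \<eta> R1(2)]) auto
      have r: "R + 1 < r \<or> R + 1 = r \<and> 2 \<le> i" using D area_less_iff[of i 2 r "R + 1"] by auto
      \<comment> \<open>Beyond the critical droplet \<open>(R + 1, 1)\<close> no climb between
        droplets remains, since a regular hexagon that occurs here has radius greater than
        \<open>R + 1\<close>.\<close>
      then have "reach L U \<Delta> (?H 1 (R + 1) + ?K) (qhexa i r p q) (hexagon L)"
        using D(1,4) R1 L U_less low[of i r] \<delta>
        by (intro reach_qhexa_hexagon[where s = "R + 1"]) auto
      from lim(2)[OF D(4) this] show ?thesis by (simp add: D(3))
    qed
    show ?thesis using shrink grow by blast
  qed
  show ?thesis
    using case1 case3 unfolding \<delta>_def[symmetric] R_def[symmetric] by blast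
qed

end
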